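(* Let $r>0$ and let $\mathcal B$ consist of a single closed disk of radius $r$ in the Euclidean plane $\mathbb E^2$. Then there is exactly one optimally dense packing of $\mathbb E^2$ by congruent copies of this disk, up to rigid motion: an optimally dense packing exists, and any two optimally dense packings lie in the same orbit of the group of rigid motions of $\mathbb E^2$.
   Context: Let $\mathbb X^n$ be Euclidean space $\mathbb E^n$ or hyperbolic space $\mathbb H^n$ (here $\mathbb X^n=\mathbb E^2$), with origin $\mathcal O$, distance $d$, and connected group $\mathcal G^n$ of (orientation-preserving) rigid motions, with Haar measure $\nu$. A body is a connected compact set with dense interior and boundary of volume $0$. For a finite collection $\mathcal B$ of bodies, a packing is a collection of congruent copies (images under $\mathcal G^n$) of bodies from $\mathcal B$ with pairwise disjoint interiors; $\mathcal P_{\mathcal B}$ is the set of all packings. $\mathcal P_{\mathcal B}$ carries a metric in which convergence is uniform convergence on compact subsets of $\mathbb X^n$; concretely $P_j\to P$ iff every body of $P$ is the Hausdorff limit of some sequence of bodies $\beta_j\in P_j$, and every Hausdorff limit of a sequence $\beta_{j_k}\in P_{j_k}$ along a subsequence is a body of $P$. Then $\mathcal P_{\mathcal B}$ is compact and $\mathcal G^n$ acts on it continuously. For a $\mathcal G^n$-invariant Borel probability measure $\mu$ on $\mathcal P_{\mathcal B}$, its density is $D(\mu)=\mu(A)$, where $A=\{P\in\mathcal P_{\mathcal B}: \mathcal O \text{ lies in a body of } P\}$. An ergodic invariant probability measure $\bar\mu$ is optimally dense if $D(\bar\mu)=\sup_\mu D(\mu)$, the supremum being over all invariant Borel probability measures.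 Put $\mathcal G^n(r,p)=\{g\in\mathcal G^n: d(g(p),p)<r\}$. A packing $P$ is generic for an ergodic $\mu$ if $P$ is in the support of $\mu$ and for every $p\in\mathbb X^n$ and every continuous $f$ on $\mathcal P_{\mathcal B}$, $$\int_{\mathcal P_{\mathcal B}} f(Q)\,d\mu(Q)=\lim_{r\to\infty}\frac1{\nu[\mathcal G^n(r,p)]}\int_{\mathcal G^n(r,p)}f[g(P)]\,d\nu(g).$$ A packing is optimally dense if it is generic for some optimally dense measure $\mu$. *)

theory Defs
  imports "HOL-Analysis.Analysis" "HOL-Probability.Probability_Measure"
begin

section \<open>Rigid motions and Haar measure\<close>

definition rigid_motions :: "(real^'n \<Rightarrow> real^'n) set" where
  "rigid_motions = {g. \<exists>a A. rotation_matrix A \<and> g = (\<lambda>x. a + A *v x)}"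

text \<open>On the function type the library topology is that of pointwise convergence. Restricted to
  \<^const>\<open>rigid_motions\<close> it is the usual Lie group topology of the group of
  orientation-preserving isometries. As this group is locally compact and second countable, a
  left-invariant measure that is finite on compact sets is automatically regular. The group is
  unimodular, and a Haar measure is unique up to a positive factor.\<close>

definition haar_measure :: "(real^'n \<Rightarrow> real^'n) measure \<Rightarrow> bool" where
  "haar_measure \<nu> \<longleftrightarrow>
     sets \<nu> = sets (restrict_space borel rigid_motions) \<and>
     (\<forall>g\<in>rigid_motions. \<forall>S\<in>sets \<nu>. emeasure \<nu> ((\<lambda>h. g \<circ> h) ` S) = emeasure \<nu> S) \<and>
     (\<forall>K. compact K \<and> K \<subseteq> rigid_motions \<longrightarrow> emeasure \<nu> K < \<infinity>) \<and>
     emeasure \<nu> (space \<nu>) \<noteq> 0"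

definition motions_within :: "real \<Rightarrow> real^'n \<Rightarrow> (real^'n \<Rightarrow> real^'n) set" where
  "motions_within R p = {g \<in> rigid_motions. dist (g p) p < R}"


section \<open>Bodies and packings\<close>

definition body :: "(real^'n) set \<Rightarrow> bool" where
  "body S \<longleftrightarrow> S \<noteq> {} \<and> compact S \<and> connected S \<and> S \<subseteq> closure (interior S) \<and> negligible (frontier S)"

lemma body_cball: "0 < r \<Longrightarrow> body (cball c r)"
  using negligible_convex_frontier[OF convex_cball, of c r] by (auto simp: body_def)

text \<open>In the next definition, \<open>B\<close> is meant to be a finite set of bodies. The empty packing is
  included.\<close>

definition packings :: "(real^'n) set set \<Rightarrow> (real^'n) set set set" where
  "packings B = {P. P \<subseteq> {g ` S | g S. g \<in> rigid_motions \<and> S \<in> B} \<and>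
                    pairwise (\<lambda>S T. interior S \<inter> interior T = {}) P}"

definition move_packing :: "(real^'n \<Rightarrow> real^'n) \<Rightarrow> (real^'n) set set \<Rightarrow> (real^'n) set set" where
  "move_packing g P = (\<lambda>S. g ` S) ` P"


section \<open>The topology on the space of packings\<close>

text \<open>For nonempty compact sets, the following is the Hausdorff metric.\<close>

definition hausdorff_dist :: "'a::metric_space set \<Rightarrow> 'a set \<Rightarrow> real" where
  "hausdorff_dist S T = max (SUP x\<in>S. infdist x T) (SUP y\<in>T. infdist y S)"

definition hausdorff_limit :: "(nat \<Rightarrow> 'a::metric_space set) \<Rightarrow> 'a set \<Rightarrow> bool" where
  "hausdorff_limit S K \<longleftrightarrow> K \<noteq> {} \<and> compact K \<and> (\<lambda>j. hausdorff_dist (S j) K) \<longlonglongrightarrow> 0"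

text \<open>Membership in the first clause is only required eventually, so that convergence does not
  depend on finitely many terms (some of which may be the empty packing).\<close>

definition packing_converges :: "(nat \<Rightarrow> (real^'n) set set) \<Rightarrow> (real^'n) set set \<Rightarrow> bool" where
  "packing_converges Ps P \<longleftrightarrow>
     (\<forall>S\<in>P. \<exists>\<beta>. (\<forall>\<^sub>F j in sequentially. \<beta> j \<in> Ps j) \<and> hausdorff_limit \<beta> S) \<and>
     (\<forall>k \<beta> S. strict_mono k \<and> (\<forall>i. \<beta> i \<in> Ps (k i)) \<and> hausdorff_limit \<beta> S \<longrightarrow> S \<in> P)"

text \<open>The metric topology is determined by its convergent sequences: a set is open iff every
  sequence converging to one of its points is eventually inside the set.\<close>

definition packing_topology :: "(real^'n) set set \<Rightarrow> (real^'n) set set topology" where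
  "packing_topology B = topology (\<lambda>U. U \<subseteq> packings B \<and>
     (\<forall>P\<in>U. \<forall>Ps. (\<forall>j. Ps j \<in> packings B) \<and> packing_converges Ps P \<longrightarrow>
        (\<forall>\<^sub>F j in sequentially. Ps j \<in> U)))"

lemma openin_packing_topology:
  "openin (packing_topology B) U \<longleftrightarrow> U \<subseteq> packings B \<and>
     (\<forall>P\<in>U. \<forall>Ps. (\<forall>j. Ps j \<in> packings B) \<and> packing_converges Ps P \<longrightarrow>
        (\<forall>\<^sub>F j in sequentially. Ps j \<in> U))"
proof -
  define L where "L = (\<lambda>U. U \<subseteq> packings B \<and>
     (\<forall>P\<in>U. \<forall>Ps. (\<forall>j. Ps j \<in> packings B) \<and> packing_converges Ps P \<longrightarrow>
        (\<forall>\<^sub>F j in sequentially. Ps j \<in> U)))"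
  have "L (S \<inter> T)" if "L S" "L T" for S T
    using that unfolding L_def by (auto intro: eventually_conj)
  moreover have "L (\<Union>\<K>)" if K: "\<forall>S\<in>\<K>. L S" for \<K>
    unfolding L_def
  proof (intro conjI ballI allI impI)
    show "\<Union>\<K> \<subseteq> packings B" using K unfolding L_def by blast
  next
    fix P Ps assume "P \<in> \<Union>\<K>" and Ps: "(\<forall>j. Ps j \<in> packings B) \<and> packing_converges Ps P"
    then obtain S where S: "S \<in> \<K>" "P \<in> S" by blast
    then have "\<forall>\<^sub>F j in sequentially. Ps j \<in> S" using K Ps unfolding L_def by blast
    then show "\<forall>\<^sub>F j in sequentially. Ps j \<in> \<Union>\<K>"
      by (rule eventually_mono) (use S in blast)
  qed
  ultimately have "istopology L" unfolding istopology_def by blast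
  then show ?thesis
    unfolding packing_topology_def L_def[symmetric] by (simp add: topology_inverse' L_def)
qed

lemma topspace_packing_topology: "topspace (packing_topology B) = packings B"
proof
  show "topspace (packing_topology B) \<subseteq> packings B"
    using openin_packing_topology[of B] by (metis openin_topspace)
  have "openin (packing_topology B) (packings B)"
    unfolding openin_packing_topology by simp
  then show "packings B \<subseteq> topspace (packing_topology B)"
    by (rule openin_subset)
qed

definition packing_borel :: "(real^'n) set set \<Rightarrow> (real^'n) set set measure" where
  "packing_borel B = sigma (packings B) {U. openin (packing_topology B) U}"


section \<open>Invariant measures, density and genericity\<close>

definition invariant_measures :: "(real^'n) set set \<Rightarrow> (real^'n) set set measure set" where
  "invariant_measures B = {\<mu>. prob_space \<mu> \<and> sets \<mu> = sets (packing_borel B) \<and>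
     (\<forall>g\<in>rigid_motions. \<forall>A\<in>sets \<mu>. measure \<mu> (move_packing g ` A) = measure \<mu> A)}"

definition ergodic_measures :: "(real^'n) set set \<Rightarrow> (real^'n) set set measure set" where
  "ergodic_measures B = {\<mu> \<in> invariant_measures B.
     \<forall>A\<in>sets \<mu>. (\<forall>g\<in>rigid_motions. move_packing g ` A = A) \<longrightarrow> measure \<mu> A = 0 \<or> measure \<mu> A = 1}"

definition measure_density :: "(real^'n) set set \<Rightarrow> (real^'n) set set measure \<Rightarrow> real" where
  "measure_density B \<mu> = measure \<mu> {P \<in> packings B. \<exists>S\<in>P. 0 \<in> S}"

definition optimally_dense_measure :: "(real^'n) set set \<Rightarrow> (real^'n) set set measure \<Rightarrow> bool" where
  "optimally_dense_measure B \<mu> \<longleftrightarrow> \<mu> \<in> ergodic_measures B \<and>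
     measure_density B \<mu> = (SUP m\<in>invariant_measures B. measure_density B m)"

definition measure_support :: "(real^'n) set set \<Rightarrow> (real^'n) set set measure \<Rightarrow> (real^'n) set set set" where
  "measure_support B \<mu> = {P \<in> packings B.
     \<forall>U. openin (packing_topology B) U \<and> P \<in> U \<longrightarrow> measure \<mu> U > 0}"

definition generic_packing ::
  "(real^'n \<Rightarrow> real^'n) measure \<Rightarrow> (real^'n) set set \<Rightarrow> (real^'n) set set measure \<Rightarrow>
   (real^'n) set set \<Rightarrow> bool" where
  "generic_packing \<nu> B \<mu> P \<longleftrightarrow> P \<in> measure_support B \<mu> \<and>
     (\<forall>p f. continuous_map (packing_topology B) euclideanreal f \<longrightarrow>
        ((\<lambda>R. (LINT g:motions_within R p|\<nu>. f (move_packing g P)) / measure \<nu> (motions_within R p))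
           \<longlongrightarrow> (LINT Q|\<mu>. f Q)) at_top)"

definition optimally_dense_packing ::
  "(real^'n \<Rightarrow> real^'n) measure \<Rightarrow> (real^'n) set set \<Rightarrow> (real^'n) set set \<Rightarrow> bool" where
  "optimally_dense_packing \<nu> B P \<longleftrightarrow>
     (\<exists>\<mu>. optimally_dense_measure B \<mu> \<and> generic_packing \<nu> B \<mu> P)"

end

theory Submission
  imports Defs
begin
text \<open>A packing by disks of radius \<open>r\<close> is given by its set of centres, a set with mutual distances at
  least \<open>2 r\<close>. Cut the Voronoi cell of each centre by the disk of radius \<open>s = 2 r / sqrt 3\<close>. By a
  local estimate every cell has area at least \<open>2 sqrt 3 r\<^sup>2\<close>, and if all cells attain the bound then
  the centres form a hexagonal lattice: the sectors of the disk pointing at the near neighbours are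
  disjoint, and a linear map shows that in each of them the cell fills at least as large a proportion
  as in the sectors of the hexagon. Equality forces all near neighbours to distance \<open>2 r\<close> and the
  sectors to cover the disk, which turns every neighbour into a full hexagon of neighbours.

  Counting in large squares bounds the density of an invariant measure, with a strict deficit as
  soon as a nonempty open set of packings with one larger cell, or with a large hole, has positive
  measure. So the support of an optimally dense measure consists of hexagonal packings, which are all
  congruent. Conversely, writing a rigid motion as a translation by \<open>- b\<close> followed by a rotation, Haar
  measure is Lebesgue measure in \<open>b\<close>. Restricting \<open>b\<close> to a cell of the hexagonal lattice gives an
  invariant measure on the orbit of the hexagonal packing that attains the bound, and
  that packing is generic for it because functions on the orbit are periodic in \<open>b\<close>.\<close>

section \<open>Sectors and truncated Voronoi cells\<close>

text \<open>The radius \<open>s\<close> is the circumradius of an equilateral triangle of side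
  \<open>d = 2 r\<close>, and also that of the regular hexagon circumscribed about one disk. A
  smaller truncation would cut the hexagonal cell itself; with a larger one the sectors of the
  hexagon would overlap. The ratio of a sector to its triangle in the hexagon stays a symbol
  \<open>\<sigma>\<close>: six disjoint sectors bound the disk from below by \<open>\<sigma>\<close>
  times the hexagon, monotonicity bounds \<open>\<sigma>\<close> times any cell from below by the
  disk, and \<open>\<sigma>\<close> cancels. Neither angles nor the value of pi enter. Truncation
  makes a cell depend on finitely many centres. Its area is only lower semicontinuous in the
  packing, but this is the direction that makes an excess of area an open condition, so that support
  points can be tested against it. Density is a probability at one point. Hence counting uses points
  of finite grids, that is, finitely many events of equal probability, and no integration over the
  plane. Haar measure is given as left invariant, whereas periodicity of the lattice packing
  concerns right translations of the motion. The passage from one to the other goes through Lebesgue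
  measure on the fibres over the rotations.\<close>

lemma sum_dist_squared_three:
  fixes a b c :: "'a::real_inner"
  shows "(dist a b)\<^sup>2 + (dist b c)\<^sup>2 + (dist a c)\<^sup>2
    = 3 * ((norm a)\<^sup>2 + (norm b)\<^sup>2 + (norm c)\<^sup>2) - (norm (a + b + c))\<^sup>2"
  by (simp add: dist_norm power2_norm_eq_inner inner_simps inner_commute)

text \<open>Measured from \<open>u\<close>, the three squared mutual distances add up to at most 9
  s^2 minus the square of the norm of \<open>a + b + c - 3 u\<close>, and to at least 3 d^2 = 9 s^2.
  So everything is an equality: \<open>u\<close> is the centroid and lies at distance exactly
  \<open>s\<close>.\<close>

lemma no_three_close:
  fixes a b c u :: "'a::real_inner"
  assumes "d \<le> dist a b" "d \<le> dist b c" "d \<le> dist a c" "0 \<le> d" "d\<^sup>2 = 3 * s\<^sup>2"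
    and "dist u a \<le> s" "dist u b \<le> s" "dist u c \<le> s"
  shows "a + b + c = 3 *\<^sub>R u" and "dist u b = s"
proof -
  have arith: "A \<le> 0 \<and> s2 \<le> Y" if "P + Q + R = 3 * (X + Y + Z) - A" "d2 \<le> P" "d2 \<le> Q" "d2 \<le> R"
      "X \<le> s2" "Y \<le> s2" "Z \<le> s2" "d2 = 3 * s2" "0 \<le> A" for P Q R X Y Z A d2 s2 :: real
    using that by simp
  have s0: "0 \<le> s" using assms(6) zero_le_dist order_trans by blast
  have sq: "d\<^sup>2 \<le> (dist a b)\<^sup>2" "d\<^sup>2 \<le> (dist b c)\<^sup>2" "d\<^sup>2 \<le> (dist a c)\<^sup>2"
    "(dist u a)\<^sup>2 \<le> s\<^sup>2" "(dist u b)\<^sup>2 \<le> s\<^sup>2" "(dist u c)\<^sup>2 \<le> s\<^sup>2"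
    using assms(1-4,6-8) by (auto intro!: power_mono simp del: assms(5))
  have eq: "(dist a b)\<^sup>2 + (dist b c)\<^sup>2 + (dist a c)\<^sup>2
    = 3 * ((dist u a)\<^sup>2 + (dist u b)\<^sup>2 + (dist u c)\<^sup>2) - (norm (a + b + c - 3 *\<^sub>R u))\<^sup>2"
    using sum_dist_squared_three[of "a - u" "b - u" "c - u"]
    by (simp add: dist_norm norm_minus_commute algebra_simps add_diff_eq scaleR_left_distrib[of 1 2, simplified] scaleR_2)
  have "(norm (a + b + c - 3 *\<^sub>R u))\<^sup>2 \<le> 0"
    "s\<^sup>2 \<le> (dist u b)\<^sup>2"
    using arith[OF eq sq assms(5) zero_le_power2] by auto
  then show "a + b + c = 3 *\<^sub>R u" "dist u b = s"
    using sq(5) power2_le_imp_le[of s "dist u b"] assms(7) s0 by auto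
qed

section \<open>The sector of the disk facing one neighbour, in adapted linear coordinates\<close>

definition rot90 :: "real^2 \<Rightarrow> real^2" where
  "rot90 v = vector [- v $ 2, v $ 1]"

lemma rot90_nth [simp]: "rot90 v $ 1 = - v $ 2" "rot90 v $ 2 = v $ 1"
  by (simp_all add: rot90_def)

lemma inner_real2: "(x::real^2) \<bullet> y = x $ 1 * y $ 1 + x $ 2 * y $ 2"
  by (simp add: inner_vec_def sum_2)

lemma norm_sq_real2: "(norm (x::real^2))\<^sup>2 = (x $ 1)\<^sup>2 + (x $ 2)\<^sup>2"
  unfolding power2_norm_eq_inner inner_real2 by (simp add: power2_eq_square)

lemma real2_eq_iff: "(x::real^2) = y \<longleftrightarrow> x $ 1 = y $ 1 \<and> x $ 2 = y $ 2"
  by (simp add: vec_eq_iff forall_2)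

text \<open>The open cone over the arc of the circle of radius \<open>s\<close> whose points are
  closer to \<open>v\<close> than to 0: for y on that circle the second condition reads |v|^2 < 2 (y
  . v), and it is homogeneous in y. Being strict, it excludes the apex 0.\<close>

definition sector :: "real \<Rightarrow> real^2 \<Rightarrow> (real^2) set" where
  "sector s v = {y. norm y < s \<and> (norm v)\<^sup>2 * norm y < 2 * s * (y \<bullet> v)}"

text \<open>The part of the sector on the near side of the bisector of 0 and \<open>v\<close>. Its
  base is the chord in which the bisector meets the disk, so the rest of the sector is a circular
  segment.\<close>

definition triangle :: "real \<Rightarrow> real^2 \<Rightarrow> (real^2) set" where
  "triangle s v = {y \<in> sector s v. 2 * (y \<bullet> v) < (norm v)\<^sup>2}"

text \<open>The sector in the coordinates of \<open>frame\<close>, with \<open>h\<close> half the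
  distance to the neighbour. The cone and the triangle become the same for all neighbours, and the
  disk becomes an ellipse; all dependence on the distance sits in its quadratic form.\<close>

definition ref_sector :: "real \<Rightarrow> real \<Rightarrow> (real^2) set" where
  "ref_sector s h = {w. \<bar>w $ 2\<bar> < w $ 1 \<and> h\<^sup>2 * (w $ 1)\<^sup>2 + (s\<^sup>2 - h\<^sup>2) * (w $ 2)\<^sup>2 < s\<^sup>2}"

definition ref_triangle :: "(real^2) set" where
  "ref_triangle = {w. \<bar>w $ 2\<bar> < w $ 1 \<and> w $ 1 < 1}"

text \<open>Sends (1, 0) to the midpoint \<open>v / 2\<close> of the chord. With \<open>b\<close>
  the half length of the chord, (1, 1) and (1, -1) go to its end points.\<close>

definition frame :: "real \<Rightarrow> real^2 \<Rightarrow> real^2 \<Rightarrow> real^2" where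
  "frame b v w = (w $ 1 / 2) *\<^sub>R v + (w $ 2 * b / norm v) *\<^sub>R rot90 v"

lemma less_iff_power2_less: "0 \<le> a \<Longrightarrow> 0 \<le> b \<Longrightarrow> a < b \<longleftrightarrow> a\<^sup>2 < b\<^sup>2" for a b :: real
  by (metis power2_less_imp_less power_strict_mono zero_less_numeral)

lemma linear_frame: "linear (frame b v)"
  by (rule linearI) (simp_all add: frame_def real2_eq_iff algebra_simps add_divide_distrib)

lemma frame_inner: "frame b v w \<bullet> v = w $ 1 * (norm v)\<^sup>2 / 2"
  unfolding norm_sq_real2 by (simp add: frame_def inner_real2 algebra_simps power2_eq_square add_divide_distrib)

lemma norm_frame:
  assumes "v \<noteq> 0"
  shows "(norm (frame b v w))\<^sup>2 = (norm v / 2)\<^sup>2 * (w $ 1)\<^sup>2 + b\<^sup>2 * (w $ 2)\<^sup>2"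
proof -
  have o: "v \<bullet> rot90 v = 0" and n: "(norm (rot90 v))\<^sup>2 = (norm v)\<^sup>2"
    by (simp_all add: inner_real2 norm_sq_real2)
  have "(norm (frame b v w))\<^sup>2 = (norm ((w $ 1 / 2) *\<^sub>R v))\<^sup>2 + (norm ((w $ 2 * b / norm v) *\<^sub>R rot90 v))\<^sup>2"
    unfolding frame_def by (rule norm_add_Pythagorean) (simp add: orthogonal_def o)
  also have "\<dots> = (w $ 1 / 2)\<^sup>2 * (norm v)\<^sup>2 + (w $ 2 * b / norm v)\<^sup>2 * (norm v)\<^sup>2"
    by (simp add: power_mult_distrib n power_divide)
  also have "\<dots> = (norm v / 2)\<^sup>2 * (w $ 1)\<^sup>2 + b\<^sup>2 * (w $ 2)\<^sup>2"
    using assms by (simp add: power_divide power_mult_distrib)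
  finally show ?thesis .
qed

lemma surj_frame:
  assumes "v \<noteq> 0" "b \<noteq> 0"
  shows "\<exists>w. y = frame b v w"
proof
  define S where "S = (v $ 1)\<^sup>2 + (v $ 2)\<^sup>2"
  have S: "S \<noteq> 0" "norm v \<noteq> 0"
    using assms norm_sq_real2[of v] by (auto simp: S_def)
  let ?w = "vector [2 * (y \<bullet> v) / S, (y \<bullet> rot90 v) * norm v / (b * S)] :: real^2"
  have "frame b v ?w = ((y \<bullet> v) / S) *\<^sub>R v + ((y \<bullet> rot90 v) / S) *\<^sub>R rot90 v"
    unfolding frame_def using assms(2) S by simp
  also have "\<dots> = (1 / S) *\<^sub>R ((y \<bullet> v) *\<^sub>R v + (y \<bullet> rot90 v) *\<^sub>R rot90 v)"
    by (simp add: scaleR_right_distrib)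
  also have "(y \<bullet> v) *\<^sub>R v + (y \<bullet> rot90 v) *\<^sub>R rot90 v = S *\<^sub>R y"
    by (simp add: real2_eq_iff inner_real2 S_def algebra_simps power2_eq_square)
  also have "(1 / S) *\<^sub>R S *\<^sub>R y = y" using S(1) by simp
  finally show "y = frame b v ?w" by simp
qed

lemma abs_det_frame:
  assumes "v \<noteq> 0" "0 < b"
  shows "\<bar>det (matrix (frame b v))\<bar> = norm v / 2 * b"
proof -
  have "det (matrix (frame b v)) = (v $ 1 * (v $ 1) + v $ 2 * (v $ 2)) / 2 * (b / norm v)"
    by (simp add: det_2 matrix_def frame_def axis_def field_simps flip: add_divide_distrib)
  also have "v $ 1 * (v $ 1) + v $ 2 * (v $ 2) = norm v * norm v"
    using norm_sq_real2[of v] by (simp add: power2_eq_square)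
  also have "norm v * norm v / 2 * (b / norm v) = norm v / 2 * b"
    using assms by simp
  finally show ?thesis using assms by (simp only: abs_of_pos) (simp add: abs_mult)
qed

lemma sector_eq_frame:
  assumes "v \<noteq> 0" "norm v < 2 * s" "b = sqrt (s\<^sup>2 - (norm v / 2)\<^sup>2)"
  shows "0 < b" "sector s v = frame b v ` ref_sector s (norm v / 2)"
    "triangle s v = frame b v ` ref_triangle"
proof -
  define h where "h = norm v / 2"
  have h: "0 < h" "h < s" "norm v = 2 * h" using assms by (auto simp: h_def)
  have b2: "b\<^sup>2 = s\<^sup>2 - h\<^sup>2" "0 < b"
  proof -
    have "h\<^sup>2 < s\<^sup>2" using h by (simp add: power_strict_mono)
    then show "b\<^sup>2 = s\<^sup>2 - h\<^sup>2" "0 < b" by (auto simp: assms(3) h_def)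
  qed
  then show "0 < b" by simp
  have bp: "0 < s\<^sup>2 - h\<^sup>2" using b2 by (metis zero_less_power)
  have nf: "(norm (frame b v w))\<^sup>2 = h\<^sup>2 * (w $ 1)\<^sup>2 + (s\<^sup>2 - h\<^sup>2) * (w $ 2)\<^sup>2" for w
    using norm_frame[OF assms(1), of b w] b2 by (simp add: h_def)
  have c1: "norm (frame b v w) < s \<longleftrightarrow> h\<^sup>2 * (w $ 1)\<^sup>2 + (s\<^sup>2 - h\<^sup>2) * (w $ 2)\<^sup>2 < s\<^sup>2" for w
    unfolding nf[symmetric] using h by (intro less_iff_power2_less) auto
  \<comment> \<open>After squaring, h^2 + b^2 = s^2 removes the first coordinate from one side and
    leaves the comparison of the two coordinates of \<open>w\<close>.\<close>
  have c2: "(norm v)\<^sup>2 * norm (frame b v w) < 2 * s * (frame b v w \<bullet> v) \<longleftrightarrow> \<bar>w $ 2\<bar> < w $ 1" for w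
  proof -
    have "(norm v)\<^sup>2 * norm (frame b v w) < 2 * s * (frame b v w \<bullet> v) \<longleftrightarrow> norm (frame b v w) < s * w $ 1"
      using h assms(1) by (simp add: frame_inner)
    also have "\<dots> \<longleftrightarrow> 0 < w $ 1 \<and> (norm (frame b v w))\<^sup>2 < (s * w $ 1)\<^sup>2"
    proof -
      have "0 < w $ 1" if "norm (frame b v w) < s * w $ 1"
        using that h by (smt (verit) norm_ge_zero zero_less_mult_iff)
      then show ?thesis
        using h less_iff_power2_less[of "norm (frame b v w)" "s * w $ 1"] by auto
    qed
    also have "\<dots> \<longleftrightarrow> 0 < w $ 1 \<and> (s\<^sup>2 - h\<^sup>2) * (w $ 2)\<^sup>2 < (s\<^sup>2 - h\<^sup>2) * (w $ 1)\<^sup>2"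
      unfolding nf by (auto simp: power_mult_distrib algebra_simps)
    also have "\<dots> \<longleftrightarrow> 0 < w $ 1 \<and> (w $ 2)\<^sup>2 < (w $ 1)\<^sup>2"
      using bp by (simp add: mult_less_cancel_left_pos)
    also have "\<dots> \<longleftrightarrow> \<bar>w $ 2\<bar> < w $ 1"
      using less_iff_power2_less[of "\<bar>w $ 2\<bar>" "w $ 1"] by auto
    finally show ?thesis .
  qed
  have c3: "2 * (frame b v w \<bullet> v) < (norm v)\<^sup>2 \<longleftrightarrow> w $ 1 < 1" for w
    using assms(1) by (simp add: frame_inner)
  \<comment> \<open>The two coefficients add up to s^2, so the triangle lies inside the ellipse by
    itself.\<close>
  have c4: "h\<^sup>2 * (w $ 1)\<^sup>2 + (s\<^sup>2 - h\<^sup>2) * (w $ 2)\<^sup>2 < s\<^sup>2" if "\<bar>w $ 2\<bar> < w $ 1" "w $ 1 < 1" for w :: "real^2"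
  proof -
    have "(w $ 1)\<^sup>2 < 1" "(w $ 2)\<^sup>2 < 1"
      using that by (auto simp: abs_square_less_1)
    then have "h\<^sup>2 * (w $ 1)\<^sup>2 < h\<^sup>2 * 1" "(s\<^sup>2 - h\<^sup>2) * (w $ 2)\<^sup>2 < (s\<^sup>2 - h\<^sup>2) * 1"
      using h bp by (auto intro: mult_strict_left_mono simp del: mult_1_right)
    then show ?thesis by simp
  qed
  have img: "S = frame b v ` T" if "\<And>w. frame b v w \<in> S \<longleftrightarrow> w \<in> T" for S T
  proof (intro equalityI subsetI)
    fix y assume y: "y \<in> S"
    obtain w where "y = frame b v w" using surj_frame[OF assms(1), of b y] b2(2) by auto
    then show "y \<in> frame b v ` T" using that[of w] y by simp
  next
    fix y assume "y \<in> frame b v ` T"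
    then obtain w where "y = frame b v w" "w \<in> T" by (elim imageE)
    then show "y \<in> S" using that[of w] by simp
  qed
  show "sector s v = frame b v ` ref_sector s (norm v / 2)"
    by (rule img) (unfold sector_def ref_sector_def h_def[symmetric] mem_Collect_eq c1 c2, rule conj_commute)
  show "triangle s v = frame b v ` ref_triangle"
    by (rule img) (unfold triangle_def sector_def ref_triangle_def mem_Collect_eq c1 c2 c3, intro iffI conjI; (elim conjE)?; (rule c4)?; assumption)
qed

lemma open_sector: "open (sector s v)"
proof -
  have *: "sector s v = {y. norm y < s} \<inter> {y. (norm v)\<^sup>2 * norm y < 2 * s * (y \<bullet> v)}"
    by (auto simp: sector_def)
  show ?thesis unfolding * by (intro open_Int open_Collect_less continuous_intros)
qed

lemma open_triangle: "open (triangle s v)"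
proof -
  have *: "triangle s v = sector s v \<inter> {y. 2 * (y \<bullet> v) < (norm v)\<^sup>2}"
    by (auto simp: triangle_def)
  show ?thesis unfolding * by (intro open_Int open_sector open_Collect_less continuous_intros)
qed

lemma open_ref_sector: "open (ref_sector s h)"
proof -
  have *: "ref_sector s h = {w. \<bar>w $ 2\<bar> < w $ 1} \<inter> {w. h\<^sup>2 * (w $ 1)\<^sup>2 + (s\<^sup>2 - h\<^sup>2) * (w $ 2)\<^sup>2 < s\<^sup>2}"
    by (auto simp: ref_sector_def)
  show ?thesis unfolding * by (intro open_Int open_Collect_less continuous_intros)
qed

lemma bounded_ref_sector: "0 < h \<Longrightarrow> h \<le> s \<Longrightarrow> bounded (ref_sector s h)"
proof (rule bounded_subset[OF bounded_cball[of 0 "2 * s / h"]], rule subsetI)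
  fix w assume h: "0 < h" "h \<le> s" and "w \<in> ref_sector s h"
  then have w: "\<bar>w $ 2\<bar> < w $ 1" "h\<^sup>2 * (w $ 1)\<^sup>2 + (s\<^sup>2 - h\<^sup>2) * (w $ 2)\<^sup>2 < s\<^sup>2"
    by (auto simp: ref_sector_def)
  have "h\<^sup>2 \<le> s\<^sup>2" using h by (simp add: power_mono)
  then have "0 \<le> (s\<^sup>2 - h\<^sup>2) * (w $ 2)\<^sup>2" by simp
  then have "(h * w $ 1)\<^sup>2 < s\<^sup>2" using w(2) by (simp only: power_mult_distrib)
  then have "h * w $ 1 < s"
    by (rule power2_less_imp_less) (use h in linarith)
  then have 1: "w $ 1 < s / h" using h by (simp only: pos_less_divide_eq mult.commute)
  have "(norm w)\<^sup>2 \<le> (2 * w $ 1)\<^sup>2"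
  proof -
    have "(w $ 2)\<^sup>2 \<le> (w $ 1)\<^sup>2" using abs_le_square_iff[of "w $ 2" "w $ 1"] w(1) by linarith
    moreover have "(2 * w $ 1)\<^sup>2 = 4 * (w $ 1)\<^sup>2" by simp
    moreover have "0 \<le> (w $ 1)\<^sup>2" by simp
    ultimately show ?thesis using norm_sq_real2[of w] by linarith
  qed
  then have "norm w \<le> 2 * w $ 1" by (rule power2_le_imp_le) (use w(1) in linarith)
  then show "w \<in> cball 0 (2 * s / h)" using 1 by simp
qed

lemma lmeasurable_ref_sector: "0 < h \<Longrightarrow> h \<le> s \<Longrightarrow> ref_sector s h \<in> lmeasurable"
  by (intro lmeasurable_open bounded_ref_sector open_ref_sector)

text \<open>At \<open>h = s\<close> the second coefficient vanishes and the ellipse degenerates to a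
  strip. So the triangle is the end point of the family of sectors, and monotonicity in
  \<open>h\<close> compares sectors with triangles as well.\<close>

lemma ref_triangle_eq: "0 < s \<Longrightarrow> ref_triangle = ref_sector s s"
proof -
  assume s: "0 < s"
  have "w $ 1 < 1 \<longleftrightarrow> s\<^sup>2 * (w $ 1)\<^sup>2 < s\<^sup>2" if "\<bar>w $ 2\<bar> < w $ 1" for w :: "real^2"
    using less_iff_power2_less[of "w $ 1" 1] that s by auto
  then show ?thesis by (auto simp: ref_triangle_def ref_sector_def)
qed

lemma lmeasurable_ref_triangle: "ref_triangle \<in> lmeasurable"
  using ref_triangle_eq[of 1] lmeasurable_ref_sector[of 1 1] by simp

lemma bounded_sector: "bounded (sector s v)"
  by (rule bounded_subset[OF bounded_ball[of 0 s]]) (auto simp: sector_def)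

lemma bounded_triangle: "bounded (triangle s v)"
  by (rule bounded_subset[OF bounded_sector[of s v]]) (auto simp: triangle_def)

text \<open>The closed triangle \<open>K\<close> has area 1 by the determinant formula and exceeds
  the open one only by points on three lines.\<close>

lemma ref_triangle_area_ge: "1 \<le> measure lebesgue ref_triangle"
proof -
  define K where "K = convex hull {0 :: real^2, vector [1, 1], vector [1, -1]}"
  define Z :: "(real^2) set" where "Z = {w. vector [1, -1] \<bullet> w = 0} \<union> {w. vector [1, 1] \<bullet> w = 0} \<union> {w. vector [1, 0] \<bullet> w = 1}"
  have nz: "(vector [a, b] :: real^2) \<noteq> 0" if "a \<noteq> 0" for a b using that by (simp add: real2_eq_iff)
  have Z: "negligible Z"
    unfolding Z_def by (intro negligible_Un negligible_hyperplane disjI1 nz) auto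
  have "K \<subseteq> {w. \<bar>w $ 2\<bar> \<le> w $ 1 \<and> w $ 1 \<le> 1}"
  proof -
    have "convex {w :: real^2. \<bar>w $ 2\<bar> \<le> w $ 1 \<and> w $ 1 \<le> 1}"
    proof -
      have *: "{w :: real^2. \<bar>w $ 2\<bar> \<le> w $ 1 \<and> w $ 1 \<le> 1} = {w. vector [-1, 1] \<bullet> w \<le> 0} \<inter> {w. vector [-1, -1] \<bullet> w \<le> 0} \<inter> {w. vector [1, 0] \<bullet> w \<le> 1}"
        by (auto simp: inner_real2)
      show ?thesis unfolding * by (intro convex_Int convex_halfspace_le)
    qed
    then show ?thesis unfolding K_def by (intro hull_minimal) auto
  qed
  then have "K \<subseteq> ref_triangle \<union> Z"
    by (auto simp: ref_triangle_def Z_def inner_real2)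
  have "1 = measure lebesgue K"
    unfolding K_def by (subst measure_completion) (auto simp: content_triangle intro!: borel_closed compact_imp_closed compact_convex_hull)
  also have "\<dots> \<le> measure lebesgue (ref_triangle \<union> Z)"
  proof (rule measure_mono_fmeasurable)
    show "K \<in> sets lebesgue" unfolding K_def
      by (intro lmeasurable_compact[THEN fmeasurableD] compact_convex_hull) auto
    show "ref_triangle \<union> Z \<in> lmeasurable"
      by (rule fmeasurable.Un[OF lmeasurable_ref_triangle negligible_imp_measurable[OF Z]])
  qed fact
  also have "\<dots> \<le> measure lebesgue ref_triangle + measure lebesgue Z"
    by (rule measure_Un_le[OF fmeasurableD[OF lmeasurable_ref_triangle] fmeasurableD[OF negligible_imp_measurable[OF Z]]])
  also have "measure lebesgue Z = 0" by (rule negligible_imp_measure0[OF Z])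
  finally show ?thesis by simp
qed

lemma measure_sector_triangle:
  assumes "v \<noteq> 0" "norm v < 2 * s" "b = sqrt (s\<^sup>2 - (norm v / 2)\<^sup>2)"
  shows "measure lebesgue (sector s v) = norm v / 2 * b * measure lebesgue (ref_sector s (norm v / 2))"
    and "measure lebesgue (triangle s v) = norm v / 2 * b * measure lebesgue ref_triangle"
proof -
  note f = sector_eq_frame[OF assms]
  have m: "ref_sector s (norm v / 2) \<in> lmeasurable" "ref_triangle \<in> lmeasurable"
    using assms lmeasurable_ref_triangle by (auto intro: lmeasurable_ref_sector)
  show "measure lebesgue (sector s v) = norm v / 2 * b * measure lebesgue (ref_sector s (norm v / 2))"
    unfolding f(2) measure_linear_image[OF linear_frame m(1)] abs_det_frame[OF assms(1) f(1)] ..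
  show "measure lebesgue (triangle s v) = norm v / 2 * b * measure lebesgue ref_triangle"
    unfolding f(3) measure_linear_image[OF linear_frame m(2)] abs_det_frame[OF assms(1) f(1)] ..
qed

text \<open>The two quadratic forms differ by (h^2 - k^2) (w1^2 - w2^2), which is nonnegative on the
  cone. In normalised coordinates a more distant neighbour thus has a smaller sector over the same
  triangle.\<close>

lemma ref_sector_mono:
  assumes "0 < k" "k \<le> h" shows "ref_sector s h \<subseteq> ref_sector s k"
proof
  fix w assume w: "w \<in> ref_sector s h"
  then have "(w $ 2)\<^sup>2 \<le> (w $ 1)\<^sup>2" unfolding ref_sector_def
    by (auto simp: abs_le_square_iff[symmetric])
  moreover have "k\<^sup>2 \<le> h\<^sup>2" using assms by (simp add: power_mono)
  ultimately have "0 \<le> (h\<^sup>2 - k\<^sup>2) * ((w $ 1)\<^sup>2 - (w $ 2)\<^sup>2)" by simp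
  then show "w \<in> ref_sector s k" using w by (auto simp: ref_sector_def algebra_simps)
qed

lemma measure_less_of_open_gap:
  fixes S T U :: "'a::euclidean_space set"
  assumes "S \<in> lmeasurable" "T \<in> lmeasurable" "S \<subseteq> T" "open U" "U \<noteq> {}" "U \<subseteq> T" "U \<inter> S = {}"
  shows "measure lebesgue S < measure lebesgue T"
proof -
  have U: "U \<in> lmeasurable"
    using assms(2,4,6) by (metis borel_open fmeasurableI2 lborelD sets_completionI_sets)
  then have "0 < measure lebesgue U"
    using open_not_negligible[OF assms(4,5)] by (metis measure_nonneg less_eq_real_def negligible_iff_measure)
  moreover have "measure lebesgue S + measure lebesgue U = measure lebesgue (S \<union> U)"
    using assms U by (subst measure_Un3) (auto simp: Int_commute)
  moreover have "\<dots> \<le> measure lebesgue T"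
    using assms U by (intro measure_mono_fmeasurable) auto
  ultimately show ?thesis by linarith
qed

lemma measure_ref_sector_less:
  assumes "0 < k" "k < h" "h \<le> s"
  shows "measure lebesgue (ref_sector s h) < measure lebesgue (ref_sector s k)"
proof (rule measure_less_of_open_gap)
  let ?U = "ref_sector s k \<inter> {w. s\<^sup>2 < h\<^sup>2 * (w $ 1)\<^sup>2 + (s\<^sup>2 - h\<^sup>2) * (w $ 2)\<^sup>2}"
  show "open ?U" by (intro open_Int open_ref_sector open_Collect_less continuous_intros)
  \<comment> \<open>On the axis the ellipses for \<open>h\<close> and \<open>k\<close> end at
    \<open>s / h\<close> and \<open>s / k\<close>; a point strictly between them witnesses the
    gap.\<close>
  obtain p where p: "s / h < p" "p < s / k"
    using assms dense[of "s / h" "s / k"] by (auto simp: divide_strict_left_mono)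
  moreover have "0 < s / h" using assms by simp
  ultimately have "0 < p" by linarith
  have "s < h * p" "k * p < s"
    using p assms by (simp_all add: pos_divide_less_eq pos_less_divide_eq mult.commute)
  then have "s\<^sup>2 < (h * p)\<^sup>2" "(k * p)\<^sup>2 < s\<^sup>2" using assms \<open>0 < p\<close> by (auto intro!: power_strict_mono simp del: power_mult_distrib)
  then have "vector [p, 0] \<in> ?U" using \<open>0 < p\<close> by (simp add: ref_sector_def power_mult_distrib)
  then show "?U \<noteq> {}" by blast
  show "?U \<inter> ref_sector s h = {}" by (auto simp: ref_sector_def)
  show "ref_sector s h \<subseteq> ref_sector s k" using assms by (intro ref_sector_mono) auto
  show "ref_sector s h \<in> lmeasurable" "ref_sector s k \<in> lmeasurable"
    using assms by (auto intro: lmeasurable_ref_sector)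
qed blast

lemma measure_ref_sector_gt_1:
  assumes "0 < h" "h < s"
  shows "1 < measure lebesgue (ref_sector s h)"
  using ref_triangle_area_ge measure_ref_sector_less[of h s s] assms by (simp add: ref_triangle_eq[of s])

lemma sector_circle:
  assumes "y \<in> sector s v" "v \<noteq> 0" "0 < s"
  shows "0 < norm y" "dist ((s / norm y) *\<^sub>R y) v < s"
proof -
  show y: "0 < norm y" using assms by (auto simp: sector_def)
  let ?u = "(s / norm y) *\<^sub>R y"
  have "(norm v)\<^sup>2 < 2 * (?u \<bullet> v)"
    using assms(1) y unfolding sector_def mem_Collect_eq inner_scaleR_left
    by (simp add: pos_less_divide_eq mult_ac)
  moreover have "(dist ?u v)\<^sup>2 = (norm ?u)\<^sup>2 - 2 * (?u \<bullet> v) + (norm v)\<^sup>2"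
    unfolding dist_norm power2_norm_eq_inner by (simp add: inner_diff inner_commute)
  moreover have "norm ?u = s" using y assms by simp
  ultimately have "(dist ?u v)\<^sup>2 < s\<^sup>2" by simp
  then show "dist ?u v < s" using assms by (metis less_imp_le power2_less_imp_less)
qed

text \<open>A common point, moved radially to the circle of radius \<open>s\<close>, would be within
  \<open>s\<close> of the three separated points 0, \<open>v\<close>, \<open>w\<close>. Then its
  distance to \<open>v\<close> is exactly \<open>s\<close>, but inside a sector it is strictly
  smaller.\<close>

lemma sector_disjoint:
  assumes "d \<le> norm v" "d \<le> norm w" "d \<le> dist v w" "0 < d" "d\<^sup>2 = 3 * s\<^sup>2" "0 < s"
  shows "sector s v \<inter> sector s w = {}"
proof (rule ccontr)
  assume "\<not> ?thesis"
  then obtain y where y: "y \<in> sector s v" "y \<in> sector s w" by blast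
  have nz: "v \<noteq> 0" "w \<noteq> 0" using assms by auto
  have "dist ((s / norm y) *\<^sub>R y) v = s"
    by (rule no_three_close(2)[of d 0 v w])
      (use assms nz y sector_circle[of y s v] sector_circle[of y s w] in \<open>auto simp: less_imp_le\<close>)
  then show False using sector_circle(2)[OF y(1) nz(1)] assms by simp
qed

text \<open>The truncated cell of the origin: the inequality for \<open>v\<close> says that y is
  closer to 0 than to \<open>v\<close>.\<close>

definition voronoi0 :: "real \<Rightarrow> (real^2) set \<Rightarrow> (real^2) set" where
  "voronoi0 s N = {y. norm y < s \<and> (\<forall>v\<in>N. 2 * (y \<bullet> v) < (norm v)\<^sup>2)}"

section \<open>The area of a single truncated cell and the case of equality\<close>

locale local_configuration =
  fixes d s :: real and N :: "(real^2) set"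
  assumes d_pos: "0 < d" and s_pos: "0 < s" and d_s: "d\<^sup>2 = 3 * s\<^sup>2"
    and fin: "finite N" and far: "v \<in> N \<Longrightarrow> d \<le> norm v" and near: "v \<in> N \<Longrightarrow> norm v < 2 * s"
    and sep: "v \<in> N \<Longrightarrow> w \<in> N \<Longrightarrow> v \<noteq> w \<Longrightarrow> d \<le> dist v w"
begin

text \<open>The ratio of a sector to its triangle for a neighbour at the least distance
  \<open>d\<close>, in coordinates where the triangle has area 1.\<close>

abbreviation "\<sigma> \<equiv> measure lebesgue (ref_sector s (d / 2))"
abbreviation "area S \<equiv> measure lebesgue (S :: (real^2) set)"

lemma d_less: "d < 2 * s"
proof -
  have "d\<^sup>2 < (2 * s)\<^sup>2" using d_s s_pos by (simp add: power_mult_distrib)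
  then show ?thesis using s_pos by (metis less_imp_le mult_pos_pos power2_less_imp_less zero_less_numeral)
qed

lemma nonzero: "v \<in> N \<Longrightarrow> v \<noteq> 0"
  using far d_pos by fastforce

lemma \<sigma>_gt_1: "1 < \<sigma>"
  using measure_ref_sector_gt_1[of "d / 2" s] d_less d_pos by simp

lemma lmeasurable_sector: "sector s v \<in> lmeasurable" and lmeasurable_triangle: "triangle s v \<in> lmeasurable"
  by (auto intro: lmeasurable_open open_sector open_triangle bounded_sector bounded_triangle)

lemma sum_sectors_eq: "(\<Sum>v\<in>N. area (sector s v)) = area (\<Union>v\<in>N. sector s v)"
proof -
  have "disjoint_family_on (sector s) N"
    unfolding disjoint_family_on_def using sector_disjoint far sep d_pos d_s s_pos by meson
  then show ?thesis
    using fin lmeasurable_sector fmeasurableD2[OF lmeasurable_sector]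
    by (intro measure_finite_Union[symmetric]) (auto dest: fmeasurableD)
qed

lemma sum_sectors_le: "(\<Sum>v\<in>N. area (sector s v)) \<le> area (ball 0 s)"
  unfolding sum_sectors_eq using fin lmeasurable_sector
  by (intro measure_mono_fmeasurable fmeasurableD fmeasurable.finite_UN) (auto simp: sector_def)

text \<open>Sector and triangle of \<open>v\<close> are images under the same linear map, so its
  determinant drops out of their ratio. What remains is \<open>ref_sector\<close> at half the norm
  of \<open>v\<close>, which is largest at \<open>d / 2\<close>.\<close>

lemma triangle_sector_ratio:
  assumes "v \<in> N"
  shows "area (sector s v) \<le> \<sigma> * area (triangle s v)"
    "d < norm v \<Longrightarrow> area (sector s v) < \<sigma> * area (triangle s v)"
proof -
  define b where "b = sqrt (s\<^sup>2 - (norm v / 2)\<^sup>2)"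
  have v: "v \<noteq> 0" "norm v < 2 * s" using assms nonzero near by auto
  note m = measure_sector_triangle[OF v b_def]
  have hb: "0 < norm v / 2 * b" using sector_eq_frame(1)[OF v b_def] v by simp
  have "area (sector s v) \<le> norm v / 2 * b * \<sigma>"
    unfolding m(1) using hb far[OF assms] near[OF assms] d_pos
    by (intro mult_left_mono measure_mono_fmeasurable ref_sector_mono fmeasurableD lmeasurable_ref_sector) auto
  moreover have t: "norm v / 2 * b * \<sigma> \<le> \<sigma> * area (triangle s v)"
  proof -
    have "norm v / 2 * b * \<sigma> * 1 \<le> norm v / 2 * b * \<sigma> * area ref_triangle"
      using hb \<sigma>_gt_1 ref_triangle_area_ge by (intro mult_left_mono) auto
    then show ?thesis unfolding m(2) by (simp add: mult_ac)
  qed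
  ultimately show "area (sector s v) \<le> \<sigma> * area (triangle s v)" by linarith
  assume "d < norm v"
  then have "area (sector s v) < norm v / 2 * b * \<sigma>"
    unfolding m(1) using hb near[OF assms] d_pos
    by (intro mult_strict_left_mono measure_ref_sector_less) auto
  with t show "area (sector s v) < \<sigma> * area (triangle s v)" by linarith
qed

text \<open>The bisector of \<open>v\<close> cuts the disk only inside the sector of
  \<open>v\<close>: outside it a point of norm below \<open>s\<close> satisfies the inequality of
  the cell automatically. So the cell loses at most the circular segments.\<close>

lemma voronoi0_area:
  "area (ball 0 s) - (\<Sum>v\<in>N. area (sector s v) - area (triangle s v)) \<le> area (voronoi0 s N)"
proof -
  have 1: "ball 0 s - (\<Union>v\<in>N. sector s v - triangle s v) \<subseteq> voronoi0 s N"
  proof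
    fix y assume y: "y \<in> ball 0 s - (\<Union>v\<in>N. sector s v - triangle s v)"
    have "2 * (y \<bullet> v) < (norm v)\<^sup>2" if v: "v \<in> N" for v
    proof (cases "y \<in> sector s v")
      case True then show ?thesis using y v by (auto simp: triangle_def)
    next
      case False
      then have "s * (2 * (y \<bullet> v)) \<le> (norm v)\<^sup>2 * norm y" using y by (simp add: sector_def not_less mult_ac)
      also have "\<dots> < (norm v)\<^sup>2 * s" using y nonzero[OF v] by (intro mult_strict_left_mono) auto
      finally show ?thesis using s_pos by (simp add: mult.commute)
    qed
    then show "y \<in> voronoi0 s N" using y by (simp add: voronoi0_def)
  qed
  have m: "sector s v - triangle s v \<in> lmeasurable" for v
    using lmeasurable_sector lmeasurable_triangle by blast
  have "area (\<Union>v\<in>N. sector s v - triangle s v) \<le> (\<Sum>v\<in>N. area (sector s v - triangle s v))"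
    using fin m by (intro measure_UNION_le) auto
  also have "\<dots> = (\<Sum>v\<in>N. area (sector s v) - area (triangle s v))"
    by (intro sum.cong refl measurable_measure_Diff)
      (auto simp: triangle_def intro: lmeasurable_sector lmeasurable_triangle[THEN fmeasurableD, unfolded triangle_def])
  finally have "area (\<Union>v\<in>N. sector s v - triangle s v) \<le> (\<Sum>v\<in>N. area (sector s v) - area (triangle s v))" .
  moreover have U: "(\<Union>v\<in>N. sector s v - triangle s v) \<in> lmeasurable"
    using fin m by (intro fmeasurable.finite_UN) auto
  moreover have "(\<Union>v\<in>N. sector s v - triangle s v) \<subseteq> ball 0 s" by (auto simp: sector_def)
  ultimately have "area (ball 0 s) - (\<Sum>v\<in>N. area (sector s v) - area (triangle s v))
      \<le> area (ball 0 s - (\<Union>v\<in>N. sector s v - triangle s v))"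
    by (subst measurable_measure_Diff) auto
  also have "\<dots> \<le> area (voronoi0 s N)"
  proof (rule measure_mono_fmeasurable[OF 1])
    show "ball 0 s - (\<Union>v\<in>N. sector s v - triangle s v) \<in> sets lebesgue"
      using U by (auto intro: fmeasurableD)
    have "voronoi0 s N = ball 0 s \<inter> (\<Inter>v\<in>N. {y. 2 * (y \<bullet> v) < (norm v)\<^sup>2})"
      by (auto simp: voronoi0_def)
    also have "open \<dots>" using fin by (intro open_Int open_INT open_Collect_less continuous_intros ballI) auto
    finally show "voronoi0 s N \<in> lmeasurable"
      by (intro lmeasurable_open bounded_subset[OF bounded_ball[of 0 s]]) (auto simp: voronoi0_def)
  qed
  finally show ?thesis .
qed

text \<open>With A, S, T for the disk, the sectors and the triangles, the cell is at least A - S +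
  T. Since \<open>\<sigma>\<close> T is at least S, multiplying by \<open>\<sigma>\<close> gives at
  least A + (\<open>\<sigma>\<close> - 1) (A - S), and S is at most A by disjointness.\<close>

lemma voronoi0_ge: "area (ball 0 s) \<le> \<sigma> * area (voronoi0 s N)"
proof -
  let ?S = "\<Sum>v\<in>N. area (sector s v)" and ?T = "\<Sum>v\<in>N. area (triangle s v)"
  have "?S \<le> \<sigma> * ?T" unfolding sum_distrib_left by (intro sum_mono triangle_sector_ratio)
  moreover have "\<sigma> * (area (ball 0 s) - (?S - ?T)) \<le> \<sigma> * area (voronoi0 s N)"
    using voronoi0_area \<sigma>_gt_1 by (intro mult_left_mono) (auto simp: sum_subtractf)
  moreover have "0 \<le> (\<sigma> - 1) * (area (ball 0 s) - ?S)"
    using sum_sectors_le \<sigma>_gt_1 by simp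
  ultimately show ?thesis by (simp add: algebra_simps)
qed

text \<open>Both estimates behind \<open>voronoi0_ge\<close> turn into equalities. As
  \<open>\<sigma> > 1\<close>, one of them says that the sectors fill the disk in area; the other
  would be strict if some neighbour were farther than \<open>d\<close>.\<close>

lemma voronoi0_eq:
  assumes "\<sigma> * area (voronoi0 s N) \<le> area (ball 0 s)"
  shows "(\<Sum>v\<in>N. area (sector s v)) = area (ball 0 s)" "v \<in> N \<Longrightarrow> norm v = d"
proof -
  let ?S = "\<Sum>v\<in>N. area (sector s v)" and ?T = "\<Sum>v\<in>N. area (triangle s v)"
  have 1: "?S \<le> \<sigma> * ?T" unfolding sum_distrib_left by (intro sum_mono triangle_sector_ratio)
  have "\<sigma> * (area (ball 0 s) - (?S - ?T)) \<le> \<sigma> * area (voronoi0 s N)"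
    using voronoi0_area \<sigma>_gt_1 by (intro mult_left_mono) (auto simp: sum_subtractf)
  then have 2: "\<sigma> * (area (ball 0 s) - (?S - ?T)) \<le> area (ball 0 s)" using assms by linarith
  have 3: "0 \<le> (\<sigma> - 1) * (area (ball 0 s) - ?S)"
    using sum_sectors_le \<sigma>_gt_1 by simp
  have 4: "(\<sigma> - 1) * (area (ball 0 s) - ?S) = 0" "?S = \<sigma> * ?T"
    using 1 2 3 by (simp_all add: algebra_simps)
  then show "?S = area (ball 0 s)" using \<sigma>_gt_1 by simp
  assume v: "v \<in> N"
  show "norm v = d"
  proof (rule ccontr)
    assume "norm v \<noteq> d"
    then have "area (sector s v) < \<sigma> * area (triangle s v)"
      using far[OF v] by (intro triangle_sector_ratio(2) v) simp
    then have "?S < (\<Sum>v\<in>N. \<sigma> * area (triangle s v))"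
      using v by (intro sum_strict_mono_ex1[OF fin] ballI triangle_sector_ratio(1)) auto
    then show False using 4(2) by (simp add: sum_distrib_left)
  qed
qed

text \<open>\<open>u\<close> is an end point of the arc of \<open>v\<close>. If no other neighbour
  were within \<open>s\<close> of it, the directions just beyond \<open>u\<close> would avoid all
  closed sectors, leaving an open gap in the disk. So there is a second neighbour \<open>w\<close>
  near \<open>u\<close>, and \<open>no_three_close\<close> identifies it by 0 + v + w = 3 u.\<close>

lemma hexagon_closed:
  assumes full: "(\<Sum>v\<in>N. area (sector s v)) = area (ball 0 s)"
    and v: "v \<in> N" and u: "norm u = s" "dist u v = s"
  shows "3 *\<^sub>R u - v \<in> N"
proof -
  have uv: "2 * (u \<bullet> v) = (norm v)\<^sup>2"
  proof -
    have "(dist u v)\<^sup>2 = (norm u)\<^sup>2 - 2 * (u \<bullet> v) + (norm v)\<^sup>2"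
      unfolding dist_norm power2_norm_eq_inner by (simp add: inner_diff inner_commute)
    then show ?thesis using u by simp
  qed
  have "\<exists>w\<in>N. w \<noteq> v \<and> dist u w \<le> s"
  proof (rule ccontr)
    assume "\<not> ?thesis"
    then have neg: "s < dist u w" if "w \<in> N" "w \<noteq> v" for w using that by force
    have w: "2 * s * (u \<bullet> w) < (norm w)\<^sup>2 * norm u" if "w \<in> N" "w \<noteq> v" for w
    proof -
      have "(dist u w)\<^sup>2 = (norm u)\<^sup>2 - 2 * (u \<bullet> w) + (norm w)\<^sup>2"
        unfolding dist_norm power2_norm_eq_inner by (simp add: inner_diff inner_commute)
      moreover have "s\<^sup>2 < (dist u w)\<^sup>2" using neg[OF that] s_pos by (simp add: power_strict_mono)
      ultimately have "2 * (u \<bullet> w) < (norm w)\<^sup>2" using u by simp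
      then have "s * (2 * (u \<bullet> w)) < s * (norm w)\<^sup>2" using s_pos by simp
      then show ?thesis using u by (simp add: mult_ac)
    qed
    let ?O = "\<Inter>w\<in>N. {y. 2 * s * (y \<bullet> w) < (norm w)\<^sup>2 * norm y}"
    have op: "open ?O" using fin by (intro open_INT open_Collect_less continuous_intros ballI)
    \<comment> \<open>The path leaves the disk along the bisector of 0 and \<open>v\<close>: the
      inner product with \<open>v\<close> stays constant while the norm grows, so it leaves the
      sector of \<open>v\<close> at once. For small \<open>t\<close> the strict conditions for the
      other neighbours persist.\<close>
    define z where "z = (\<lambda>t::real. u + t *\<^sub>R (u - (1/2) *\<^sub>R v))"
    have "open ({t. z t \<in> (\<Inter>w\<in>N - {v}. {y. 2 * s * (y \<bullet> w) < (norm w)\<^sup>2 * norm y})})"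
    proof -
      have "{t. z t \<in> (\<Inter>w\<in>N - {v}. {y. 2 * s * (y \<bullet> w) < (norm w)\<^sup>2 * norm y})}
          = (\<Inter>w\<in>N - {v}. {t. 2 * s * (z t \<bullet> w) < (norm w)\<^sup>2 * norm (z t)})" by auto
      also have "open \<dots>" unfolding z_def
        using fin by (intro open_INT open_Collect_less continuous_intros ballI) auto
      finally show ?thesis .
    qed
    moreover have "0 \<in> {t. z t \<in> (\<Inter>w\<in>N - {v}. {y. 2 * s * (y \<bullet> w) < (norm w)\<^sup>2 * norm y})}"
      using w by (auto simp: z_def)
    ultimately obtain e where e: "0 < e" "ball 0 e \<subseteq> {t. z t \<in> (\<Inter>w\<in>N - {v}. {y. 2 * s * (y \<bullet> w) < (norm w)\<^sup>2 * norm y})}"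
      by (meson open_contains_ball)
    define t where "t = e / 2"
    have t: "0 < t" "t \<in> ball 0 e" using e by (auto simp: t_def)
    have zv: "2 * s * (z t \<bullet> v) < (norm v)\<^sup>2 * norm (z t)"
    proof -
      have "(u - (1/2) *\<^sub>R v) \<bullet> v = 0" using uv by (simp add: inner_diff power2_norm_eq_inner)
      then have zv: "2 * (z t \<bullet> v) = (norm v)\<^sup>2" using uv by (simp add: z_def inner_add_left)
      have "u \<noteq> (1/2) *\<^sub>R v"
      proof
        assume "u = (1/2) *\<^sub>R v"
        then have "norm u = norm v / 2" by simp
        then show False using u near[OF v] by simp
      qed
      moreover have "u \<bullet> (u - (1/2) *\<^sub>R v) = (norm (u - (1/2) *\<^sub>R v))\<^sup>2"
        using \<open>(u - (1/2) *\<^sub>R v) \<bullet> v = 0\<close> unfolding power2_norm_eq_inner by (simp add: inner_diff inner_commute)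
      ultimately have "0 < u \<bullet> (u - (1/2) *\<^sub>R v)" by simp
      moreover have "(norm (z t))\<^sup>2 = (norm u)\<^sup>2 + 2 * t * (u \<bullet> (u - (1/2) *\<^sub>R v)) + (t * norm (u - (1/2) *\<^sub>R v))\<^sup>2"
        unfolding z_def power_mult_distrib power2_norm_eq_inner
        by (simp add: inner_add inner_commute power2_eq_square algebra_simps)
      ultimately have "(norm u)\<^sup>2 < (norm (z t))\<^sup>2"
        using t by (smt (verit, best) mult_pos_pos zero_le_power2)
      then have "norm u < norm (z t)" using norm_ge_zero power2_less_imp_less by blast
      then have "(norm v)\<^sup>2 * s < (norm v)\<^sup>2 * norm (z t)"
        using nonzero[OF v] u by (intro mult_strict_left_mono) auto
      then show ?thesis using zv by (simp add: mult_ac)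
    qed
    have "z t \<in> ?O" using e(2) t(2) zv by blast
    moreover have nz: "z t \<noteq> 0" using zv by auto
    \<comment> \<open>\<open>?O\<close> is invariant under positive scaling, so the direction found
      outside the disk yields a point inside it.\<close>
    ultimately have "((s / 2) / norm (z t)) *\<^sub>R z t \<in> ?O"
      using s_pos by (auto simp: field_simps)
    moreover have "((s / 2) / norm (z t)) *\<^sub>R z t \<in> ball 0 s" using nz s_pos by simp
    ultimately have ne: "?O \<inter> ball 0 s \<noteq> {}" by blast
    have "area (\<Union>v\<in>N. sector s v) < area (ball 0 s)"
    proof (rule measure_less_of_open_gap[OF _ _ _ _ ne])
      show "(\<Union>v\<in>N. sector s v) \<in> lmeasurable" using fin lmeasurable_sector by (intro fmeasurable.finite_UN) auto
      show "(\<Union>v\<in>N. sector s v) \<subseteq> ball 0 s" by (auto simp: sector_def)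
      show "(?O \<inter> ball 0 s) \<inter> (\<Union>v\<in>N. sector s v) = {}" by (force simp: sector_def)
    qed (use op in auto)
    then show False using full sum_sectors_eq by simp
  qed
  then obtain w where w: "w \<in> N" "w \<noteq> v" "dist u w \<le> s" by blast
  have "0 + v + w = 3 *\<^sub>R u"
    by (rule no_three_close(1)[of d _ _ _ s]) (use w v u far sep d_pos d_s in auto)
  then have "3 *\<^sub>R u - v = w" by (simp add: algebra_simps)
  then show ?thesis using w by simp
qed

end

section \<open>The hexagonal lattice and its quadratic form\<close>

definition rot60 :: "real^2 \<Rightarrow> real^2" where
  "rot60 v = (1/2) *\<^sub>R v + (sqrt 3 / 2) *\<^sub>R rot90 v"

lemma rot60_rot60: "rot60 (rot60 v) = rot60 v - v"
  by (simp add: rot60_def real2_eq_iff algebra_simps)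

text \<open>Two vectors of equal length at an angle of 60 degrees give the norm form of the
  Eisenstein integers.\<close>

lemma norm_rot60_comb:
  "(norm (a *\<^sub>R v + b *\<^sub>R rot60 v))\<^sup>2 = (norm v)\<^sup>2 * (a\<^sup>2 + a * b + b\<^sup>2)"
proof -
  have s3: "sqrt 3 * (sqrt 3 * x) = 3 * x" for x by (simp flip: mult.assoc)
  show ?thesis
    unfolding norm_sq_real2 by (simp add: rot60_def power2_eq_square algebra_simps s3)
qed

definition lat :: "real^2 \<Rightarrow> int \<times> int \<Rightarrow> real^2" where
  "lat v k = of_int (fst k) *\<^sub>R v + of_int (snd k) *\<^sub>R rot60 v"

lemma lat_diff: "lat v k - lat v l = lat v (fst k - fst l, snd k - snd l)"
  by (simp add: lat_def algebra_simps)

lemma norm_lat: "(norm (lat v (i, j)))\<^sup>2 = (norm v)\<^sup>2 * of_int (i\<^sup>2 + i * j + j\<^sup>2)"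
  by (simp add: lat_def norm_rot60_comb)

lemma eisenstein_form_pos: "(i, j) \<noteq> (0, 0) \<Longrightarrow> 1 \<le> i\<^sup>2 + i * j + j\<^sup>2" for i j :: int
proof -
  assume "(i, j) \<noteq> (0, 0)"
  then have "0 < (2 * i + j)\<^sup>2 + 3 * j\<^sup>2"
    by (cases "j = 0") (auto simp: add_nonneg_pos)
  moreover have "(2 * i + j)\<^sup>2 + 3 * j\<^sup>2 = 4 * (i\<^sup>2 + i * j + j\<^sup>2)"
    by (simp add: power2_eq_square algebra_simps)
  ultimately show ?thesis by simp
qed

lemma norm_lat_ge:
  assumes "k \<noteq> (0, 0)" shows "norm v \<le> norm (lat v k)"
proof (rule power2_le_imp_le)
  obtain i j where k: "k = (i, j)" by (cases k)
  have "1 \<le> i\<^sup>2 + i * j + j\<^sup>2" using eisenstein_form_pos assms unfolding k by blast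
  then have "(1::real) \<le> of_int (i\<^sup>2 + i * j + j\<^sup>2)" by linarith
  then have "(norm v)\<^sup>2 * 1 \<le> (norm v)\<^sup>2 * of_int (i\<^sup>2 + i * j + j\<^sup>2)" by (intro mult_left_mono) auto
  then show "(norm v)\<^sup>2 \<le> (norm (lat v k))\<^sup>2" by (simp add: k norm_lat)
qed simp

lemma dist_lat_ge: "k \<noteq> l \<Longrightarrow> norm v \<le> dist (lat v k) (lat v l)"
  unfolding dist_norm lat_diff by (rule norm_lat_ge) (auto simp: prod_eq_iff)

text \<open>The six sectors of the regular hexagon of neighbours are disjoint subsets of the disk,
  and each has area \<open>d / 2 * (s / 2) * \<sigma>\<close>. The factor
  \<open>3 * d * s / 2\<close> is the area of the hexagon with inradius \<open>d / 2\<close> and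
  circumradius \<open>s\<close>.\<close>

lemma ball_area_ge:
  assumes "0 < d" "0 < s" "d\<^sup>2 = 3 * s\<^sup>2"
  shows "3 * d * s / 2 * measure lebesgue (ref_sector s (d / 2)) \<le> measure lebesgue (ball (0 :: real^2) s)"
proof -
  \<comment> \<open>The six integer solutions of i^2 + i j + j^2 = 1, that is, the shortest nonzero
    lattice vectors.\<close>
  define I :: "(int \<times> int) set" where "I = {(1, 0), (0, 1), (-1, 1), (-1, 0), (0, -1), (1, -1)}"
  define v0 :: "real^2" where "v0 = vector [d, 0]"
  define N where "N = lat v0 ` I"
  have "(norm v0)\<^sup>2 = d\<^sup>2" unfolding norm_sq_real2 by (simp add: v0_def)
  then have v0: "norm v0 = d" using assms(1) power2_eq_iff_nonneg[of "norm v0" d] by simp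
  have "(2 * s)\<^sup>2 > d\<^sup>2" using assms by (simp add: power_mult_distrib)
  then have d2: "d < 2 * s" using assms by (auto intro: power2_less_imp_less)
  have nN: "norm v = d" if "v \<in> N" for v
  proof -
    have "(norm v)\<^sup>2 = d\<^sup>2" using that by (auto simp: N_def I_def norm_lat v0)
    then show ?thesis using assms(1) by (simp add: power2_eq_iff_nonneg)
  qed
  have gap: "d \<le> dist (lat v0 k) (lat v0 l)" if "k \<noteq> l" for k l
    using dist_lat_ge[OF that, of v0] v0 by simp
  have "k = l" if "lat v0 k = lat v0 l" for k l
    using gap[of k l] assms(1) that by (cases "k = l") auto
  then have inj: "inj_on (lat v0) I" by (intro inj_onI)
  interpret local_configuration d s N
  proof
    show "finite N" by (simp add: N_def I_def)
    show "d \<le> dist v w" if "v \<in> N" "w \<in> N" "v \<noteq> w" for v w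
    proof -
      obtain k l where "v = lat v0 k" "w = lat v0 l" using \<open>v \<in> N\<close> \<open>w \<in> N\<close> by (auto simp: N_def)
      then show ?thesis using gap[of k l] \<open>v \<noteq> w\<close> by auto
    qed
  qed (use assms nN d2 in auto)
  have "area (sector s v) = d / 2 * (s / 2) * \<sigma>" if "v \<in> N" for v
  proof -
    have "s\<^sup>2 - (d / 2)\<^sup>2 = (s / 2)\<^sup>2" using assms(3) by (simp add: power_divide)
    then have "s / 2 = sqrt (s\<^sup>2 - (d / 2)\<^sup>2)" using assms(2) by simp
    then show ?thesis
      using measure_sector_triangle(1)[of v s "s / 2", unfolded nN[OF that]] d2 nonzero[OF that] by simp
  qed
  then have "(\<Sum>v\<in>N. area (sector s v)) = (\<Sum>v\<in>N. d / 2 * (s / 2) * \<sigma>)" by (intro sum.cong refl)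
  also have "\<dots> = real (card N) * (d / 2 * (s / 2) * \<sigma>)" by (rule sum_constant)
  also have "card N = 6" unfolding N_def card_image[OF inj] by (simp add: I_def)
  also have "real 6 * (d / 2 * (s / 2) * \<sigma>) = 3 * d * s / 2 * \<sigma>" by simp
  finally show ?thesis using sum_sectors_le by metis
qed

section \<open>Separated point sets and their truncated cells\<close>

definition separated :: "real \<Rightarrow> 'a::metric_space set \<Rightarrow> bool" where
  "separated d X \<longleftrightarrow> (\<forall>x\<in>X. \<forall>y\<in>X. x \<noteq> y \<longrightarrow> d \<le> dist x y)"

text \<open>Both inequalities are strict, so that cells of distinct points are disjoint and cells of
  a separated set are open.\<close>

definition voronoi :: "real \<Rightarrow> 'a::metric_space set \<Rightarrow> 'a \<Rightarrow> 'a set" where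
  "voronoi s X x = {y. dist y x < s \<and> (\<forall>x'\<in>X. x' \<noteq> x \<longrightarrow> dist y x < dist y x')}"

lemma separated_closed:
  fixes X :: "'a::metric_space set"
  assumes "0 < d" "separated d X" shows "closed X"
  by (rule discrete_imp_closed[OF assms(1)]) (use assms(2) in \<open>force simp: separated_def\<close>)

lemma separated_subset: "separated d X \<Longrightarrow> Y \<subseteq> X \<Longrightarrow> separated d Y"
  by (auto simp: separated_def)

lemma separated_finite:
  fixes X :: "'a::euclidean_space set"
  assumes "0 < d" "separated d X" "bounded X" shows "finite X"
proof (rule ccontr)
  assume "infinite X"
  moreover have "compact X" using separated_closed[OF assms(1,2)] assms(3) by (simp add: compact_eq_bounded_closed)
  ultimately obtain x where x: "x islimpt X" using compact_imp_bounded
    by (metis bounded_infinite_imp_islimpt assms(3) subset_refl)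
  then obtain y where y: "y \<in> X" "y \<noteq> x" "dist y x < d / 2" using assms(1) by (meson half_gt_zero islimpt_approachable)
  then obtain z where z: "z \<in> X" "z \<noteq> x" "dist z x < min (d / 2) (dist y x)"
    using x assms(1) by (metis islimpt_approachable half_gt_zero min_less_iff_conj zero_less_dist_iff)
  have "dist y z < d" using dist_triangle_half_l[of y x d z] y(3) z(3) by simp
  moreover have "y \<noteq> z" using z by auto
  ultimately show False using assms(2) y(1) z(1) unfolding separated_def by (meson not_le)
qed

definition neighbours :: "real \<Rightarrow> 'a::real_normed_vector set \<Rightarrow> 'a \<Rightarrow> 'a set" where
  "neighbours s X x = {v. x + v \<in> X \<and> v \<noteq> 0 \<and> norm v < 2 * s}"

lemma local_configuration_neighbours:
  assumes "0 < d" "0 < s" "d\<^sup>2 = 3 * s\<^sup>2" "separated d X" "x \<in> X"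
  shows "local_configuration d s (neighbours s X x)"
proof
  have sep: "separated d (neighbours s X x)"
    using assms(4) by (auto simp: separated_def neighbours_def) (metis add_left_cancel dist_add_cancel)
  have "bounded (neighbours s X x)"
    by (rule bounded_subset[OF bounded_ball[of 0 "2 * s"]]) (auto simp: neighbours_def)
  then show "finite (neighbours s X x)" by (rule separated_finite[OF assms(1) sep])
  show "d \<le> norm v" if "v \<in> neighbours s X x" for v
  proof -
    have "d \<le> dist x (x + v)" using assms(4,5) that by (auto simp: separated_def neighbours_def)
    then show ?thesis by (simp add: dist_norm)
  qed
  show "d \<le> dist v w" if "v \<in> neighbours s X x" "w \<in> neighbours s X x" "v \<noteq> w" for v w
    using sep that by (simp add: separated_def)
qed (use assms in \<open>auto simp: neighbours_def\<close>)

text \<open>Only neighbours at distance below \<open>2 * s\<close> matter: a point at distance at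
  least \<open>2 * s\<close> from \<open>x\<close> is farther than \<open>x\<close> from every point
  of the open disk of radius \<open>s\<close> about \<open>x\<close>.\<close>

lemma voronoi_eq_translation:
  fixes x :: "real^2"
  shows "voronoi s X x = (+) x ` voronoi0 s (neighbours s X x)"
proof -
  have key: "norm w < norm (w - v) \<longleftrightarrow> 2 * (w \<bullet> v) < (norm v)\<^sup>2" for v w :: "real^2"
  proof -
    have "norm w < norm (w - v) \<longleftrightarrow> (norm w)\<^sup>2 < (norm (w - v))\<^sup>2" by (rule less_iff_power2_less) auto
    also have "(norm (w - v))\<^sup>2 = (norm w)\<^sup>2 - 2 * (w \<bullet> v) + (norm v)\<^sup>2"
      unfolding power2_norm_eq_inner by (simp add: inner_diff inner_commute)
    finally show ?thesis by auto
  qed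
  have far: "2 * (w \<bullet> v) < (norm v)\<^sup>2" if "norm w < s" "2 * s \<le> norm v" for v w :: "real^2"
  proof -
    have "2 * (w \<bullet> v) \<le> 2 * (norm w * norm v)" using norm_cauchy_schwarz[of w v] by simp
    also have "\<dots> < 2 * (s * norm v)"
      using that by (smt (verit, best) mult_strict_right_mono norm_ge_zero)
    also have "\<dots> \<le> norm v * norm v" using that mult_right_mono[of "2 * s" "norm v" "norm v"] by simp
    finally show ?thesis by (simp add: power2_eq_square)
  qed
  have "x + w \<in> voronoi s X x \<longleftrightarrow> w \<in> voronoi0 s (neighbours s X x)" for w
  proof -
    have "x + w \<in> voronoi s X x \<longleftrightarrow> norm w < s \<and> (\<forall>v. x + v \<in> X \<and> v \<noteq> 0 \<longrightarrow> norm w < norm (w - v))"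
    proof -
      have "(\<forall>x'\<in>X. x' \<noteq> x \<longrightarrow> norm w < dist (x + w) x') \<longleftrightarrow> (\<forall>v. x + v \<in> X \<and> v \<noteq> 0 \<longrightarrow> norm w < dist (x + w) (x + v))"
        by (metis add.right_neutral add_diff_cancel_left' diff_add_cancel add.commute)
      then show ?thesis by (simp add: voronoi_def dist_norm)
    qed
    also have "\<dots> \<longleftrightarrow> w \<in> voronoi0 s (neighbours s X x)"
      unfolding key voronoi0_def neighbours_def using far[of w] by (auto simp: not_less[symmetric])
    finally show ?thesis .
  qed
  then show ?thesis by (auto simp: image_iff) (metis add.commute diff_add_cancel)
qed

lemma measure_voronoi: "measure lebesgue (voronoi s X x) = measure lebesgue (voronoi0 s (neighbours s X (x::real^2)))"
  unfolding voronoi_eq_translation by (rule measure_translation)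

locale separated_set =
  fixes d s :: real and X :: "(real^2) set"
  assumes d_pos: "0 < d" and s_pos: "0 < s" and d_s: "d\<^sup>2 = 3 * s\<^sup>2" and sep: "separated d X"
begin

lemma d_less: "d < 2 * s"
proof -
  have "d\<^sup>2 < (2 * s)\<^sup>2" using d_s s_pos by (simp add: power_mult_distrib)
  then show ?thesis using s_pos by (auto intro: power2_less_imp_less)
qed

text \<open>The disk of radius \<open>s\<close> lies in area between \<open>\<sigma>\<close> times
  the hexagon, by \<open>ball_area_ge\<close>, and \<open>\<sigma>\<close> times the cell, by
  \<open>voronoi0_ge\<close>.\<close>

lemma voronoi_area_ge:
  assumes "x \<in> X" shows "3 * d * s / 2 \<le> measure lebesgue (voronoi s X x)"
proof -
  interpret local_configuration d s "neighbours s X x"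
    using local_configuration_neighbours d_pos s_pos d_s sep assms by blast
  have "3 * d * s / 2 * \<sigma> \<le> \<sigma> * area (voronoi s X x)"
    using ball_area_ge[OF d_pos s_pos d_s] voronoi0_ge by (simp add: measure_voronoi)
  then show ?thesis using \<sigma>_gt_1 by (simp add: mult.commute)
qed

lemma voronoi_area_eq:
  assumes "x \<in> X" "measure lebesgue (voronoi s X x) \<le> 3 * d * s / 2"
  shows "neighbours s X x \<noteq> {}"
    and "v \<in> neighbours s X x \<Longrightarrow> norm v = d"
    and "v \<in> neighbours s X x \<Longrightarrow> rot60 v \<in> neighbours s X x"
proof -
  interpret local_configuration d s "neighbours s X x"
    using local_configuration_neighbours d_pos s_pos d_s sep assms by blast
  have le: "\<sigma> * area (voronoi0 s (neighbours s X x)) \<le> area (ball 0 s)"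
  proof -
    have "\<sigma> * area (voronoi0 s (neighbours s X x)) \<le> \<sigma> * (3 * d * s / 2)"
      using assms(2) \<sigma>_gt_1 by (intro mult_left_mono) (auto simp: measure_voronoi)
    then show ?thesis using ball_area_ge[OF d_pos s_pos d_s] by (simp add: mult.commute)
  qed
  note full = voronoi0_eq(1)[OF le]
  have "0 < area (ball 0 s)" using s_pos by (simp add: content_ball_pos)
  then show "neighbours s X x \<noteq> {}" using full by auto
  assume v: "v \<in> neighbours s X x"
  show n: "norm v = d" by (rule voronoi0_eq(2)[OF le v])
  \<comment> \<open>The centroid of 0, \<open>v\<close> and \<open>rot60 v\<close>, which is the
    vertex of the hexagon between these two neighbours.\<close>
  let ?u = "(1/2) *\<^sub>R v + (sqrt 3 / 6) *\<^sub>R rot90 v"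
  have n2: "(v $ 1)\<^sup>2 + (v $ 2)\<^sup>2 = 3 * s\<^sup>2" using n d_s norm_sq_real2[of v] by simp
  have s3: "sqrt 3 * (sqrt 3 * x) = 3 * x" for x by (simp flip: mult.assoc)
  have "(norm ?u)\<^sup>2 = ((v $ 1)\<^sup>2 + (v $ 2)\<^sup>2) / 3" "(norm (?u - v))\<^sup>2 = ((v $ 1)\<^sup>2 + (v $ 2)\<^sup>2) / 3"
    unfolding norm_sq_real2 by (simp_all add: power2_eq_square algebra_simps s3)
  then have "norm ?u = s" "dist ?u v = s"
    using n2 s_pos by (simp_all add: dist_norm power2_eq_iff_nonneg)
  then have "3 *\<^sub>R ?u - v \<in> neighbours s X x" by (rule hexagon_closed[OF full v])
  also have "3 *\<^sub>R ?u - v = rot60 v" by (simp add: rot60_def real2_eq_iff algebra_simps)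
  finally show "rot60 v \<in> neighbours s X x" .
qed

end

section \<open>Rigidity of point sets all of whose cells are minimal\<close>

definition hex :: "real^2 \<Rightarrow> real^2 \<Rightarrow> (real^2) set" where
  "hex x v = {x + of_int i *\<^sub>R v + of_int j *\<^sub>R rot60 v | i j :: int. True}"

lemma rot60_basis:
  assumes "v \<noteq> 0"
  obtains a b where "z = a *\<^sub>R v + b *\<^sub>R rot60 v"
proof -
  obtain w where w: "z = frame 1 v w" using surj_frame[OF assms, of 1 z] by auto
  define q where "q = w $ 2 / norm v"
  have e: "2 * q / sqrt 3 * (1/2) = q / sqrt 3" "2 * q / sqrt 3 * (sqrt 3 / 2) = q" "w $ 2 * 1 / norm v = q"
    by (simp_all add: q_def)
  then have "z = (w $ 1 / 2 - q / sqrt 3) *\<^sub>R v + (2 * q / sqrt 3) *\<^sub>R rot60 v"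
    unfolding w frame_def rot60_def e scaleR_right_distrib scaleR_scaleR scaleR_left_diff_distrib by simp
  then show thesis by (rule that)
qed

lemma rot60_diff: "rot60 (v - w) = rot60 v - rot60 w"
  by (simp add: rot60_def real2_eq_iff algebra_simps diff_divide_distrib)

context separated_set
begin

text \<open>The neighbours of each point are closed under \<open>rot60\<close>, and being neighbours
  is symmetric, so one vector \<open>v\<close> propagates from point to point and the whole lattice
  lies in \<open>X\<close>. Rounding the lattice coordinates of any point of the plane leaves a
  squared distance of at most 3/4 d^2, so separation leaves no room for further points.\<close>

lemma hex_lattice:
  assumes all: "\<And>x. x \<in> X \<Longrightarrow> measure lebesgue (voronoi s X x) \<le> 3 * d * s / 2" and "X \<noteq> {}"
  shows "\<exists>x v. norm v = d \<and> X = hex x v"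
proof -
  obtain x where x: "x \<in> X" using assms(2) by blast
  obtain v where v: "v \<in> neighbours s X x" using voronoi_area_eq(1)[OF x all[OF x]] by blast
  have nv: "norm v = d" using voronoi_area_eq(2)[OF x all[OF x] v] .
  have rot: "rot60 w \<in> neighbours s X y" if "y \<in> X" "w \<in> neighbours s X y" for y w
    using voronoi_area_eq(3)[OF that(1) all[OF that(1)] that(2)] .
  have n: "z \<in> neighbours s X y \<Longrightarrow> y + z \<in> X" for y z by (simp add: neighbours_def)
  have opp: "y \<in> X \<Longrightarrow> z \<in> neighbours s X y \<Longrightarrow> - z \<in> neighbours s X (y + z)" for y z
    by (auto simp: neighbours_def)
  have rot3: "rot60 (rot60 (rot60 w)) = - w" for w
    by (simp add: rot60_rot60 rot60_diff)
  have neg: "-w \<in> neighbours s X y" if "y \<in> X" "w \<in> neighbours s X y" for y w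
    using rot[OF that(1) rot[OF that(1) rot[OF that]]] by (simp add: rot3)
  have step: "y + w \<in> X \<and> w \<in> neighbours s X (y + w)" if "y \<in> X" "w \<in> neighbours s X y" for y w
    using neg[OF n[OF that(2)] opp[OF that]] n[OF that(2)] by simp
  \<comment> \<open>The invariant carried along the lattice: it records the direction
    \<open>v\<close> together with membership, since otherwise the neighbours of the next point
    could be a rotated hexagon.\<close>
  define P where "P y \<longleftrightarrow> y \<in> X \<and> v \<in> neighbours s X y" for y
  have P1: "P (y + v)" if "P y" for y using step that by (simp add: P_def)
  have P2: "P (y - v)" if "P y" for y
  proof -
    have "y - v \<in> X \<and> - v \<in> neighbours s X (y - v)" using step[OF _ neg, of y v] that by (simp add: P_def)
    then show ?thesis using neg[of "y - v" "- v"] by (simp add: P_def)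
  qed
  have back60: "v \<in> neighbours s X y" if "y \<in> X" "rot60 v \<in> neighbours s X y" for y
  proof -
    have "rot60 (rot60 (rot60 v)) \<in> neighbours s X y" using that rot by blast
    then have "- v \<in> neighbours s X y" by (simp add: rot3)
    then show ?thesis using neg[OF that(1)] by force
  qed
  have P3: "P (y + rot60 v)" if "P y" for y
    using step[of y "rot60 v"] rot[of y v] back60[of "y + rot60 v"] that by (simp add: P_def)
  have P4: "P (y - rot60 v)" if "P y" for y
  proof -
    have "rot60 v \<in> neighbours s X y" using rot that by (simp add: P_def)
    then have 1: "y - rot60 v \<in> X \<and> - rot60 v \<in> neighbours s X (y - rot60 v)"
      using step[OF _ neg, of y "rot60 v"] that by (simp add: P_def)
    then have "rot60 v \<in> neighbours s X (y - rot60 v)" using neg[of "y - rot60 v" "- rot60 v"] by simp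
    then show ?thesis using 1 back60 by (simp add: P_def)
  qed
  have Pi: "P (y + of_int i *\<^sub>R w)" if "P y" "\<And>y. P y \<Longrightarrow> P (y + w)" "\<And>y. P y \<Longrightarrow> P (y - w)" for y w and i :: int
  proof (induction i rule: int_induct[where k = 0])
    case base then show ?case using that(1) by simp
  next
    case (step1 i) then show ?case using that(2)[OF step1(2)] by (simp add: scaleR_left_distrib add.assoc)
  next
    case (step2 i) then show ?case using that(3)[OF step2(2)] by (simp add: scaleR_left_diff_distrib add_diff_eq)
  qed
  have "P x" using x v by (simp add: P_def)
  then have "P (x + of_int i *\<^sub>R v + of_int j *\<^sub>R rot60 v)" for i j
    by (intro Pi P1 P2 P3 P4)
  then have sub: "hex x v \<subseteq> X" by (auto simp: hex_def P_def)
  have "y \<in> hex x v" if y: "y \<in> X" for y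
  proof -
    have "v \<noteq> 0" using nv d_pos by auto
    then obtain a b where ab: "y - x = a *\<^sub>R v + b *\<^sub>R rot60 v" by (rule rot60_basis)
    define p where "p = x + of_int (round a) *\<^sub>R v + of_int (round b) *\<^sub>R rot60 v"
    have p: "p \<in> hex x v" by (auto simp: p_def hex_def)
    define e f where "e = a - of_int (round a)" and "f = b - of_int (round b)"
    have "y - p = (y - x) - (p - x)" by simp
    also have "\<dots> = e *\<^sub>R v + f *\<^sub>R rot60 v"
      unfolding ab p_def e_def f_def by (simp add: scaleR_left_diff_distrib)
    finally have "(dist y p)\<^sup>2 = d\<^sup>2 * (e\<^sup>2 + e * f + f\<^sup>2)"
      by (simp add: dist_norm norm_rot60_comb nv)
    also have "\<dots> < d\<^sup>2 * 1"
    proof (rule mult_strict_left_mono)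
      have ef: "\<bar>e\<bar> \<le> 1/2" "\<bar>f\<bar> \<le> 1/2" using of_int_round_abs_le[of a] of_int_round_abs_le[of b]
        by (auto simp: e_def f_def abs_minus_commute)
      have "\<bar>e\<bar> * \<bar>e\<bar> \<le> 1/2 * (1/2)" "\<bar>e\<bar> * \<bar>f\<bar> \<le> 1/2 * (1/2)" "\<bar>f\<bar> * \<bar>f\<bar> \<le> 1/2 * (1/2)"
        using ef by (intro mult_mono; simp)+
      moreover have "e * f \<le> \<bar>e\<bar> * \<bar>f\<bar>" by (metis abs_ge_self abs_mult)
      moreover have "e\<^sup>2 = \<bar>e\<bar> * \<bar>e\<bar>" "f\<^sup>2 = \<bar>f\<bar> * \<bar>f\<bar>" by (simp_all add: power2_eq_square)
      ultimately show "e\<^sup>2 + e * f + f\<^sup>2 < 1" by simp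
    qed (use d_pos in simp)
    finally have "dist y p < d" using d_pos by (auto intro: power2_less_imp_less)
    then have "y = p" using sep y sub p unfolding separated_def by (meson not_le subsetD)
    then show ?thesis using p by simp
  qed
  then have "X = hex x v" using sub by blast
  then show ?thesis using nv by blast
qed

end

section \<open>Rigid motions of the plane\<close>

text \<open>Complex multiplication on \<open>real^2\<close>; rotations are the multiplications by
  unit vectors, and \<open>conj2\<close> gives their inverses.\<close>

definition cmul :: "real^2 \<Rightarrow> real^2 \<Rightarrow> real^2" where
  "cmul z x = vector [z $ 1 * x $ 1 - z $ 2 * x $ 2, z $ 1 * x $ 2 + z $ 2 * x $ 1]"

definition conj2 :: "real^2 \<Rightarrow> real^2" where
  "conj2 z = vector [z $ 1, - z $ 2]"

definition motion :: "real^2 \<Rightarrow> real^2 \<Rightarrow> real^2 \<Rightarrow> real^2" where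
  "motion a z x = a + cmul z x"

lemma cmul_nth [simp]: "cmul z x $ 1 = z $ 1 * x $ 1 - z $ 2 * x $ 2" "cmul z x $ 2 = z $ 1 * x $ 2 + z $ 2 * x $ 1"
  by (simp_all add: cmul_def)

lemma conj2_nth [simp]: "conj2 z $ 1 = z $ 1" "conj2 z $ 2 = - z $ 2"
  by (simp_all add: conj2_def)

lemma cmul_assoc: "cmul (cmul z w) x = cmul z (cmul w x)"
  by (simp add: real2_eq_iff algebra_simps)

lemma cmul_add: "cmul z (x + y) = cmul z x + cmul z y" and cmul_diff: "cmul z (x - y) = cmul z x - cmul z y"
  and cmul_minus: "cmul z (- x) = - cmul z x" and cmul_zero [simp]: "cmul z 0 = 0"
  and cmul_scaleR: "cmul z (c *\<^sub>R x) = c *\<^sub>R cmul z x"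
  by (simp_all add: real2_eq_iff algebra_simps)

lemma norm_cmul: "norm (cmul z x) = norm z * norm x"
proof -
  have "(norm (cmul z x))\<^sup>2 = (norm z * norm x)\<^sup>2"
    unfolding power_mult_distrib norm_sq_real2 by (simp add: power2_eq_square algebra_simps)
  then show ?thesis by (simp add: power2_eq_iff_nonneg)
qed

lemma cmul_conj2:
  assumes "norm z = 1" shows "cmul z (cmul (conj2 z) x) = x" "cmul (conj2 z) (cmul z x) = x"
proof -
  have "z $ 1 * z $ 1 + z $ 2 * z $ 2 = 1" using norm_sq_real2[of z] assms by (simp add: power2_eq_square)
  moreover have "cmul z (cmul (conj2 z) x) = (z $ 1 * z $ 1 + z $ 2 * z $ 2) *\<^sub>R x"
    "cmul (conj2 z) (cmul z x) = (z $ 1 * z $ 1 + z $ 2 * z $ 2) *\<^sub>R x"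
    by (simp_all add: real2_eq_iff algebra_simps)
  ultimately show "cmul z (cmul (conj2 z) x) = x" "cmul (conj2 z) (cmul z x) = x" by simp_all
qed

lemma norm_conj2 [simp]: "norm (conj2 z) = norm z"
proof -
  have "(norm (conj2 z))\<^sup>2 = (norm z)\<^sup>2" by (simp add: norm_sq_real2)
  then show ?thesis by simp
qed

lemma motion_comp: "motion a z \<circ> motion b w = motion (a + cmul z b) (cmul z w)"
  by (rule ext) (simp add: motion_def cmul_add cmul_assoc add.assoc)

lemma rigid_motions_eq: "rigid_motions = {motion a z | a z. norm z = 1}"
proof (intro equalityI subsetI)
  fix g :: "real^2 \<Rightarrow> real^2" assume "g \<in> rigid_motions"
  then obtain a A where A: "rotation_matrix A" "g = (\<lambda>x. a + A *v x)" unfolding rigid_motions_def by blast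
  have o: "A ** transpose A = mat 1" "transpose A ** A = mat 1" and d: "det A = 1"
    using A(1) by (auto simp: rotation_matrix_def orthogonal_matrix_def)
  let ?p = "A $ 1 $ 1" and ?q = "A $ 1 $ 2" and ?s = "A $ 2 $ 1" and ?t = "A $ 2 $ 2"
  have e: "?p * ?p + ?s * ?s = 1" "?p * ?q + ?s * ?t = 0" "?q * ?q + ?t * ?t = 1"
    using o(2) by (simp_all add: vec_eq_iff forall_2 matrix_matrix_mult_def transpose_def sum_2 mat_def)
  have d: "?p * ?t - ?q * ?s = 1" using d by (simp add: det_2)
  \<comment> \<open>Orthogonality together with determinant 1 makes the first column (p, s)
    determine the second one as (-s, p).\<close>
  have "?t = (?p * ?p + ?s * ?s) * ?t" "?p = ?p * (?p * ?t - ?q * ?s)" using e d by simp_all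
  moreover have "?p * (?p * ?t - ?q * ?s) = (?p * ?p + ?s * ?s) * ?t - ?s * (?p * ?q + ?s * ?t)" by algebra
  ultimately have tp: "?t = ?p" using e by simp
  have "- ?s = - (?q * ?q + ?t * ?t) * ?s" "?q = ?q * (?p * ?t - ?q * ?s)" using e d by simp_all
  moreover have "?q * (?p * ?t - ?q * ?s) = - (?q * ?q + ?t * ?t) * ?s + ?t * (?p * ?q + ?s * ?t)" by algebra
  ultimately have qs: "?q = - ?s" using e by simp
  let ?z = "vector [?p, ?s] :: real^2"
  have "g = motion a ?z"
    unfolding A(2) motion_def
    by (rule ext) (simp add: real2_eq_iff matrix_vector_mult_def sum_2 tp qs algebra_simps)
  moreover have "(norm ?z)\<^sup>2 = 1" using e(1) unfolding norm_sq_real2 by (simp add: power2_eq_square)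
  then have "norm ?z = 1" using abs_square_eq_1[of "norm ?z"] by simp
  ultimately show "g \<in> {motion a z | a z. norm z = 1}" by blast
next
  fix g assume "g \<in> {motion a z | a z. norm z = 1}"
  then obtain a z where g: "g = motion a z" "norm z = 1" by blast
  let ?A = "vector [vector [z $ 1, - z $ 2], vector [z $ 2, z $ 1]] :: real^2^2"
  have n: "z $ 1 * z $ 1 + z $ 2 * z $ 2 = 1" using norm_sq_real2[of z] g(2) by (simp add: power2_eq_square)
  have "orthogonal_matrix ?A"
    unfolding orthogonal_matrix using n
    by (simp add: vec_eq_iff forall_2 matrix_matrix_mult_def transpose_def sum_2 mat_def algebra_simps)
  moreover have "det ?A = 1" using n by (simp add: det_2)
  moreover have "g = (\<lambda>x. a + ?A *v x)"
    unfolding g motion_def by (rule ext) (simp add: real2_eq_iff matrix_vector_mult_def sum_2)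
  ultimately show "g \<in> rigid_motions" unfolding rigid_motions_def rotation_matrix_def by blast
qed

lemma motion_rigid: "norm z = 1 \<Longrightarrow> motion a z \<in> rigid_motions"
  unfolding rigid_motions_eq by blast

lemma rigid_motionE:
  fixes g :: "real^2 \<Rightarrow> real^2"
  assumes "g \<in> rigid_motions" obtains a z where "norm z = 1" "g = motion a z"
  using assms unfolding rigid_motions_eq by blast

lemma rigid_comp: "g \<in> rigid_motions \<Longrightarrow> h \<in> rigid_motions \<Longrightarrow> g \<circ> h \<in> rigid_motions" for g :: "real^2 \<Rightarrow> real^2"
  by (elim rigid_motionE) (auto simp: motion_comp norm_cmul intro!: motion_rigid)

lemma translation_rigid: "(+) a \<in> rigid_motions" for a :: "real^2"
proof -
  have "(+) a = motion a (vector [1, 0])"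
    by (rule ext) (simp add: motion_def real2_eq_iff)
  moreover have "(norm (vector [1, 0] :: real^2))\<^sup>2 = 1" by (simp add: norm_sq_real2)
  then have "norm (vector [1, 0] :: real^2) = 1" using abs_square_eq_1[of "norm (vector [1, 0] :: real^2)"] by simp
  ultimately show ?thesis using motion_rigid by simp
qed

lemma rigid_inverse:
  fixes g :: "real^2 \<Rightarrow> real^2"
  assumes "g \<in> rigid_motions"
  obtains h where "h \<in> rigid_motions" "g \<circ> h = id" "h \<circ> g = id"
proof -
  obtain a z where g: "norm z = 1" "g = motion a z" using assms by (rule rigid_motionE)
  show thesis
  proof (rule that)
    show "motion (- cmul (conj2 z) a) (conj2 z) \<in> rigid_motions" using g by (intro motion_rigid) simp
  qed (auto simp: fun_eq_iff g(2) motion_def cmul_add cmul_diff cmul_minus cmul_conj2[OF g(1)])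
qed

lemma rigid_dist: "g \<in> rigid_motions \<Longrightarrow> dist (g x) (g y) = dist x y" for g :: "real^2 \<Rightarrow> real^2"
  by (elim rigid_motionE) (simp add: motion_def dist_norm norm_cmul flip: cmul_diff)

lemma rigid_continuous: "g \<in> rigid_motions \<Longrightarrow> continuous_on S g" for g :: "real^2 \<Rightarrow> real^2"
  by (rule continuous_on_subset[of UNIV]) (auto simp: continuous_on_iff rigid_dist)

lemma rigid_image_cball:
  fixes g :: "real^2 \<Rightarrow> real^2"
  assumes "g \<in> rigid_motions" shows "g ` cball x r = cball (g x) r"
proof (intro equalityI subsetI)
  obtain h where h: "h \<in> rigid_motions" "g \<circ> h = id" "h \<circ> g = id" using assms by (rule rigid_inverse)
  fix y assume "y \<in> cball (g x) r"
  moreover have "g (h y) = y" using h by (metis comp_apply id_apply)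
  ultimately have "h y \<in> cball x r" using rigid_dist[OF assms, of x "h y"] by simp
  then show "y \<in> g ` cball x r" using \<open>g (h y) = y\<close> by (metis imageI)
qed (use rigid_dist[OF assms] in auto)

section \<open>Packings by congruent disks and their sets of centres\<close>

lemma hausdorff_dist_le_iff:
  fixes S T :: "'a::metric_space set"
  assumes "S \<noteq> {}" "T \<noteq> {}" "bounded S" "bounded T"
  shows "hausdorff_dist S T \<le> e \<longleftrightarrow> (\<forall>x\<in>S. infdist x T \<le> e) \<and> (\<forall>y\<in>T. infdist y S \<le> e)"
proof -
  have bdd: "bdd_above ((\<lambda>x. infdist x B) ` A)" if A: "bounded A" and B: "B \<noteq> {}" for A B :: "'a set"
  proof -
    obtain b where b: "b \<in> B" using B by blast
    obtain e where "\<forall>a\<in>A. dist b a \<le> e" using A by (meson bounded_any_center)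
    then have "infdist a B \<le> e" if "a \<in> A" for a
      using infdist_le[OF b, of a] that by (force simp: dist_commute)
    then show ?thesis by (rule bdd_aboveI2)
  qed
  show ?thesis
    unfolding hausdorff_dist_def using assms bdd by (simp add: cSUP_le_iff)
qed

lemma hausdorff_dist_nonneg:
  fixes S T :: "'a::metric_space set"
  assumes "S \<noteq> {}" "T \<noteq> {}" "bounded S" "bounded T"
  shows "0 \<le> hausdorff_dist S T"
proof -
  obtain x where "x \<in> S" using assms(1) by blast
  then have "infdist x T \<le> hausdorff_dist S T" using hausdorff_dist_le_iff[OF assms] by blast
  then show ?thesis using infdist_nonneg[of x T] by linarith
qed

lemma hausdorff_dist_triangle:
  fixes S T U :: "'a::metric_space set"
  assumes S: "S \<noteq> {}" "bounded S" and T: "T \<noteq> {}" "bounded T" and U: "U \<noteq> {}" "bounded U"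
  shows "hausdorff_dist S U \<le> hausdorff_dist S T + hausdorff_dist T U"
proof -
  have key: "infdist x C \<le> a + b" if "infdist x B \<le> a" "\<And>y. y \<in> B \<Longrightarrow> infdist y C \<le> b" "B \<noteq> {}" for x a b and B C :: "'a set"
  proof -
    have "infdist x C - b \<le> dist x y" if "y \<in> B" for y
      using infdist_triangle[of x C y] \<open>\<And>y. y \<in> B \<Longrightarrow> infdist y C \<le> b\<close>[OF that] by simp
    then have "infdist x C - b \<le> infdist x B" using \<open>B \<noteq> {}\<close> by (simp add: infdist_def cINF_greatest)
    then show ?thesis using that(1) by simp
  qed
  have 1: "\<forall>x\<in>S. infdist x T \<le> hausdorff_dist S T" "\<forall>y\<in>T. infdist y S \<le> hausdorff_dist S T"
    using hausdorff_dist_le_iff[OF S(1) T(1) S(2) T(2), of "hausdorff_dist S T"] by auto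
  have 2: "\<forall>x\<in>T. infdist x U \<le> hausdorff_dist T U" "\<forall>y\<in>U. infdist y T \<le> hausdorff_dist T U"
    using hausdorff_dist_le_iff[OF T(1) U(1) T(2) U(2), of "hausdorff_dist T U"] by auto
  show ?thesis
    unfolding hausdorff_dist_le_iff[OF S(1) U(1) S(2) U(2)]
  proof (intro conjI ballI)
    show "infdist x U \<le> hausdorff_dist S T + hausdorff_dist T U" if "x \<in> S" for x
      by (rule key[OF _ _ T(1)]) (use 1 2 that in auto)
    show "infdist y S \<le> hausdorff_dist S T + hausdorff_dist T U" if "y \<in> U" for y
      using key[OF _ _ T(1), of y "hausdorff_dist T U" S "hausdorff_dist S T"] 1 2 that by (simp add: add.commute)
  qed
qed

lemma hausdorff_dist_commute: "hausdorff_dist S T = hausdorff_dist T S"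
  by (simp add: hausdorff_dist_def max.commute)

lemma hausdorff_dist_cball:
  fixes x y :: "'a::euclidean_space"
  assumes "0 < r" shows "hausdorff_dist (cball x r) (cball y r) = dist x y"
proof (rule antisym)
  have ne: "cball z r \<noteq> {}" for z :: 'a using assms by simp
  have inf: "infdist p (cball b r) \<le> dist a b" if "p \<in> cball a r" for a b p :: 'a
  proof -
    have "p + (b - a) \<in> cball b r" using that by (simp add: dist_norm algebra_simps)
    then have "infdist p (cball b r) \<le> dist p (p + (b - a))" by (rule infdist_le)
    then show ?thesis by (simp add: dist_norm norm_minus_commute)
  qed
  show "hausdorff_dist (cball x r) (cball y r) \<le> dist x y"
    unfolding hausdorff_dist_le_iff[OF ne ne bounded_cball bounded_cball]
    using inf[of _ x y] inf[of _ y x] unfolding dist_commute[of y x] by blast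
  show "dist x y \<le> hausdorff_dist (cball x r) (cball y r)"
  proof (cases "x = y")
    case True
    then show ?thesis using hausdorff_dist_nonneg[OF ne ne bounded_cball bounded_cball] by simp
  next
    case False
    \<comment> \<open>The point of the first disk farthest from \<open>y\<close>.\<close>
    define p where "p = x + (r / dist x y) *\<^sub>R (x - y)"
    have "p - y = (1 + r / dist x y) *\<^sub>R (x - y)" by (simp add: p_def algebra_simps)
    then have "dist p y = (1 + r / dist x y) * dist x y"
      using assms by (simp add: dist_norm)
    then have py: "dist p y = dist x y + r" using False by (simp add: distrib_right)
    have "p \<in> cball x r" using False assms by (simp add: p_def dist_norm)
    then have "infdist p (cball y r) \<le> hausdorff_dist (cball x r) (cball y r)"
      using hausdorff_dist_le_iff[OF ne ne bounded_cball bounded_cball] by blast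
    moreover have "dist x y \<le> infdist p (cball y r)"
    proof -
      have "dist x y \<le> dist p q" if "q \<in> cball y r" for q
        using dist_triangle[of p y q] py that by (simp add: dist_commute)
      then show ?thesis using ne[of y] unfolding infdist_notempty[OF ne] by (intro cINF_greatest)
    qed
    ultimately show ?thesis by simp
  qed
qed

lemma hausdorff_limit_cball_iff:
  fixes x :: "'a::euclidean_space"
  assumes "0 < r"
  shows "hausdorff_limit (\<lambda>j. cball (\<xi> j) r) (cball x r) \<longleftrightarrow> \<xi> \<longlonglongrightarrow> x"
  unfolding hausdorff_limit_def tendsto_dist_iff[of \<xi>] using assms by (simp add: hausdorff_dist_cball)

text \<open>The second clause of convergence admits an arbitrary compact limit, which has to be
  recognised as a disk. The centres are Cauchy because Hausdorff distances of equal disks are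
  distances of centres; the limiting disk and \<open>S\<close> are then closed sets at Hausdorff
  distance 0.\<close>

lemma hausdorff_limit_cballD:
  fixes S :: "'a::euclidean_space set"
  assumes r: "0 < r" and lim: "hausdorff_limit (\<lambda>j. cball (\<xi> j) r) S"
  shows "\<exists>x. S = cball x r \<and> \<xi> \<longlonglongrightarrow> x"
proof -
  have S: "S \<noteq> {}" "compact S" "bounded S" and l: "(\<lambda>j. hausdorff_dist (cball (\<xi> j) r) S) \<longlonglongrightarrow> 0"
    using lim by (auto simp: hausdorff_limit_def compact_imp_bounded)
  have ne: "cball z r \<noteq> {}" for z :: 'a using r by simp
  have "Cauchy \<xi>"
  proof (rule metric_CauchyI)
    fix e :: real assume "0 < e"
    then have "eventually (\<lambda>j. hausdorff_dist (cball (\<xi> j) r) S < e / 2) sequentially"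
      using l by (intro order_tendstoD) auto
    then obtain M where M: "hausdorff_dist (cball (\<xi> j) r) S < e / 2" if "j \<ge> M" for j
      by (auto simp: eventually_sequentially)
    have "dist (\<xi> m) (\<xi> n) < e" if "m \<ge> M" "n \<ge> M" for m n
      using hausdorff_dist_triangle[OF ne bounded_cball S(1,3) ne bounded_cball, of "\<xi> m" "\<xi> n"] M[OF that(1)] M[OF that(2)]
      by (simp add: hausdorff_dist_cball[OF r] hausdorff_dist_commute[of S])
    then show "\<exists>M. \<forall>m\<ge>M. \<forall>n\<ge>M. dist (\<xi> m) (\<xi> n) < e" by blast
  qed
  then obtain x where x: "\<xi> \<longlonglongrightarrow> x" using Cauchy_convergent convergent_def by blast
  have "(\<lambda>j. hausdorff_dist (cball (\<xi> j) r) S + dist (\<xi> j) x) \<longlonglongrightarrow> 0 + 0"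
    using x l by (intro tendsto_add) (auto simp: tendsto_dist_iff[symmetric])
  then have "hausdorff_dist S (cball x r) \<le> 0"
    using hausdorff_dist_triangle[OF S(1,3) ne bounded_cball ne bounded_cball]
    by (intro LIMSEQ_le_const[where X = "\<lambda>j. hausdorff_dist (cball (\<xi> j) r) S + dist (\<xi> j) x"])
      (auto simp: hausdorff_dist_cball[OF r] hausdorff_dist_commute[of S])
  then have "\<forall>a\<in>S. infdist a (cball x r) \<le> 0" "\<forall>b\<in>cball x r. infdist b S \<le> 0"
    using hausdorff_dist_le_iff[OF S(1) ne S(3) bounded_cball] by auto
  then have "\<forall>a\<in>S. infdist a (cball x r) = 0" "\<forall>b\<in>cball x r. infdist b S = 0"
    by (meson antisym infdist_nonneg)+
  then have "S = cball x r"
    using S ne[of x] by (auto simp: in_closed_iff_infdist_zero[OF closed_cball ne[of x]] in_closed_iff_infdist_zero[OF compact_imp_closed[OF S(2)] S(1)] simp del: mem_cball)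
  then show ?thesis using x by blast
qed

section \<open>Convergence of packings expressed by centres\<close>

definition ball_packing :: "real \<Rightarrow> 'a::metric_space set \<Rightarrow> 'a set set" where
  "ball_packing r X = (\<lambda>x. cball x r) ` X"

definition centres :: "real \<Rightarrow> 'a::metric_space set set \<Rightarrow> 'a set" where
  "centres r P = {x. cball x r \<in> P}"

definition centres_converge :: "(nat \<Rightarrow> 'a::metric_space set) \<Rightarrow> 'a set \<Rightarrow> bool" where
  "centres_converge Xs X \<longleftrightarrow>
     (\<forall>x\<in>X. \<exists>\<xi>. (\<forall>\<^sub>F j in sequentially. \<xi> j \<in> Xs j) \<and> \<xi> \<longlonglongrightarrow> x) \<and>
     (\<forall>k \<xi> x. strict_mono k \<and> (\<forall>i. \<xi> i \<in> Xs (k i)) \<and> \<xi> \<longlonglongrightarrow> x \<longrightarrow> x \<in> X)"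

lemma mem_ball_packing_iff:
  fixes x :: "'a::euclidean_space"
  shows "0 < r \<Longrightarrow> cball x r \<in> ball_packing r X \<longleftrightarrow> x \<in> X"
  by (auto simp: ball_packing_def cball_eq_cball_iff)

lemma centres_ball_packing [simp]:
  fixes X :: "'a::euclidean_space set"
  shows "0 < r \<Longrightarrow> centres r (ball_packing r X) = X"
  by (simp add: centres_def mem_ball_packing_iff)

text \<open>With the radius fixed, a Hausdorff limit of disks is the same as a limit of centres, and
  every Hausdorff limit of disks is a disk; so the two clauses translate one by one.\<close>

lemma packing_converges_iff:
  fixes X :: "(real^'n) set"
  assumes r: "0 < r"
  shows "packing_converges (\<lambda>j. ball_packing r (Xs j)) (ball_packing r X) \<longleftrightarrow> centres_converge Xs X"
proof -
  have "(\<exists>\<beta>. (\<forall>\<^sub>F j in sequentially. \<beta> j \<in> ball_packing r (Xs j)) \<and> hausdorff_limit \<beta> (cball x r))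
      \<longleftrightarrow> (\<exists>\<xi>. (\<forall>\<^sub>F j in sequentially. \<xi> j \<in> Xs j) \<and> \<xi> \<longlonglongrightarrow> x)" (is "?L \<longleftrightarrow> ?R") for x
  proof
    assume ?L
    then obtain \<beta> where b: "\<forall>\<^sub>F j in sequentially. \<beta> j \<in> ball_packing r (Xs j)" "hausdorff_limit \<beta> (cball x r)" by blast
    \<comment> \<open>Only eventually is \<open>\<beta> j\<close> a disk of the packing; for the
      other indices the choice is arbitrary and harmless for the limit.\<close>
    define \<xi> where "\<xi> j = (SOME x. x \<in> Xs j \<and> \<beta> j = cball x r)" for j
    have ev: "\<forall>\<^sub>F j in sequentially. \<xi> j \<in> Xs j \<and> \<beta> j = cball (\<xi> j) r"
      using b(1)
    proof eventually_elim
      case (elim j)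
      then have "\<exists>x. x \<in> Xs j \<and> \<beta> j = cball x r" by (auto simp: ball_packing_def)
      then show ?case unfolding \<xi>_def by (rule someI_ex)
    qed
    have "hausdorff_limit (\<lambda>j. cball (\<xi> j) r) (cball x r)"
    proof -
      have "\<forall>\<^sub>F j in sequentially. hausdorff_dist (\<beta> j) (cball x r) = hausdorff_dist (cball (\<xi> j) r) (cball x r)"
        using ev by (rule eventually_mono) simp
      then show ?thesis
        using b(2) Lim_transform_eventually[of "\<lambda>j. hausdorff_dist (\<beta> j) (cball x r)" 0 sequentially]
        unfolding hausdorff_limit_def by auto
    qed
    then have "\<xi> \<longlonglongrightarrow> x" by (simp add: hausdorff_limit_cball_iff[OF r])
    then show ?R using ev by (auto elim: eventually_mono)
  next
    assume ?R
    then obtain \<xi> where "\<forall>\<^sub>F j in sequentially. \<xi> j \<in> Xs j" "\<xi> \<longlonglongrightarrow> x" by blast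
    then show ?L
      by (intro exI[of _ "\<lambda>j. cball (\<xi> j) r"]) (simp add: hausdorff_limit_cball_iff[OF r] mem_ball_packing_iff[OF r])
  qed
  then have 1: "(\<forall>S\<in>ball_packing r X. \<exists>\<beta>. (\<forall>\<^sub>F j in sequentially. \<beta> j \<in> ball_packing r (Xs j)) \<and> hausdorff_limit \<beta> S)
      \<longleftrightarrow> (\<forall>x\<in>X. \<exists>\<xi>. (\<forall>\<^sub>F j in sequentially. \<xi> j \<in> Xs j) \<and> \<xi> \<longlonglongrightarrow> x)"
    by (simp add: ball_packing_def)
  have 2: "(\<forall>k \<beta> S. strict_mono k \<and> (\<forall>i. \<beta> i \<in> ball_packing r (Xs (k i))) \<and> hausdorff_limit \<beta> S \<longrightarrow> S \<in> ball_packing r X)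
      \<longleftrightarrow> (\<forall>k \<xi> x. strict_mono k \<and> (\<forall>i. \<xi> i \<in> Xs (k i)) \<and> \<xi> \<longlonglongrightarrow> x \<longrightarrow> x \<in> X)" (is "?L \<longleftrightarrow> ?R")
  proof
    assume L: ?L
    show ?R
    proof (intro allI impI, elim conjE)
      fix k :: "nat \<Rightarrow> nat" and \<xi> x assume "strict_mono k" "\<forall>i. \<xi> i \<in> Xs (k i)" "\<xi> \<longlonglongrightarrow> x"
      then have "cball x r \<in> ball_packing r X"
        by (intro L[rule_format, of k "\<lambda>i. cball (\<xi> i) r"]) (simp add: hausdorff_limit_cball_iff[OF r] mem_ball_packing_iff[OF r])
      then show "x \<in> X" by (simp add: mem_ball_packing_iff[OF r])
    qed
  next
    assume R: ?R
    show ?L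
    proof (intro allI impI, elim conjE)
      fix k :: "nat \<Rightarrow> nat" and \<beta> S assume k: "strict_mono k" and b: "\<forall>i. \<beta> i \<in> ball_packing r (Xs (k i))" and S: "hausdorff_limit \<beta> S"
      have "\<forall>i. \<exists>x. x \<in> Xs (k i) \<and> \<beta> i = cball x r" using b by (auto simp: ball_packing_def)
      then obtain \<xi> where x: "\<And>i. \<xi> i \<in> Xs (k i) \<and> \<beta> i = cball (\<xi> i) r" by metis
      then have "\<beta> = (\<lambda>i. cball (\<xi> i) r)" by blast
      then obtain x where "S = cball x r" "\<xi> \<longlonglongrightarrow> x" using hausdorff_limit_cballD[OF r] S by blast
      then show "S \<in> ball_packing r X" using R k x by (auto simp: mem_ball_packing_iff[OF r])
    qed
  qed
  show ?thesis unfolding packing_converges_def centres_converge_def 1 2 ..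
qed

text \<open>A rigid motion sends a disk to the disk about the image of its centre, so the copies are
  all disks of radius \<open>r\<close> and the position \<open>c\<close> of the model disk
  disappears.\<close>

lemma packings_cball_iff:
  fixes c :: "real^2"
  assumes r: "0 < r"
  shows "P \<in> packings {cball c r} \<longleftrightarrow> (\<exists>X. separated (2 * r) X \<and> P = ball_packing r X)"
proof -
  have copies: "{g ` S | g S. g \<in> rigid_motions \<and> S \<in> {cball c r}} = range (\<lambda>x :: real^2. cball x r)"
  proof (intro equalityI subsetI)
    fix T assume "T \<in> range (\<lambda>x :: real^2. cball x r)"
    then obtain x where "T = cball x r" by blast
    then have "T = (+) (x - c) ` cball c r" using rigid_image_cball[OF translation_rigid, of "x - c" c r] by simp
    then show "T \<in> {g ` S | g S. g \<in> rigid_motions \<and> S \<in> {cball c r}}" using translation_rigid by blast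
  qed (use rigid_image_cball in auto)
  have disj: "interior (cball x r) \<inter> interior (cball y r) = {} \<longleftrightarrow> 2 * r \<le> dist x y" for x y :: "real^2"
  proof
    assume *: "interior (cball x r) \<inter> interior (cball y r) = {}"
    show "2 * r \<le> dist x y"
    proof (rule ccontr)
      assume "\<not> 2 * r \<le> dist x y"
      then have "midpoint x y \<in> ball x r \<inter> ball y r" by (simp add: dist_midpoint)
      then show False using * by (auto simp: interior_cball)
    qed
  next
    assume *: "2 * r \<le> dist x y"
    show "interior (cball x r) \<inter> interior (cball y r) = {}"
    proof (rule ccontr)
      assume "\<not> ?thesis"
      then obtain z where "dist x z < r" "dist y z < r" by (auto simp: interior_cball)
      then show False using * dist_triangle2[of x y z] by linarith
    qed
  qed
  show ?thesis
  proof
    assume "P \<in> packings {cball c r}"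
    then have P: "P \<subseteq> range (\<lambda>x. cball x r)" "pairwise (\<lambda>S T. interior S \<inter> interior T = {}) P"
      unfolding packings_def copies by auto
    have "P = ball_packing r (centres r P)" using P(1) by (auto simp: ball_packing_def centres_def)
    moreover have "separated (2 * r) (centres r P)"
      unfolding separated_def
    proof (intro ballI impI)
      fix x y assume "x \<in> centres r P" "y \<in> centres r P" "x \<noteq> y"
      then have "cball x r \<in> P" "cball y r \<in> P" "cball x r \<noteq> cball y r"
        using r by (auto simp: centres_def cball_eq_cball_iff)
      then show "2 * r \<le> dist x y" using P(2) unfolding disj[symmetric] pairwise_def by blast
    qed
    ultimately show "\<exists>X. separated (2 * r) X \<and> P = ball_packing r X" by blast
  next
    assume "\<exists>X. separated (2 * r) X \<and> P = ball_packing r X"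
    then obtain X where X: "separated (2 * r) X" "P = ball_packing r X" by blast
    then show "P \<in> packings {cball c r}"
      unfolding packings_def copies
    proof (intro CollectI conjI pairwiseI)
      fix S T assume "S \<in> P" "T \<in> P" "S \<noteq> T"
      then obtain x y where "x \<in> X" "y \<in> X" "x \<noteq> y" "S = cball x r" "T = cball y r"
        using X(2) by (auto simp: ball_packing_def)
      then show "interior S \<inter> interior T = {}" using X(1) disj[of x y] unfolding separated_def by blast
    qed (auto simp: X(2) ball_packing_def)
  qed
qed

lemma separated_rigid:
  fixes g :: "real^2 \<Rightarrow> real^2"
  assumes "g \<in> rigid_motions" "separated d X" shows "separated d (g ` X)"
  unfolding separated_def
proof (intro ballI impI)
  fix p q assume "p \<in> g ` X" "q \<in> g ` X" "p \<noteq> q"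
  then obtain x y where "x \<in> X" "y \<in> X" "x \<noteq> y" "p = g x" "q = g y" by blast
  then show "d \<le> dist p q" using assms(2) rigid_dist[OF assms(1)] by (simp add: separated_def)
qed

lemma move_ball_packing:
  fixes g :: "real^2 \<Rightarrow> real^2"
  shows "g \<in> rigid_motions \<Longrightarrow> move_packing g (ball_packing r X) = ball_packing r (g ` X)"
  by (simp add: move_packing_def ball_packing_def image_image rigid_image_cball)

lemma move_packing_comp: "move_packing g (move_packing h P) = move_packing (g \<circ> h) P"
  by (simp add: move_packing_def image_image image_comp)

lemma move_packing_id: "move_packing id P = P"
  by (simp add: move_packing_def)

lemma centres_converge_subseqD:
  assumes "centres_converge Xs X" "strict_mono k" "\<And>i. \<xi> i \<in> Xs (k i)" "\<xi> \<longlonglongrightarrow> x"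
  shows "x \<in> X"
  using assms unfolding centres_converge_def by blast

lemma centres_converge_rigid:
  fixes g :: "real^2 \<Rightarrow> real^2"
  assumes g: "g \<in> rigid_motions" and conv: "centres_converge Xs X"
  shows "centres_converge (\<lambda>j. g ` Xs j) (g ` X)"
  unfolding centres_converge_def
proof (intro conjI ballI allI impI)
  fix y assume "y \<in> g ` X"
  then obtain x where x: "x \<in> X" "y = g x" by blast
  then obtain \<xi> where xi: "\<forall>\<^sub>F j in sequentially. \<xi> j \<in> Xs j" "\<xi> \<longlonglongrightarrow> x"
    using conv unfolding centres_converge_def by blast
  have "(\<lambda>j. g (\<xi> j)) \<longlonglongrightarrow> g x"
    by (rule continuous_on_tendsto_compose[OF rigid_continuous[OF g, of UNIV] xi(2)]) auto
  moreover have "\<forall>\<^sub>F j in sequentially. g (\<xi> j) \<in> g ` Xs j" using xi(1) by (rule eventually_mono) simp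
  ultimately show "\<exists>\<xi>. (\<forall>\<^sub>F j in sequentially. \<xi> j \<in> g ` Xs j) \<and> \<xi> \<longlonglongrightarrow> y"
    unfolding x(2) by (intro exI[of _ "\<lambda>j. g (\<xi> j)"] conjI)
next
  fix k \<xi> y assume *: "strict_mono k \<and> (\<forall>i. \<xi> i \<in> g ` Xs (k i)) \<and> \<xi> \<longlonglongrightarrow> y"
  obtain h where h: "h \<in> rigid_motions" "g \<circ> h = id" "h \<circ> g = id" using g by (rule rigid_inverse)
  have gh: "g (h x) = x" "h (g x) = x" for x using h(2,3) by (metis comp_apply id_apply)+
  have "(\<lambda>j. h (\<xi> j)) \<longlonglongrightarrow> h y"
    by (rule continuous_on_tendsto_compose[OF rigid_continuous[OF h(1), of UNIV]]) (use * in auto)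
  moreover have "h (\<xi> i) \<in> Xs (k i)" for i
  proof -
    have "\<xi> i \<in> g ` Xs (k i)" using * by blast
    then show ?thesis by (auto simp: gh)
  qed
  ultimately have "h y \<in> X" using centres_converge_subseqD[OF conv, of k "\<lambda>j. h (\<xi> j)"] * by blast
  then show "y \<in> g ` X" using gh(1)[of y] by (metis imageI)
qed

section \<open>The topology, Borel sets and group action on disk packings\<close>

locale disk_packings =
  fixes r :: real and c :: "real^2"
  assumes r_pos: "0 < r"
begin

abbreviation "B \<equiv> {cball c r}"

lemma packingE:
  assumes "P \<in> packings B"
  obtains X where "separated (2 * r) X" "P = ball_packing r X" "centres r P = X"
  using assms packings_cball_iff[OF r_pos] r_pos by auto

lemma packingI: "separated (2 * r) X \<Longrightarrow> ball_packing r X \<in> packings B"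
  using packings_cball_iff[OF r_pos] by blast

lemma openin_iff:
  "openin (packing_topology B) U \<longleftrightarrow> U \<subseteq> packings B \<and>
     (\<forall>X Xs. separated (2 * r) X \<and> ball_packing r X \<in> U \<and> (\<forall>j. separated (2 * r) (Xs j)) \<and> centres_converge Xs X
        \<longrightarrow> (\<forall>\<^sub>F j in sequentially. ball_packing r (Xs j) \<in> U))" (is "?L \<longleftrightarrow> ?R")
proof
  assume ?L
  then have U: "U \<subseteq> packings B" "\<And>P Ps. P \<in> U \<Longrightarrow> \<forall>j. Ps j \<in> packings B \<Longrightarrow> packing_converges Ps P \<Longrightarrow> \<forall>\<^sub>F j in sequentially. Ps j \<in> U"
    unfolding openin_packing_topology by blast+
  show ?R
  proof (intro conjI allI impI U(1))
    fix X Xs assume *: "separated (2 * r) X \<and> ball_packing r X \<in> U \<and> (\<forall>j. separated (2 * r) (Xs j)) \<and> centres_converge Xs X"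
    then show "\<forall>\<^sub>F j in sequentially. ball_packing r (Xs j) \<in> U"
      by (intro U(2)[of "ball_packing r X"]) (auto simp: packing_converges_iff[OF r_pos] intro: packingI)
  qed
next
  assume R: ?R
  show ?L
    unfolding openin_packing_topology
  proof (intro conjI ballI allI impI)
    show "U \<subseteq> packings B" using R by blast
    fix P Ps assume P: "P \<in> U" and *: "(\<forall>j. Ps j \<in> packings B) \<and> packing_converges Ps P"
    obtain X where X: "separated (2 * r) X" "P = ball_packing r X" using P R packingE by blast
    have "\<forall>j. \<exists>Y. separated (2 * r) Y \<and> Ps j = ball_packing r Y" using * packings_cball_iff[OF r_pos] by blast
    then obtain Xs where Xs: "\<And>j. separated (2 * r) (Xs j)" "\<And>j. Ps j = ball_packing r (Xs j)" by metis
    then have "centres_converge Xs X"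
    proof -
      have "Ps = (\<lambda>j. ball_packing r (Xs j))" using Xs(2) by blast
      then show ?thesis using * X(2) packing_converges_iff[OF r_pos, of Xs X] by simp
    qed
    then have "\<forall>\<^sub>F j in sequentially. ball_packing r (Xs j) \<in> U" using R X P Xs(1) by blast
    then show "\<forall>\<^sub>F j in sequentially. Ps j \<in> U" using Xs(2) by simp
  qed
qed

lemma move_packings: "g \<in> rigid_motions \<Longrightarrow> P \<in> packings B \<Longrightarrow> move_packing g P \<in> packings B"
  by (elim packingE) (simp add: move_ball_packing packingI separated_rigid)

lemma move_cancel:
  assumes "g \<circ> h = id" shows "move_packing g (move_packing h P) = P"
  using assms by (simp add: move_packing_comp move_packing_id)

lemma openin_move:
  assumes g: "g \<in> rigid_motions" and U: "openin (packing_topology B) U"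
  shows "openin (packing_topology B) (move_packing g ` U)"
  unfolding openin_iff
proof (intro conjI allI impI)
  obtain h where h: "h \<in> rigid_motions" "g \<circ> h = id" "h \<circ> g = id" using g by (rule rigid_inverse)
  show "move_packing g ` U \<subseteq> packings B" using U move_packings[OF g] unfolding openin_iff by blast
  fix X Xs assume *: "separated (2 * r) X \<and> ball_packing r X \<in> move_packing g ` U \<and>
    (\<forall>j. separated (2 * r) (Xs j)) \<and> centres_converge Xs X"
  then have "ball_packing r (h ` X) \<in> U"
    using move_cancel[OF h(3)] by (auto simp: move_ball_packing[OF h(1), symmetric])
  then have "\<forall>\<^sub>F j in sequentially. ball_packing r (h ` Xs j) \<in> U"
    using conjunct2[OF U[unfolded openin_iff], rule_format, of "h ` X" "\<lambda>j. h ` Xs j"] *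
      separated_rigid[OF h(1)] centres_converge_rigid[OF h(1)] by blast
  then show "\<forall>\<^sub>F j in sequentially. ball_packing r (Xs j) \<in> move_packing g ` U"
  proof (rule eventually_mono)
    fix j assume "ball_packing r (h ` Xs j) \<in> U"
    then have "move_packing g (move_packing h (ball_packing r (Xs j))) \<in> move_packing g ` U"
      by (simp add: move_ball_packing[OF h(1)])
    then show "ball_packing r (Xs j) \<in> move_packing g ` U" by (simp add: move_cancel[OF h(2)])
  qed
qed

lemma space_packing_borel: "space (packing_borel B) = packings B"
  unfolding packing_borel_def by (rule space_measure_of) (auto simp: openin_packing_topology)

lemma sets_packing_borel: "sets (packing_borel B) = sigma_sets (packings B) {U. openin (packing_topology B) U}"
  unfolding packing_borel_def by (rule sets_measure_of) (auto simp: openin_packing_topology)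

lemma open_sets: "openin (packing_topology B) U \<Longrightarrow> U \<in> sets (packing_borel B)"
  by (auto simp: sets_packing_borel)

lemma measurable_packing_borelI:
  assumes "\<And>x. x \<in> space M \<Longrightarrow> f x \<in> packings B"
    and "\<And>U. openin (packing_topology B) U \<Longrightarrow> f -` U \<inter> space M \<in> sets M"
  shows "f \<in> measurable M (packing_borel B)"
  unfolding packing_borel_def
  by (rule measurable_measure_of) (use assms in \<open>auto simp: openin_packing_topology\<close>)

text \<open>Invariance is formulated with images of sets; as a preimage under the inverse motion,
  such an image is accessible to measurability.\<close>

lemma move_image_eq_vimage:
  assumes "g \<circ> h = id" "h \<circ> g = id" "g \<in> rigid_motions" "h \<in> rigid_motions" "A \<subseteq> packings B"
  shows "move_packing g ` A = move_packing h -` A \<inter> packings B"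
proof (intro equalityI subsetI)
  fix P assume "P \<in> move_packing g ` A"
  then obtain Q where "Q \<in> A" "P = move_packing g Q" by blast
  then show "P \<in> move_packing h -` A \<inter> packings B"
    using move_cancel[OF assms(2), of Q] move_packings[OF assms(3)] assms(5) by auto
next
  fix P assume "P \<in> move_packing h -` A \<inter> packings B"
  then show "P \<in> move_packing g ` A" using move_cancel[OF assms(1), of P] by (metis IntD1 imageI vimageD)
qed

lemma measurable_move:
  assumes "g \<in> rigid_motions"
  shows "move_packing g \<in> measurable (packing_borel B) (packing_borel B)"
proof (rule measurable_packing_borelI)
  obtain h where h: "h \<in> rigid_motions" "g \<circ> h = id" "h \<circ> g = id" using assms by (rule rigid_inverse)
  fix U assume U: "openin (packing_topology B) U"
  then have "U \<subseteq> packings B" by (simp add: openin_packing_topology)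
  then have "move_packing g -` U \<inter> packings B = move_packing h ` U"
    using move_image_eq_vimage[OF h(3,2) h(1) assms] by simp
  then show "move_packing g -` U \<inter> space (packing_borel B) \<in> sets (packing_borel B)"
    using openin_move[OF h(1) U] by (simp add: space_packing_borel open_sets)
qed (simp add: space_packing_borel move_packings assms)

lemma move_sets:
  assumes g: "g \<in> rigid_motions" and A: "A \<in> sets (packing_borel B)"
  shows "move_packing g ` A \<in> sets (packing_borel B)"
proof -
  obtain h where h: "h \<in> rigid_motions" "g \<circ> h = id" "h \<circ> g = id" using g by (rule rigid_inverse)
  have "A \<subseteq> packings B" using sets.sets_into_space[OF A] by (simp add: space_packing_borel)
  then show ?thesis
    using measurable_sets[OF measurable_move[OF h(1)] A]
    by (simp add: move_image_eq_vimage[OF h(2,3) g h(1)] space_packing_borel)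
qed

definition covered :: "real^2 \<Rightarrow> (real^2) set set set" where
  "covered y = {P \<in> packings B. \<exists>S\<in>P. y \<in> S}"

lemma ball_packing_covered: "separated (2 * r) X \<Longrightarrow> ball_packing r X \<in> covered y \<longleftrightarrow> (\<exists>x\<in>X. dist x y \<le> r)"
  by (auto simp: covered_def packingI) (auto simp: ball_packing_def)

text \<open>The set is closed. Centres within \<open>r\<close> of \<open>y\<close> along a
  subsequence stay in a compact disk, and their accumulation point is a centre of the limit packing
  still within \<open>r\<close> of \<open>y\<close>.\<close>

lemma covered_sets: "covered y \<in> sets (packing_borel B)"
proof -
  have "openin (packing_topology B) (packings B - covered y)"
    unfolding openin_iff
  proof (intro conjI allI impI)
    fix X and Xs :: "nat \<Rightarrow> (real^2) set"
    assume *: "separated (2 * r) X \<and> ball_packing r X \<in> packings B - covered y \<and>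
      (\<forall>j. separated (2 * r) (Xs j)) \<and> centres_converge Xs X"
    show "\<forall>\<^sub>F j in sequentially. ball_packing r (Xs j) \<in> packings B - covered y"
    proof (rule ccontr)
      assume "\<not> ?thesis"
      then obtain k :: "nat \<Rightarrow> nat" where k0: "strict_mono k" "\<And>i. ball_packing r (Xs (k i)) \<notin> packings B - covered y"
        using not_eventually_sequentiallyD[of "\<lambda>j. ball_packing r (Xs j) \<in> packings B - covered y"] by auto
      have k: "\<exists>x\<in>Xs (k i). dist x y \<le> r" for i
        using k0(2)[of i] * packingI[of "Xs (k i)"] ball_packing_covered[of "Xs (k i)" y] by blast
      have "\<forall>i. \<exists>x. x \<in> Xs (k i) \<and> x \<in> cball y r" using k by (simp add: dist_commute) blast
      then obtain \<xi> where x: "\<And>i. \<xi> i \<in> Xs (k i)" "\<And>i. \<xi> i \<in> cball y r" by metis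
      then obtain l \<phi> where l: "l \<in> cball y r" "strict_mono (\<phi> :: nat \<Rightarrow> nat)" "(\<xi> \<circ> \<phi>) \<longlonglongrightarrow> l"
        using compact_cball[of y r] unfolding compact_def by metis
      have "l \<in> X"
      proof -
        have "(\<xi> \<circ> \<phi>) i \<in> Xs ((k \<circ> \<phi>) i)" for i using x(1) by simp
        then show ?thesis
          using * centres_converge_subseqD[OF _ strict_mono_o[OF k0(1) l(2)] _ l(3)] by blast
      qed
      then show False using * l(1) by (auto simp: ball_packing_covered dist_commute)
    qed
  qed blast
  then have "packings B - (packings B - covered y) \<in> sets (packing_borel B)"
    using open_sets sets.top[of "packing_borel B"] by (auto simp: space_packing_borel)
  moreover have "packings B - (packings B - covered y) = covered y" by (auto simp: covered_def)
  ultimately show ?thesis by simp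
qed

end

section \<open>Irregular packings form an open set\<close>

lemma finite_neighbours:
  fixes X :: "'a::euclidean_space set"
  assumes "0 < d" "separated d X" shows "finite (neighbours s X x)"
proof -
  have "neighbours s X x \<subseteq> (\<lambda>p. p - x) ` (X \<inter> ball x (2 * s))"
  proof
    fix v assume "v \<in> neighbours s X x"
    then have "x + v \<in> X \<inter> ball x (2 * s)" "v = (x + v) - x" by (auto simp: neighbours_def dist_norm)
    then show "v \<in> (\<lambda>p. p - x) ` (X \<inter> ball x (2 * s))" by (metis image_eqI)
  qed
  moreover have "finite (X \<inter> ball x (2 * s))"
    by (rule separated_finite[OF assms(1) separated_subset[OF assms(2)]]) (auto intro: bounded_subset[OF bounded_ball])
  ultimately show ?thesis using finite_subset by blast
qed

lemma lmeasurable_voronoi: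
  fixes X :: "(real^2) set"
  assumes "0 < d" "separated d X" shows "voronoi s X x \<in> lmeasurable"
proof -
  let ?N = "neighbours s X x"
  have "voronoi0 s ?N = ball 0 s \<inter> (\<Inter>v\<in>?N. {y. 2 * (y \<bullet> v) < (norm v)\<^sup>2})"
    by (auto simp: voronoi0_def)
  also have "open \<dots>"
    using finite_neighbours[OF assms] by (intro open_Int open_INT open_Collect_less continuous_intros ballI) auto
  finally have "open (voronoi0 s ?N)" .
  moreover have "bounded (voronoi0 s ?N)"
    by (rule bounded_subset[OF bounded_ball[of 0 s]]) (auto simp: voronoi0_def)
  ultimately have "voronoi0 s ?N \<in> lmeasurable" by (rule lmeasurable_open[rotated])
  then show ?thesis unfolding voronoi_eq_translation by (rule measurable_translation)
qed

text \<open>If \<open>y\<close> left the cells infinitely often, competing centres at least as close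
  to \<open>y\<close> would accumulate at a centre \<open>l\<close> of the limit. Separation passes
  to the limit and keeps \<open>l\<close> different from \<open>x\<close>, so \<open>y\<close> would
  not lie strictly closer to \<open>x\<close> than to \<open>l\<close>.\<close>

lemma voronoi_stable:
  fixes X :: "'a::euclidean_space set"
  assumes d: "0 < d" and sep: "\<And>j. separated d (Xs j)" and conv: "centres_converge Xs X"
    and xi: "\<forall>\<^sub>F j in sequentially. \<xi> j \<in> Xs j" "\<xi> \<longlonglongrightarrow> x" and y: "y \<in> voronoi s X x"
  shows "\<forall>\<^sub>F j in sequentially. y \<in> voronoi s (Xs j) (\<xi> j)"
proof (rule ccontr)
  assume neg: "\<not> ?thesis"
  have dl: "(\<lambda>j. dist y (\<xi> j)) \<longlonglongrightarrow> dist y x" using xi(2) by (intro tendsto_intros)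
  have "\<forall>\<^sub>F j in sequentially. dist y (\<xi> j) < s"
    using order_tendstoD(2)[OF dl] y by (auto simp: voronoi_def)
  then have E: "\<forall>\<^sub>F j in sequentially. \<xi> j \<in> Xs j \<and> dist y (\<xi> j) < s" using xi(1) by (rule eventually_conj[rotated])
  have "\<not> (\<forall>\<^sub>F j in sequentially. (\<xi> j \<in> Xs j \<and> dist y (\<xi> j) < s) \<longrightarrow> y \<in> voronoi s (Xs j) (\<xi> j))"
  proof
    assume "\<forall>\<^sub>F j in sequentially. (\<xi> j \<in> Xs j \<and> dist y (\<xi> j) < s) \<longrightarrow> y \<in> voronoi s (Xs j) (\<xi> j)"
    from eventually_mp[OF this E] show False using neg by simp
  qed
  then obtain k :: "nat \<Rightarrow> nat" where k: "strict_mono k"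
      "\<And>i. \<xi> (k i) \<in> Xs (k i) \<and> dist y (\<xi> (k i)) < s \<and> y \<notin> voronoi s (Xs (k i)) (\<xi> (k i))"
    using not_eventually_sequentiallyD by blast
  then have "\<forall>i. \<exists>p. p \<in> Xs (k i) \<and> p \<noteq> \<xi> (k i) \<and> dist y p \<le> dist y (\<xi> (k i))"
    by (force simp: voronoi_def not_less)
  then obtain p where p: "\<And>i. p i \<in> Xs (k i)" "\<And>i. p i \<noteq> \<xi> (k i)" "\<And>i. dist y (p i) \<le> dist y (\<xi> (k i))"
    by metis
  have "p i \<in> cball y s" for i using p(3)[of i] k(2)[of i] by simp
  then obtain l \<phi> where l: "strict_mono (\<phi> :: nat \<Rightarrow> nat)" "(p \<circ> \<phi>) \<longlonglongrightarrow> l"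
    using compact_cball[of y s] unfolding compact_def by metis
  have k\<phi>: "strict_mono (k \<circ> \<phi>)" using strict_mono_o[OF k(1) l(1)] .
  have lX: "l \<in> X" by (rule centres_converge_subseqD[OF conv k\<phi> _ l(2)]) (simp add: p)
  have x2: "(\<xi> \<circ> (k \<circ> \<phi>)) \<longlonglongrightarrow> x" using xi(2) k\<phi> by (rule LIMSEQ_subseq_LIMSEQ)
  have "d \<le> dist l x"
  proof (rule LIMSEQ_le_const[OF tendsto_dist[OF l(2) x2]])
    have "d \<le> dist (p (\<phi> n)) (\<xi> (k (\<phi> n)))" for n
      using sep[of "k (\<phi> n)"] p[of "\<phi> n"] k(2)[of "\<phi> n"] unfolding separated_def by blast
    then show "\<exists>N. \<forall>n\<ge>N. d \<le> dist ((p \<circ> \<phi>) n) ((\<xi> \<circ> (k \<circ> \<phi>)) n)" by simp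
  qed
  then have "l \<noteq> x" using d by auto
  have "dist y l \<le> dist y x"
    by (rule LIMSEQ_le[OF tendsto_dist[OF tendsto_const l(2)] tendsto_dist[OF tendsto_const x2]]) (use p(3) in simp)
  then show False using y lX \<open>l \<noteq> x\<close> by (force simp: voronoi_def)
qed

text \<open>The sets \<open>E n\<close> of points that stay in all cells from index \<open>n\<close>
  on increase to the limit cell by \<open>voronoi_stable\<close>; continuity of measure from below
  gives the claim, as in Fatou's lemma.\<close>

lemma voronoi_area_lower_semicontinuous:
  fixes X :: "(real^2) set"
  assumes d: "0 < d" and sep: "separated d X" "\<And>j. separated d (Xs j)" and conv: "centres_converge Xs X"
    and xi: "\<forall>\<^sub>F j in sequentially. \<xi> j \<in> Xs j" "\<xi> \<longlonglongrightarrow> x"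
    and a: "a < measure lebesgue (voronoi s X x)"
  shows "\<forall>\<^sub>F j in sequentially. a < measure lebesgue (voronoi s (Xs j) (\<xi> j))"
proof -
  have m: "voronoi s X x \<in> lmeasurable" "voronoi s (Xs j) z \<in> lmeasurable" for j z
    using lmeasurable_voronoi d sep by blast+
  define E where "E n = voronoi s X x \<inter> (\<Inter>j\<in>{n..}. voronoi s (Xs j) (\<xi> j))" for n
  have Em: "E n \<in> lmeasurable" for n
  proof -
    have "(\<Inter>j\<in>{n..}. voronoi s (Xs j) (\<xi> j)) \<in> sets lebesgue"
      using m(2) by (intro sets.countable_INT') auto
    then show ?thesis unfolding E_def by (intro fmeasurable_Int_fmeasurable m(1))
  qed
  have UE: "(\<Union>n. E n) = voronoi s X x"
  proof (intro equalityI subsetI)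
    fix y assume y: "y \<in> voronoi s X x"
    obtain n where "\<forall>j\<ge>n. y \<in> voronoi s (Xs j) (\<xi> j)"
      using voronoi_stable[OF d sep(2) conv xi y] unfolding eventually_sequentially by blast
    then have "y \<in> E n" using y by (simp add: E_def)
    then show "y \<in> (\<Union>n. E n)" by blast
  qed (auto simp: E_def)
  have "(\<lambda>n. measure lebesgue (E n)) \<longlonglongrightarrow> measure lebesgue (\<Union>n. E n)"
  proof (rule Lim_measure_incseq)
    show "range E \<subseteq> sets lebesgue" using Em by auto
    show "incseq E" by (auto simp: incseq_def E_def)
    show "emeasure lebesgue (\<Union>n. E n) \<noteq> \<infinity>" unfolding UE using fmeasurableD2[OF m(1)] by simp
  qed
  then have "\<forall>\<^sub>F n in sequentially. a < measure lebesgue (E n)" unfolding UE using a by (rule order_tendstoD)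
  then show ?thesis
  proof (rule eventually_mono)
    fix n assume "a < measure lebesgue (E n)"
    also have "\<dots> \<le> measure lebesgue (voronoi s (Xs n) (\<xi> n))"
      using m Em by (intro measure_mono_fmeasurable) (auto simp: E_def)
    finally show "a < measure lebesgue (voronoi s (Xs n) (\<xi> n))" .
  qed
qed

context disk_packings
begin

abbreviation "s \<equiv> 2 * r / sqrt 3"
abbreviation "cell_area \<equiv> 3 * (2 * r) * s / 2"

lemma s_pos: "0 < s" and s_sq: "(2 * r)\<^sup>2 = 3 * s\<^sup>2"
  using r_pos by (auto simp: power_divide)

text \<open>A defect near \<open>z\<close>: a cell exceeding the minimal area by more than
  \<open>e\<close>, or a hole of radius \<open>R\<close>. The strict inequalities in the first
  alternative and the closed disk in the second make both of them open conditions.\<close>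

definition irregular :: "real \<Rightarrow> real \<Rightarrow> real^2 \<Rightarrow> (real^2) set set set" where
  "irregular R e z = {P \<in> packings B. (\<exists>x\<in>centres r P. dist z x < R \<and> cell_area + e < measure lebesgue (voronoi s (centres r P) x))
     \<or> centres r P \<inter> cball z R = {}}"

lemma ball_packing_irregular:
  "separated (2 * r) X \<Longrightarrow> ball_packing r X \<in> irregular R e z \<longleftrightarrow>
    (\<exists>x\<in>X. dist z x < R \<and> cell_area + e < measure lebesgue (voronoi s X x)) \<or> X \<inter> cball z R = {}"
  using r_pos by (simp add: irregular_def packingI)

lemma openin_irregular: "openin (packing_topology B) (irregular R e z)"
  unfolding openin_iff
proof (intro conjI allI impI)
  show "irregular R e z \<subseteq> packings B" by (auto simp: irregular_def)
  fix X Xs assume *: "separated (2 * r) X \<and> ball_packing r X \<in> irregular R e z \<and>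
    (\<forall>j. separated (2 * r) (Xs j)) \<and> centres_converge Xs X"
  have d: "0 < 2 * r" using r_pos by simp
  consider x where "x \<in> X" "dist z x < R" "cell_area + e < measure lebesgue (voronoi s X x)" | "X \<inter> cball z R = {}"
    using * ball_packing_irregular by blast
  then show "\<forall>\<^sub>F j in sequentially. ball_packing r (Xs j) \<in> irregular R e z"
  proof cases
    case 1
    obtain \<xi> where xi: "\<forall>\<^sub>F j in sequentially. \<xi> j \<in> Xs j" "\<xi> \<longlonglongrightarrow> x"
      using * 1(1) unfolding centres_converge_def by blast
    have "(\<lambda>j. dist z (\<xi> j)) \<longlonglongrightarrow> dist z x" using xi(2) by (intro tendsto_intros)
    then have "\<forall>\<^sub>F j in sequentially. dist z (\<xi> j) < R" using 1(2) by (rule order_tendstoD)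
    moreover have "\<forall>\<^sub>F j in sequentially. cell_area + e < measure lebesgue (voronoi s (Xs j) (\<xi> j))"
      using * by (intro voronoi_area_lower_semicontinuous[OF d _ _ _ xi 1(3)]) auto
    ultimately show ?thesis using xi(1)
      by eventually_elim (use * ball_packing_irregular in blast)
  next
    case 2
    show ?thesis
    proof (rule ccontr)
      assume "\<not> ?thesis"
      then obtain k :: "nat \<Rightarrow> nat" where k: "strict_mono k" "\<And>i. ball_packing r (Xs (k i)) \<notin> irregular R e z"
        using not_eventually_sequentiallyD[of "\<lambda>j. ball_packing r (Xs j) \<in> irregular R e z"] by metis
      have "\<exists>p. p \<in> Xs (k i) \<and> p \<in> cball z R" for i
        using k(2)[of i] * ball_packing_irregular[of "Xs (k i)"] by blast
      then obtain p where p: "\<And>i. p i \<in> Xs (k i)" "\<And>i. p i \<in> cball z R" by metis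
      then obtain l \<phi> where l: "l \<in> cball z R" "strict_mono (\<phi> :: nat \<Rightarrow> nat)" "(p \<circ> \<phi>) \<longlonglongrightarrow> l"
        using compact_cball[of z R] unfolding compact_def by metis
      have "l \<in> X"
        by (rule centres_converge_subseqD[OF _ strict_mono_o[OF k(1) l(2)] _ l(3), of Xs]) (use * p in auto)
      then show False using 2 l(1) by blast
    qed
  qed
qed

lemma voronoi_translate:
  fixes X :: "(real^2) set"
  shows "voronoi s ((+) a ` X) (a + x) = (+) a ` voronoi s X x"
proof -
  have *: "y \<in> voronoi s ((+) a ` X) (a + x) \<longleftrightarrow> y - a \<in> voronoi s X x" for y
    by (simp add: voronoi_def dist_norm diff_diff_eq)
  show ?thesis
  proof (intro equalityI subsetI)
    fix y assume "y \<in> voronoi s ((+) a ` X) (a + x)"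
    then have "a + (y - a) \<in> (+) a ` voronoi s X x" unfolding * by (rule imageI)
    then show "y \<in> (+) a ` voronoi s X x" by simp
  next
    fix y assume "y \<in> (+) a ` voronoi s X x"
    then show "y \<in> voronoi s ((+) a ` X) (a + x)" unfolding * by auto
  qed
qed

lemma irregular_translate: "move_packing ((+) a) ` irregular R e z = irregular R e (a + z)"
proof -
  have sub: "move_packing ((+) a) ` irregular R e z \<subseteq> irregular R e (a + z)" for a z
  proof
    fix Q assume "Q \<in> move_packing ((+) a) ` irregular R e z"
    then obtain P where P: "P \<in> irregular R e z" "Q = move_packing ((+) a) P" by blast
    then have "P \<in> packings B" by (simp add: irregular_def)
    then obtain X where X: "separated (2 * r) X" "P = ball_packing r X" by (rule packingE)
    have Q: "Q = ball_packing r ((+) a ` X)" using P X by (simp add: move_ball_packing translation_rigid)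
    have sQ: "separated (2 * r) ((+) a ` X)" using X(1) by (intro separated_rigid translation_rigid)
    consider x where "x \<in> X" "dist z x < R" "cell_area + e < measure lebesgue (voronoi s X x)" | "X \<inter> cball z R = {}"
      using P(1) X ball_packing_irregular by blast
    then show "Q \<in> irregular R e (a + z)"
    proof cases
      case 1
      then have "a + x \<in> (+) a ` X" "dist (a + z) (a + x) < R"
        "cell_area + e < measure lebesgue (voronoi s ((+) a ` X) (a + x))"
        by (auto simp: voronoi_translate measure_translation)
      then show ?thesis unfolding Q ball_packing_irregular[OF sQ] by blast
    next
      case 2
      then have "((+) a ` X) \<inter> cball (a + z) R = {}" by auto
      then show ?thesis unfolding Q ball_packing_irregular[OF sQ] by blast
    qed
  qed
  show ?thesis
  proof (rule antisym[OF sub])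
    have "irregular R e (a + z) = move_packing ((+) a) ` move_packing ((+) (- a)) ` irregular R e (a + z)"
    proof -
      have "(+) a \<circ> (+) (- a) = id" by auto
      then show ?thesis by (simp add: image_image move_cancel)
    qed
    also have "\<dots> \<subseteq> move_packing ((+) a) ` irregular R e z" using sub[of "- a" "a + z"] by auto
    finally show "irregular R e (a + z) \<subseteq> move_packing ((+) a) ` irregular R e z" .
  qed
qed

lemma covered_translate: "move_packing ((+) a) ` covered z = covered (a + z)"
proof -
  have sub: "move_packing ((+) a) ` covered z \<subseteq> covered (a + z)" for a z
    using move_packings[OF translation_rigid, of _ a] by (auto simp: covered_def move_packing_def)
  show ?thesis
  proof (rule antisym[OF sub])
    have "covered (a + z) = move_packing ((+) a) ` move_packing ((+) (- a)) ` covered (a + z)"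
    proof -
      have "(+) a \<circ> (+) (- a) = id" by auto
      then show ?thesis by (simp add: image_image move_cancel)
    qed
    also have "\<dots> \<subseteq> move_packing ((+) a) ` covered z" using sub[of "- a" "a + z"] by auto
    finally show "covered (a + z) \<subseteq> move_packing ((+) a) ` covered z" .
  qed
qed

end

section \<open>Counting in large squares\<close>

definition square :: "real \<Rightarrow> real \<Rightarrow> (real^2) set" where
  "square a b = cbox (vector [a, a]) (vector [b, b])"

lemma mem_square: "x \<in> square a b \<longleftrightarrow> a \<le> x $ 1 \<and> x $ 1 \<le> b \<and> a \<le> x $ 2 \<and> x $ 2 \<le> b"
  by (auto simp: square_def mem_box_cart forall_2)

lemma square_lmeasurable: "square a b \<in> lmeasurable"
  by (simp add: square_def)

lemma measure_square: "a \<le> b \<Longrightarrow> measure lebesgue (square a b) = (b - a)\<^sup>2"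
proof -
  assume "a \<le> b"
  then have "vector [a, a] \<in> square a b" by (simp add: mem_square)
  then show ?thesis
    unfolding square_def by (auto simp: content_cbox_if_cart UNIV_2 power2_eq_square)
qed

lemma component_dist_le: "\<bar>x $ i - y $ i\<bar> \<le> dist x (y :: real^'n)"
  using component_le_norm_cart[of "x - y" i] by (simp add: dist_norm)

lemma near_square:
  assumes "z \<in> square a b" "dist z x \<le> t" shows "x \<in> square (a - t) (b + t)"
  using assms component_dist_le[of z 1 x] component_dist_le[of z 2 x] by (auto simp: mem_square)

definition grid :: "real \<Rightarrow> nat \<Rightarrow> (real^2) set" where
  "grid \<eta> m = (\<lambda>(i, j). vector [\<eta> * of_nat i, \<eta> * of_nat j]) ` ({..<m} \<times> {..<m})"

lemma finite_grid: "finite (grid \<eta> m)"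
  by (simp add: grid_def)

lemma grid_inj: "0 < \<eta> \<Longrightarrow> inj_on (\<lambda>(i, j). vector [\<eta> * of_nat i, \<eta> * of_nat j] :: real^2) S"
  by (auto simp: inj_on_def real2_eq_iff)

lemma card_grid: "0 < \<eta> \<Longrightarrow> card (grid \<eta> m) = m\<^sup>2"
  unfolding grid_def card_image[OF grid_inj] by (simp add: power2_eq_square)

lemma grid_gap:
  assumes "0 < \<eta>" "y \<in> grid \<eta> m" "z \<in> grid \<eta> m" "y \<noteq> z"
  shows "\<eta> \<le> \<bar>y $ 1 - z $ 1\<bar> \<or> \<eta> \<le> \<bar>y $ 2 - z $ 2\<bar>"
proof -
  obtain i j where y: "y = vector [\<eta> * of_nat i, \<eta> * of_nat j]" using assms(2) by (auto simp: grid_def)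
  obtain k l where z: "z = vector [\<eta> * of_nat k, \<eta> * of_nat l]" using assms(3) by (auto simp: grid_def)
  have gap: "\<eta> \<le> \<bar>\<eta> * real p - \<eta> * real q\<bar>" if "p \<noteq> q" for p q :: nat
  proof -
    have "1 \<le> \<bar>real p - real q\<bar>" using that by linarith
    then have "\<eta> * 1 \<le> \<eta> * \<bar>real p - real q\<bar>" using assms(1) by (intro mult_left_mono) auto
    also have "\<dots> = \<bar>\<eta> * real p - \<eta> * real q\<bar>"
      using assms(1) by (simp add: abs_mult flip: right_diff_distrib)
    finally show ?thesis by simp
  qed
  have "i \<noteq> k \<or> j \<noteq> l" using assms(4) y z by auto
  then show ?thesis using gap[of i k] gap[of j l] unfolding y z by auto
qed

lemma grid_dist:
  assumes "0 < \<eta>" "y \<in> grid \<eta> m" "z \<in> grid \<eta> m" "y \<noteq> z"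
  shows "\<eta> \<le> dist y z"
  using grid_gap[OF assms] component_dist_le[of y 1 z] component_dist_le[of y 2 z] by auto

lemma grid_subset_square:
  assumes "0 < \<eta>" shows "grid \<eta> m \<subseteq> square 0 (\<eta> * of_nat m)"
  using assms by (auto simp: grid_def mem_square)

lemma sum_measure_disjoint:
  fixes f :: "'b \<Rightarrow> 'a::euclidean_space set"
  assumes "finite I" "\<And>i. i \<in> I \<Longrightarrow> f i \<in> lmeasurable" "disjoint_family_on f I"
  shows "(\<Sum>i\<in>I. measure lebesgue (f i)) = measure lebesgue (\<Union>i\<in>I. f i)"
  using assms fmeasurableD2[OF assms(2)]
  by (intro measure_finite_Union[symmetric]) (auto dest: fmeasurableD)

text \<open>Attach to each covered grid point the open square of side \<open>\<eta>\<close> with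
  that point as lower left corner. These squares are disjoint, and each lies within
  \<open>2 * \<eta>\<close> of its corner, hence in a disk of radius \<open>r + 2 * \<eta>\<close>
  about a centre.\<close>

lemma count_covered:
  fixes X :: "(real^2) set"
  assumes eta: "0 < \<eta>" and r: "0 < r" and F: "finite F" and Y: "Y \<subseteq> grid \<eta> m"
    and cov: "\<And>y. y \<in> Y \<Longrightarrow> \<exists>x\<in>F. dist x y \<le> r"
  shows "real (card Y) * \<eta>\<^sup>2 \<le> real (card F) * measure lebesgue (ball (0 :: real^2) (r + 2 * \<eta>))"
proof -
  define Q :: "real^2 \<Rightarrow> (real^2) set" where "Q y = {z. y $ 1 < z $ 1 \<and> z $ 1 < y $ 1 + \<eta> \<and> y $ 2 < z $ 2 \<and> z $ 2 < y $ 2 + \<eta>}" for y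
  have Qb: "Q y = box y (y + vector [\<eta>, \<eta>])" for y by (auto simp: Q_def mem_box_cart forall_2)
  have mQ: "measure lebesgue (Q y) = \<eta>\<^sup>2" for y
  proof -
    have "cbox y (y + vector [\<eta>, \<eta>]) \<noteq> {}" using eta by (auto simp: interval_ne_empty_cart forall_2)
    then show ?thesis
      unfolding Qb
      using content_cbox_if_cart[of y "y + vector [\<eta>, \<eta>]"]
        measure_lborel_box_eq[of y "y + vector [\<eta>, \<eta>]"] measure_lborel_cbox_eq[of y "y + vector [\<eta>, \<eta>]"]
      by (simp add: UNIV_2 power2_eq_square)
  qed
  have Qm: "Q y \<in> lmeasurable" for y by (simp add: Qb)
  have fY: "finite Y" using Y finite_grid finite_subset by blast
  have "disjoint_family_on Q Y"
    unfolding disjoint_family_on_def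
  proof (intro ballI impI)
    fix y z assume "y \<in> Y" "z \<in> Y" "y \<noteq> z"
    then have "\<eta> \<le> \<bar>y $ 1 - z $ 1\<bar> \<or> \<eta> \<le> \<bar>y $ 2 - z $ 2\<bar>" using grid_gap[OF eta] Y by blast
    then show "Q y \<inter> Q z = {}" by (auto simp: Q_def)
  qed
  then have "(\<Sum>y\<in>Y. measure lebesgue (Q y)) = measure lebesgue (\<Union>y\<in>Y. Q y)"
    by (intro sum_measure_disjoint fY Qm)
  also have "\<dots> \<le> measure lebesgue (\<Union>x\<in>F. ball x (r + 2 * \<eta>))"
  proof (rule measure_mono_fmeasurable)
    show "(\<Union>y\<in>Y. Q y) \<subseteq> (\<Union>x\<in>F. ball x (r + 2 * \<eta>))"
    proof
      fix z assume "z \<in> (\<Union>y\<in>Y. Q y)"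
      then obtain y where y: "y \<in> Y" "z \<in> Q y" by blast
      obtain x where x: "x \<in> F" "dist x y \<le> r" using cov[OF y(1)] by blast
      have "dist y z \<le> \<bar>(y - z) $ 1\<bar> + \<bar>(y - z) $ 2\<bar>"
        unfolding dist_norm using norm_le_l1_cart[of "y - z"] by (simp add: sum_2)
      then have "dist y z < 2 * \<eta>" using y(2) by (auto simp: Q_def)
      then have "dist x z < r + 2 * \<eta>" using x(2) dist_triangle[of x z y] by linarith
      then show "z \<in> (\<Union>x\<in>F. ball x (r + 2 * \<eta>))" using x(1) by auto
    qed
    show "(\<Union>y\<in>Y. Q y) \<in> sets lebesgue" using fY Qm by (intro sets.finite_UN) auto
    show "(\<Union>x\<in>F. ball x (r + 2 * \<eta>)) \<in> lmeasurable" using F by (intro fmeasurable.finite_UN) auto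
  qed
  also have "\<dots> \<le> (\<Sum>x\<in>F. measure lebesgue (ball x (r + 2 * \<eta>)))"
    using F by (intro measure_UNION_le) auto
  also have "\<dots> = (\<Sum>x\<in>F. measure lebesgue (ball (0 :: real^2) (r + 2 * \<eta>)))"
  proof (rule sum.cong[OF refl])
    fix x :: "real^2"
    have "ball x (r + 2 * \<eta>) = (+) x ` ball 0 (r + 2 * \<eta>)" by simp
    then show "measure lebesgue (ball x (r + 2 * \<eta>)) = measure lebesgue (ball (0 :: real^2) (r + 2 * \<eta>))"
      using measure_translation by metis
  qed
  finally show ?thesis by (simp add: mQ)
qed

context disk_packings
begin

text \<open>The cells of the centres in the enlarged square and the disks of radius
  \<open>R - s\<close> in the holes are disjoint and fit into a slightly larger square. Each
  irregular test point contributes at least \<open>e\<close> on top of the minimal cells: a private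
  oversized cell, or a disk that no cell meets.\<close>

lemma packing_area_bound:
  assumes X: "separated (2 * r) X" and Z: "finite Z" "Z \<subseteq> square 0 L" "\<And>z w. z \<in> Z \<Longrightarrow> w \<in> Z \<Longrightarrow> z \<noteq> w \<Longrightarrow> 2 * R \<le> dist z w"
    and R: "s < R" and e: "0 \<le> e" "e \<le> measure lebesgue (ball (0 :: real^2) (R - s))" and L: "0 \<le> L" and C: "R \<le> C"
  shows "real (card (X \<inter> square (- C) (L + C))) * cell_area + e * real (card {z \<in> Z. ball_packing r X \<in> irregular R e z})
    \<le> (L + 2 * (C + s))\<^sup>2"
proof -
  let ?A = "\<lambda>S. measure lebesgue (S :: (real^2) set)"
  have d: "0 < 2 * r" using r_pos by simp
  define F where "F = X \<inter> square (- C) (L + C)"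
  have F: "finite F" unfolding F_def
    by (rule separated_finite[OF d separated_subset[OF X]]) (auto simp: square_def intro: bounded_subset[OF bounded_cbox])
  define V where "V = voronoi s X"
  interpret separated_set "2 * r" s X by (rule separated_set.intro[OF d s_pos s_sq X])
  have Vm: "V x \<in> lmeasurable" for x unfolding V_def by (rule lmeasurable_voronoi[OF d X])
  define Z1 where "Z1 = {z \<in> Z. \<exists>x\<in>X. dist z x < R \<and> cell_area + e < ?A (V x)}"
  define Z2 where "Z2 = {z \<in> Z. X \<inter> cball z R = {}}"
  have irr: "{z \<in> Z. ball_packing r X \<in> irregular R e z} = Z1 \<union> Z2"
    unfolding Z1_def Z2_def V_def using ball_packing_irregular[OF X] by blast
  have fin: "finite Z1" "finite Z2" using Z(1) by (auto simp: Z1_def Z2_def)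
  have sep2: "z = w" if "z \<in> Z" "w \<in> Z" "dist z x < R" "dist w x < R" for z w x
    using Z(3)[OF that(1,2)] that(3,4) dist_triangle2[of z w x] by linarith
  obtain f where f: "\<And>z. z \<in> Z1 \<Longrightarrow> f z \<in> X \<and> dist z (f z) < R \<and> cell_area + e < ?A (V (f z))"
  proof -
    have "\<forall>z\<in>Z1. \<exists>x. x \<in> X \<and> dist z x < R \<and> cell_area + e < ?A (V x)" unfolding Z1_def by blast
    from bchoice[OF this] show thesis using that by blast
  qed
  \<comment> \<open>Test points are \<open>2 * R\<close> apart, so no centre is within
    \<open>R\<close> of two of them and each defect is counted once.\<close>
  have inj: "inj_on f Z1"
  proof (rule inj_onI)
    fix z w assume "z \<in> Z1" "w \<in> Z1" "f z = f w"
    then show "z = w" using f[of z] f[of w] sep2[of z w "f z"] by (auto simp: Z1_def)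
  qed
  have fF: "f ` Z1 \<subseteq> F"
  proof
    fix x assume "x \<in> f ` Z1"
    then obtain z where z: "z \<in> Z1" "x = f z" by blast
    then have "x \<in> square (0 - C) (L + C)"
      using f[OF z(1)] Z(2) C by (intro near_square[of z]) (auto simp: Z1_def)
    then show "x \<in> F" using f[OF z(1)] z(2) by (simp add: F_def)
  qed
  have 1: "real (card F) * cell_area + e * real (card Z1) \<le> (\<Sum>x\<in>F. ?A (V x))"
  proof -
    have "(\<Sum>x\<in>F. cell_area) + (\<Sum>x\<in>f ` Z1. e) = (\<Sum>x\<in>F. cell_area + (if x \<in> f ` Z1 then e else 0))"
      unfolding sum.distrib using fF F by (simp add: sum.inter_restrict[symmetric] Int_absorb1 Int_absorb2)
    also have "\<dots> \<le> (\<Sum>x\<in>F. ?A (V x))"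
    proof (rule sum_mono)
      fix x assume x: "x \<in> F"
      have "cell_area \<le> ?A (V x)" using voronoi_area_ge[of x] x by (simp add: F_def V_def)
      moreover have "cell_area + e < ?A (V x)" if "x \<in> f ` Z1" using that f by blast
      ultimately show "cell_area + (if x \<in> f ` Z1 then e else 0) \<le> ?A (V x)" by auto
    qed
    finally show ?thesis using card_image[OF inj] by (simp add: mult.commute)
  qed
  have Vdisj: "disjoint_family_on V F"
    unfolding disjoint_family_on_def V_def voronoi_def F_def by fastforce
  have 2: "e * real (card Z2) \<le> (\<Sum>z\<in>Z2. ?A (ball z (R - s)))"
  proof -
    have "(\<Sum>z\<in>Z2. e) \<le> (\<Sum>z\<in>Z2. ?A (ball z (R - s)))"
    proof (rule sum_mono)
      fix z :: "real^2"
      have "ball z (R - s) = (+) z ` ball 0 (R - s)" by simp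
      then show "e \<le> ?A (ball z (R - s))" using measure_translation e(2) by metis
    qed
    then show ?thesis by (simp add: mult.commute)
  qed
  have Bdisj: "disjoint_family_on (\<lambda>z. ball z (R - s)) Z2"
    unfolding disjoint_family_on_def
  proof (intro ballI impI)
    fix z w assume zw: "z \<in> Z2" "w \<in> Z2" "z \<noteq> w"
    show "ball z (R - s) \<inter> ball w (R - s) = {}"
    proof (rule ccontr)
      assume "\<not> ?thesis"
      then obtain y where "dist z y < R - s" "dist w y < R - s" by auto
      then show False using sep2[of z w y] zw s_pos by (auto simp: Z2_def)
    qed
  qed
  let ?U1 = "\<Union>x\<in>F. V x" and ?U2 = "\<Union>z\<in>Z2. ball z (R - s)"
  have U: "?U1 \<in> lmeasurable" "?U2 \<in> lmeasurable"
    using F fin Vm by (auto intro!: fmeasurable.finite_UN)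
  \<comment> \<open>Cells reach less than \<open>s\<close> from their centres, so shrinking a hole
    by \<open>s\<close> keeps it clear of all cells.\<close>
  have "?U1 \<inter> ?U2 = {}"
  proof (rule ccontr)
    assume "\<not> ?thesis"
    then obtain x z y where "x \<in> F" "y \<in> V x" "z \<in> Z2" "dist z y < R - s" by auto
    then have "dist z x < R" "x \<in> X" using dist_triangle[of z x y] by (auto simp: V_def voronoi_def F_def)
    then show False using \<open>z \<in> Z2\<close> by (auto simp: Z2_def)
  qed
  then have "?A ?U1 + ?A ?U2 = ?A (?U1 \<union> ?U2)" using U by (simp add: measure_Un3)
  also have "\<dots> \<le> ?A (square (- C - s) (L + C + s))"
  proof (rule measure_mono_fmeasurable)
    show "?U1 \<union> ?U2 \<subseteq> square (- C - s) (L + C + s)"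
    proof
      fix y assume "y \<in> ?U1 \<union> ?U2"
      then consider x where "x \<in> square (- C) (L + C)" "dist x y \<le> s" | z where "z \<in> square 0 L" "dist z y \<le> C + s"
        using Z(2) C s_pos by (fastforce simp: F_def V_def voronoi_def Z2_def dist_commute)
      then show "y \<in> square (- C - s) (L + C + s)"
      proof cases
        case 1 then show ?thesis by (rule near_square)
      next
        case 2 then show ?thesis using near_square[of z 0 L y "C + s"] by (simp add: algebra_simps)
      qed
    qed
  qed (use U square_lmeasurable in auto)
  also have "\<dots> = (L + 2 * (C + s))\<^sup>2"
    using L C R s_pos by (subst measure_square) (auto simp: algebra_simps)
  finally have 3: "(\<Sum>x\<in>F. ?A (V x)) + (\<Sum>z\<in>Z2. ?A (ball z (R - s))) \<le> (L + 2 * (C + s))\<^sup>2"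
    using sum_measure_disjoint[OF F Vm Vdisj] sum_measure_disjoint[OF fin(2) _ Bdisj] by simp
  have "real (card (Z1 \<union> Z2)) \<le> real (card Z1) + real (card Z2)"
    using card_Un_le[of Z1 Z2] by linarith
  then have "e * real (card (Z1 \<union> Z2)) \<le> e * real (card Z1) + e * real (card Z2)"
    using e(1) by (metis distrib_left mult_left_mono)
  then show ?thesis using 1 2 3 unfolding irr F_def[symmetric] by linarith
qed

end

text \<open>Passes from a count valid for each single packing to probabilities, by taking the
  expectation of sums of indicators.\<close>

lemma (in prob_space) sum_prob_le:
  assumes fin: "finite Y" "finite Z"
    and A: "\<And>y. y \<in> Y \<Longrightarrow> A y \<in> events" and E: "\<And>z. z \<in> Z \<Longrightarrow> E z \<in> events"
    and le: "\<And>x. x \<in> space M \<Longrightarrow> a * real (card {y \<in> Y. x \<in> A y}) + b * real (card {z \<in> Z. x \<in> E z}) \<le> k"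
  shows "a * (\<Sum>y\<in>Y. prob (A y)) + b * (\<Sum>z\<in>Z. prob (E z)) \<le> k"
proof -
  let ?f = "\<lambda>x. a * (\<Sum>y\<in>Y. indicator (A y) x) + b * (\<Sum>z\<in>Z. indicator (E z) x) :: real"
  have int: "integrable M (indicator (A y) :: _ \<Rightarrow> real)" if "y \<in> Y" for y
    using A[OF that] by (simp add: emeasure_eq_measure)
  have int': "integrable M (indicator (E z) :: _ \<Rightarrow> real)" if "z \<in> Z" for z
    using E[OF that] by (simp add: emeasure_eq_measure)
  have iY: "integrable M (\<lambda>x. \<Sum>y\<in>Y. indicator (A y) x :: real)" and iZ: "integrable M (\<lambda>x. \<Sum>z\<in>Z. indicator (E z) x :: real)"
    using int int' by (auto intro!: Bochner_Integration.integrable_sum)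
  have "expectation ?f = a * expectation (\<lambda>x. \<Sum>y\<in>Y. indicator (A y) x) + b * expectation (\<lambda>x. \<Sum>z\<in>Z. indicator (E z) x)"
    using iY iZ by simp
  also have "expectation (\<lambda>x. \<Sum>y\<in>Y. indicator (A y) x) = (\<Sum>y\<in>Y. prob (A y))"
    using int A by (subst Bochner_Integration.integral_sum) auto
  also have "expectation (\<lambda>x. \<Sum>z\<in>Z. indicator (E z) x) = (\<Sum>z\<in>Z. prob (E z))"
    using int' E by (subst Bochner_Integration.integral_sum) auto
  finally have "a * (\<Sum>y\<in>Y. prob (A y)) + b * (\<Sum>z\<in>Z. prob (E z)) = expectation ?f" by simp
  also have "\<dots> \<le> k"
  proof (rule integral_le_const)
    show "integrable M ?f" using iY iZ by simp
    have "?f x \<le> k" if "x \<in> space M" for x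
    proof -
      have c: "(\<Sum>y\<in>Y. indicator (A y) x :: real) = real (card {y \<in> Y. x \<in> A y})"
        using fin(1) by (simp add: indicator_def sum.If_cases Int_def)
      have c': "(\<Sum>z\<in>Z. indicator (E z) x :: real) = real (card {z \<in> Z. x \<in> E z})"
        using fin(2) by (simp add: indicator_def sum.If_cases Int_def)
      show ?thesis unfolding c c' by (rule le[OF that])
    qed
    then show "AE x in M. ?f x \<le> k" by (intro AE_I2)
  qed
  finally show ?thesis .
qed

section \<open>The density bound with its deficit\<close>

context disk_packings
begin

abbreviation "unit_area \<equiv> measure lebesgue (ball (0 :: real^2) 1)"

lemma ball_area: "0 \<le> t \<Longrightarrow> measure lebesgue (ball (0 :: real^2) t) = unit_area * t\<^sup>2"
  using content_ball_conv_unit_ball[of t "0 :: real^2"] by simp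

lemma invariant_measureD:
  assumes "\<mu> \<in> invariant_measures B"
  shows "prob_space \<mu>" "sets \<mu> = sets (packing_borel B)" "space \<mu> = packings B"
    "g \<in> rigid_motions \<Longrightarrow> A \<in> sets (packing_borel B) \<Longrightarrow> measure \<mu> (move_packing g ` A) = measure \<mu> A"
proof -
  show 1: "prob_space \<mu>" "sets \<mu> = sets (packing_borel B)" using assms by (auto simp: invariant_measures_def)
  show "space \<mu> = packings B" using sets_eq_imp_space_eq[OF 1(2)] by (simp add: space_packing_borel)
  show "g \<in> rigid_motions \<Longrightarrow> A \<in> sets (packing_borel B) \<Longrightarrow> measure \<mu> (move_packing g ` A) = measure \<mu> A"
    using assms 1(2) by (auto simp: invariant_measures_def)
qed

lemma irregular_sets: "irregular R e z \<in> sets (packing_borel B)"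
  by (rule open_sets[OF openin_irregular])

lemma measure_density_covered: "measure_density B \<mu> = measure \<mu> (covered 0)"
  by (simp add: measure_density_def covered_def)

text \<open>The expectation of the two counts in a square of side \<open>2 * R * m\<close>.
  Translation invariance makes all probabilities on each grid equal to the one at the origin, so
  division by the area leaves the density, the probability of a defect and an error from the
  boundary of the square.\<close>

lemma finite_scale_bound:
  assumes mu: "\<mu> \<in> invariant_measures B" and R: "s < R" and e: "0 \<le> e" "e \<le> measure lebesgue (ball (0 :: real^2) (R - s))"
    and K: "0 < K" and m: "0 < m"
  shows "cell_area * measure_density B \<mu> / (unit_area * (r + 2 * (2 * R / real K))\<^sup>2) + e * measure \<mu> (irregular R e 0) / (2 * R)\<^sup>2
    \<le> (1 + 2 * (R + r + s) / (2 * R) * inverse (real m))\<^sup>2"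
proof -
  interpret prob_space \<mu> by (rule invariant_measureD[OF mu])
  \<comment> \<open>The coarse grid has the spacing that separates defects; the fine spacing
    \<open>\<eta>\<close> divides it, so that both grids span the same square of side
    \<open>S\<close>.\<close>
  define L0 where "L0 = 2 * R"
  define \<eta> where "\<eta> = L0 / real K"
  define S where "S = L0 * real m"
  \<comment> \<open>A margin that serves both counts: it contains the centres within
    \<open>r\<close> of a covered grid point and those within \<open>R\<close> of a test
    point.\<close>
  define C where "C = R + r"
  define \<kappa> where "\<kappa> = unit_area * (r + 2 * \<eta>)\<^sup>2"
  have L0: "0 < L0" using R s_pos by (simp add: L0_def)
  have eta: "0 < \<eta>" using L0 K by (simp add: \<eta>_def)
  have S: "0 < S" using L0 m by (simp add: S_def)
  have SK: "\<eta> * real (K * m) = S" using K by (simp add: \<eta>_def S_def)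
  have kap: "0 < \<kappa>" using r_pos eta by (simp add: \<kappa>_def content_ball_pos)
  have cell: "0 < cell_area" using r_pos by simp
  have D: "prob (covered y) = measure_density B \<mu>" for y
    using invariant_measureD(4)[OF mu translation_rigid covered_sets, of y 0] by (simp add: covered_translate measure_density_covered)
  have p: "prob (irregular R e z) = prob (irregular R e 0)" for z
    using invariant_measureD(4)[OF mu translation_rigid irregular_sets, of z R e 0] by (simp add: irregular_translate)
  have sumZ: "(\<Sum>z\<in>grid L0 m. prob (irregular R e z)) = (\<Sum>z\<in>grid L0 m. prob (irregular R e 0))"
    by (intro sum.cong refl p)
  have "cell_area * \<eta>\<^sup>2 / \<kappa> * (\<Sum>y\<in>grid \<eta> (K * m). prob (covered y)) + e * (\<Sum>z\<in>grid L0 m. prob (irregular R e z)) \<le> (S + 2 * (C + s))\<^sup>2"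
  proof (rule sum_prob_le[OF finite_grid finite_grid])
    show "covered y \<in> events" "irregular R e y \<in> events" for y
      using covered_sets irregular_sets invariant_measureD(2)[OF mu] by auto
    fix P assume "P \<in> space \<mu>"
    then have "P \<in> packings B" by (simp add: invariant_measureD(3)[OF mu])
    then obtain X where X: "separated (2 * r) X" "P = ball_packing r X" by (rule packingE)
    define F where "F = X \<inter> square (- C) (S + C)"
    have d: "0 < 2 * r" using r_pos by simp
    have F: "finite F" unfolding F_def
      by (rule separated_finite[OF d separated_subset[OF X(1)]]) (auto simp: square_def intro: bounded_subset[OF bounded_cbox])
    have "real (card {y \<in> grid \<eta> (K * m). P \<in> covered y}) * \<eta>\<^sup>2 \<le> real (card F) * measure lebesgue (ball (0 :: real^2) (r + 2 * \<eta>))"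
    proof (rule count_covered[OF eta r_pos F])
      fix y assume y: "y \<in> {y \<in> grid \<eta> (K * m). P \<in> covered y}"
      then obtain x where x: "x \<in> X" "dist x y \<le> r" using X ball_packing_covered by blast
      have "y \<in> square 0 S" using y grid_subset_square[OF eta, of "K * m"] unfolding SK by blast
      then have "x \<in> square (0 - C) (S + C)"
        using x(2) R s_pos by (intro near_square[of y]) (auto simp: C_def dist_commute)
      then show "\<exists>x\<in>F. dist x y \<le> r" using x by (auto simp: F_def)
    qed auto
    also have "measure lebesgue (ball (0 :: real^2) (r + 2 * \<eta>)) = \<kappa>"
      unfolding \<kappa>_def by (rule ball_area) (use r_pos eta in simp)
    finally have "real (card {y \<in> grid \<eta> (K * m). P \<in> covered y}) * \<eta>\<^sup>2 / \<kappa> \<le> real (card F)"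
      using kap by (simp add: pos_divide_le_eq)
    then have "cell_area * (real (card {y \<in> grid \<eta> (K * m). P \<in> covered y}) * \<eta>\<^sup>2 / \<kappa>) \<le> cell_area * real (card F)"
      using cell by (intro mult_left_mono) auto
    moreover have "real (card F) * cell_area + e * real (card {z \<in> grid L0 m. ball_packing r X \<in> irregular R e z}) \<le> (S + 2 * (C + s))\<^sup>2"
      unfolding F_def
    proof (rule packing_area_bound[OF X(1) finite_grid _ _ R e])
      show "grid L0 m \<subseteq> square 0 S" using grid_subset_square[OF L0, of m] by (simp add: S_def)
      show "2 * R \<le> dist z w" if "z \<in> grid L0 m" "w \<in> grid L0 m" "z \<noteq> w" for z w
        using grid_dist[OF L0 that] by (simp add: L0_def)
    qed (use S r_pos in \<open>auto simp: C_def\<close>)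
    ultimately show "cell_area * \<eta>\<^sup>2 / \<kappa> * real (card {y \<in> grid \<eta> (K * m). P \<in> covered y})
        + e * real (card {z \<in> grid L0 m. P \<in> irregular R e z}) \<le> (S + 2 * (C + s))\<^sup>2"
      unfolding X(2) by (simp add: mult_ac)
  qed
  then have "cell_area * \<eta>\<^sup>2 / \<kappa> * ((real (K * m))\<^sup>2 * measure_density B \<mu>) + e * ((real m)\<^sup>2 * prob (irregular R e 0)) \<le> (S + 2 * (C + s))\<^sup>2"
    unfolding D sumZ sum_constant card_grid[OF eta] card_grid[OF L0] of_nat_power .
  moreover have "cell_area * \<eta>\<^sup>2 / \<kappa> * ((real (K * m))\<^sup>2 * measure_density B \<mu>) = S\<^sup>2 * (cell_area * measure_density B \<mu> / \<kappa>)"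
    unfolding SK[symmetric] power_mult_distrib by simp
  moreover have "e * ((real m)\<^sup>2 * prob (irregular R e 0)) = S\<^sup>2 * (e * prob (irregular R e 0) / L0\<^sup>2)"
    using L0 by (simp add: S_def power_mult_distrib)
  moreover have "(S + 2 * (C + s))\<^sup>2 = S\<^sup>2 * (1 + 2 * (C + s) / S)\<^sup>2"
  proof -
    have "S + x = S * (1 + x / S)" for x using S by (simp add: distrib_left)
    then show ?thesis by (simp only: power_mult_distrib[symmetric])
  qed
  ultimately have "S\<^sup>2 * (cell_area * measure_density B \<mu> / \<kappa> + e * prob (irregular R e 0) / L0\<^sup>2) \<le> S\<^sup>2 * (1 + 2 * (C + s) / S)\<^sup>2"
    by (simp only: distrib_left)
  then have "cell_area * measure_density B \<mu> / \<kappa> + e * prob (irregular R e 0) / L0\<^sup>2 \<le> (1 + 2 * (C + s) / S)\<^sup>2"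
    using S by (simp only: mult_le_cancel_left_pos zero_less_power)
  moreover have "2 * (C + s) / S = 2 * (R + r + s) / (2 * R) * inverse (real m)"
    unfolding C_def S_def L0_def by (simp only: divide_inverse inverse_mult_distrib mult.assoc)
  ultimately show ?thesis unfolding \<kappa>_def \<eta>_def L0_def by simp
qed

text \<open>Let \<open>m\<close> tend to infinity at fixed \<open>K\<close>, which removes the
  boundary term, and then \<open>K\<close> tend to infinity, which shrinks the mesh of the fine
  grid. The second term on the left is the deficit caused by defects.\<close>

lemma density_bound:
  assumes mu: "\<mu> \<in> invariant_measures B" and R: "s < R" and e: "0 \<le> e" "e \<le> measure lebesgue (ball (0 :: real^2) (R - s))"
  shows "cell_area * measure_density B \<mu> + unit_area * r\<^sup>2 * (e * measure \<mu> (irregular R e 0) / (2 * R)\<^sup>2) \<le> unit_area * r\<^sup>2"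
proof -
  let ?D = "cell_area * measure_density B \<mu>" and ?p = "e * measure \<mu> (irregular R e 0) / (2 * R)\<^sup>2"
  have arith: "D + x * p \<le> x" if "0 < x" "D / x + p \<le> 1" for D x p :: real
    using mult_left_mono[OF that(2), of x] that(1) by (simp add: distrib_left)
  let ?k = "\<lambda>t. unit_area * (r + 2 * (2 * R * t))\<^sup>2"
  have R0: "0 < R" using R s_pos by linarith
  have "?D / ?k (inverse (real (Suc K))) + ?p \<le> 1" for K
  proof (rule LIMSEQ_le_const)
    have "(\<lambda>m. (1 + 2 * (R + r + s) / (2 * R) * inverse (real (Suc m)))\<^sup>2) \<longlonglongrightarrow> (1 + 2 * (R + r + s) / (2 * R) * 0)\<^sup>2"
      by (intro tendsto_intros LIMSEQ_inverse_real_of_nat)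
    then show "(\<lambda>m. (1 + 2 * (R + r + s) / (2 * R) * inverse (real (Suc m)))\<^sup>2) \<longlonglongrightarrow> 1" by simp
    show "\<exists>N. \<forall>n\<ge>N. ?D / ?k (inverse (real (Suc K))) + ?p \<le> (1 + 2 * (R + r + s) / (2 * R) * inverse (real (Suc n)))\<^sup>2"
      using finite_scale_bound[OF mu R e, of "Suc K" "Suc _"] by (simp only: divide_inverse zero_less_Suc simp_thms)
  qed
  moreover have kpos: "0 < ?k (inverse (real (Suc K)))" for K
    using r_pos R0 by (intro mult_pos_pos zero_less_power add_pos_pos) (auto simp: content_ball_pos)
  ultimately have le: "?D + ?k (inverse (real (Suc K))) * ?p \<le> ?k (inverse (real (Suc K)))" for K
    by (intro arith)
  show ?thesis
  proof (rule LIMSEQ_le)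
    show "(\<lambda>K. ?D + ?k (inverse (real (Suc K))) * ?p) \<longlonglongrightarrow> ?D + unit_area * r\<^sup>2 * ?p"
      by (rule tendsto_eq_intros LIMSEQ_inverse_real_of_nat refl | simp)+
    show "(\<lambda>K. ?k (inverse (real (Suc K)))) \<longlonglongrightarrow> unit_area * r\<^sup>2"
      by (rule tendsto_eq_intros LIMSEQ_inverse_real_of_nat refl | simp)+
    show "\<exists>N. \<forall>n\<ge>N. ?D + ?k (inverse (real (Suc n))) * ?p \<le> ?k (inverse (real (Suc n)))" using le by blast
  qed
qed

end

section \<open>The support of a measure of maximal density\<close>

context disk_packings
begin

abbreviation "max_density \<equiv> unit_area * r\<^sup>2 / cell_area"

lemma cell_area_pos: "0 < cell_area"
  using r_pos by simp

lemma measure_density_le: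
  assumes "\<mu> \<in> invariant_measures B" shows "measure_density B \<mu> \<le> max_density"
proof -
  \<comment> \<open>With \<open>e = 0\<close> the deficit vanishes and \<open>R\<close> may be any
    number above \<open>s\<close>.\<close>
  have "cell_area * measure_density B \<mu> \<le> unit_area * r\<^sup>2"
    using density_bound[OF assms, of "s + 1" 0] by simp
  then show ?thesis using cell_area_pos by (simp only: pos_le_divide_eq mult.commute)
qed

lemma optimal_irregular_null:
  assumes mu: "\<mu> \<in> invariant_measures B" "measure_density B \<mu> = max_density"
    and R: "s < R" and e: "0 < e" "e \<le> measure lebesgue (ball (0 :: real^2) (R - s))"
  shows "measure \<mu> (irregular R e 0) = 0"
proof -
  have cancel: "a * (k / a) = k" if "0 < a" for a k :: real using that by simp
  have zero: "p = 0" if "k * (e * p / q) \<le> 0" "0 < k" "0 < e" "0 < q" "0 \<le> p" for k e p q :: real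
  proof (rule ccontr)
    assume "p \<noteq> 0"
    then have "0 < k * (e * p / q)" using that(2-5) by (intro mult_pos_pos divide_pos_pos) auto
    then show False using that(1) by simp
  qed
  have "cell_area * measure_density B \<mu> = unit_area * r\<^sup>2"
    unfolding mu(2) by (rule cancel[OF cell_area_pos])
  then have "unit_area * r\<^sup>2 * (e * measure \<mu> (irregular R e 0) / (2 * R)\<^sup>2) \<le> 0"
    using density_bound[OF mu(1) R less_imp_le[OF e(1)] e(2)] by simp
  moreover have "0 < unit_area * r\<^sup>2" using r_pos by (simp add: content_ball_pos)
  moreover have "0 < (2 * R)\<^sup>2" using R s_pos by (intro zero_less_power) linarith
  ultimately show ?thesis using zero e(1) measure_nonneg by blast
qed

lemma optimal_support_hex:
  assumes mu: "\<mu> \<in> invariant_measures B" "measure_density B \<mu> = max_density"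
    and P: "P \<in> measure_support B \<mu>"
  shows "\<exists>x v. norm v = 2 * r \<and> P = ball_packing r (hex x v)"
proof -
  have "P \<in> packings B" using P by (simp add: measure_support_def)
  then obtain X where X: "separated (2 * r) X" "P = ball_packing r X" by (rule packingE)
  \<comment> \<open>A point of the support lies in no open null set, and sets of irregular packings
    are open.\<close>
  have reg: "P \<notin> irregular R e 0" if "s < R" "0 < e" "e \<le> measure lebesgue (ball (0 :: real^2) (R - s))" for R e
    using P optimal_irregular_null[OF mu that] openin_irregular[of R e 0] unfolding measure_support_def by force
  have ball: "0 < measure lebesgue (ball (0 :: real^2) (R - s))" if "s < R" for R
    using that by (simp add: content_ball_pos)
  have d: "0 < 2 * r" using r_pos by simp
  interpret separated_set "2 * r" s X by (rule separated_set.intro[OF d s_pos s_sq X(1)])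
  have "X \<inter> cball 0 (s + 1) \<noteq> {}"
    using reg[of "s + 1" "measure lebesgue (ball (0 :: real^2) (s + 1 - s))"] ball[of "s + 1"] ball_packing_irregular[OF X(1)] X(2) by simp
  then have ne: "X \<noteq> {}" by blast
  have "measure lebesgue (voronoi s X x) \<le> cell_area" if x: "x \<in> X" for x
  proof (rule field_le_epsilon)
    fix e :: real assume e: "0 < e"
    define R where "R = s + 1 + norm x"
    have R: "s < R" "norm x < R" using s_pos by (auto simp: R_def add_pos_nonneg)
    \<comment> \<open>The excess is capped by the area of the disk of radius \<open>R - s\<close>,
      as the deficit estimate requires; \<open>R\<close> was chosen large enough to see
      \<open>x\<close> from the origin.\<close>
    define e' where "e' = min e (measure lebesgue (ball (0 :: real^2) (R - s)))"
    have "P \<notin> irregular R e' 0" using reg[of R e'] R e ball[of R] by (simp add: e'_def)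
    then have "measure lebesgue (voronoi s X x) \<le> cell_area + e'"
      using x R(2) ball_packing_irregular[OF X(1)] X(2) by (auto simp: not_less dist_norm)
    also have "\<dots> \<le> cell_area + e" by (simp add: e'_def)
    finally show "measure lebesgue (voronoi s X x) \<le> cell_area + e" .
  qed
  then show ?thesis using hex_lattice[OF _ ne] X(2) by blast
qed

end

section \<open>Haar measure in coordinates\<close>

lemma linear_cmul: "linear (cmul z)"
  by (rule linearI) (simp_all add: cmul_add cmul_scaleR)

lemma det_cmul: "det (matrix (cmul z)) = (norm z)\<^sup>2"
  using norm_sq_real2[of z] by (simp add: det_2 matrix_def axis_def power2_eq_square)

lemma continuous_on_real2_iff:
  "continuous_on S f \<longleftrightarrow> continuous_on S (\<lambda>x. f x $ 1) \<and> continuous_on S (\<lambda>x. f x $ 2)"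
  for f :: "'a::topological_space \<Rightarrow> real^2"
proof
  assume *: "continuous_on S (\<lambda>x. f x $ 1) \<and> continuous_on S (\<lambda>x. f x $ 2)"
  have "f = (\<lambda>x. \<chi> i. f x $ i)" by simp
  moreover have "continuous_on S (\<lambda>x. \<chi> i. f x $ i)"
    using * by (intro continuous_on_vec_lambda) (metis exhaust_2)
  ultimately show "continuous_on S f" by simp
qed (auto intro: continuous_intros)

lemma continuous_on_cmul [continuous_intros]:
  assumes "continuous_on S f" "continuous_on S g" shows "continuous_on S (\<lambda>x. cmul (f x) (g x))"
  unfolding continuous_on_real2_iff cmul_nth using assms by (intro conjI continuous_intros)

lemma continuous_on_conj2 [continuous_intros]:
  assumes "continuous_on S f" shows "continuous_on S (\<lambda>x. conj2 (f x))"
  unfolding continuous_on_real2_iff conj2_nth using assms by (intro conjI continuous_intros)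

lemma lborel_distr_cmul:
  assumes "norm z = 1" shows "distr lborel borel (cmul z) = lborel"
proof (rule lborel_eqI[symmetric])
  have m: "cmul z \<in> borel_measurable borel"
    by (intro borel_measurable_continuous_onI continuous_intros)
  fix l u :: "real^2" assume lu: "\<And>b. b \<in> Basis \<Longrightarrow> l \<bullet> b \<le> u \<bullet> b"
  have img: "cmul z -` box l u = cmul (conj2 z) ` box l u"
  proof (intro equalityI subsetI)
    fix x assume "x \<in> cmul z -` box l u"
    then have "cmul (conj2 z) (cmul z x) \<in> cmul (conj2 z) ` box l u" by (intro imageI) simp
    then show "x \<in> cmul (conj2 z) ` box l u" by (simp add: cmul_conj2[OF assms])
  qed (auto simp: cmul_conj2[OF assms])
  have lm: "cmul (conj2 z) ` box l u \<in> lmeasurable"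
    by (intro measurable_linear_image linear_cmul) simp
  have "emeasure (distr lborel borel (cmul z)) (box l u) = emeasure lborel (cmul z -` box l u)"
    using m by (simp add: emeasure_distr)
  also have "\<dots> = emeasure lebesgue (cmul (conj2 z) ` box l u)"
    unfolding img[symmetric] using measurable_sets[OF m, of "box l u"] by (simp add: emeasure_completion)
  also have "\<dots> = ennreal (measure lebesgue (cmul (conj2 z) ` box l u))"
    using emeasure_eq_measure2[OF lm] by simp
  also have "measure lebesgue (cmul (conj2 z) ` box l u) = measure lebesgue (box l u)"
    using assms by (subst measure_linear_image[OF linear_cmul]) (simp_all add: det_cmul)
  also have "ennreal \<dots> = ennreal (\<Prod>b\<in>Basis. (u - l) \<bullet> b)"
    using lu by (simp add: measure_lborel_box_eq)
  finally show "emeasure (distr lborel borel (cmul z)) (box l u) = ennreal (\<Prod>b\<in>Basis. (u - l) \<bullet> b)" .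
qed simp

lemma nn_integral_lborel_cmul:
  assumes "norm z = 1" "f \<in> borel_measurable borel"
  shows "(\<integral>\<^sup>+ x. f (cmul z x) \<partial>lborel) = (\<integral>\<^sup>+ x. f x \<partial>lborel)"
proof -
  have "cmul z \<in> borel_measurable borel" by (intro borel_measurable_continuous_onI continuous_intros)
  then have "(\<integral>\<^sup>+ x. f x \<partial>distr lborel borel (cmul z)) = (\<integral>\<^sup>+ x. f (cmul z x) \<partial>lborel)"
    using assms(2) by (intro nn_integral_distr) auto
  then show ?thesis by (simp add: lborel_distr_cmul[OF assms(1)])
qed

lemma nn_integral_lborel_shift:
  fixes f :: "'a::euclidean_space \<Rightarrow> ennreal"
  assumes "f \<in> borel_measurable borel"
  shows "(\<integral>\<^sup>+ x. f (c + x) \<partial>lborel) = (\<integral>\<^sup>+ x. f x \<partial>lborel)"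
proof -
  have "(\<integral>\<^sup>+ x. f x \<partial>distr lborel borel ((+) c)) = (\<integral>\<^sup>+ x. f (c + x) \<partial>lborel)"
    using assms by (intro nn_integral_distr) auto
  then show ?thesis by (simp add: lborel_distr_plus)
qed

text \<open>A bounded set of Lebesgue measure 1, used as the normalising test set in the uniqueness
  argument for Haar measure.\<close>

definition unit_square :: "(real^2) set" where
  "unit_square = box 0 (vector [1, 1])"

lemma unit_square_borel [measurable]: "unit_square \<in> sets borel"
  by (simp add: unit_square_def)

lemma emeasure_unit_square: "emeasure lborel unit_square = 1"
proof -
  have "emeasure lborel unit_square = ennreal (measure lborel (cbox 0 (vector [1, 1] :: real^2)))"
    unfolding unit_square_def emeasure_lborel_box_eq emeasure_lborel_cbox_eq[symmetric]
    by (rule emeasure_eq_ennreal_measure) (use emeasure_lborel_cbox_finite[of 0 "vector [1, 1] :: real^2"] in \<open>simp add: less_top\<close>)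
  also have "cbox 0 (vector [1, 1] :: real^2) = square 0 1"
    by (auto simp: square_def mem_box_cart forall_2)
  finally show ?thesis using measure_square[of 0 1] square_lmeasurable[of 0 1]
    by (simp add: square_def)
qed

lemma borel_compose_continuous:
  "G \<in> borel_measurable borel \<Longrightarrow> continuous_on UNIV h \<Longrightarrow> (\<lambda>x. G (h x)) \<in> borel_measurable borel"
  by (rule measurable_compose[OF borel_measurable_continuous_onI])

text \<open>The following is the classical uniqueness argument for Haar measure, applied to the
  translations in the first coordinate only.\<close>

lemma disintegrate_translation_invariant:
  fixes N :: "((real^2) \<times> 'b::euclidean_space) measure"
  assumes sN: "sets N = sets borel" and sf: "sigma_finite_measure N"
    and inv: "\<And>c. distr N borel (\<lambda>p. (c + fst p, snd p)) = N"
    and F: "F \<in> borel_measurable borel"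
  shows "(\<integral>\<^sup>+ p. F p \<partial>N) = (\<integral>\<^sup>+ p. indicator unit_square (- fst p) * (\<integral>\<^sup>+ y. F (y, snd p) \<partial>lborel) \<partial>N)"
proof -
  interpret N: sigma_finite_measure N by fact
  interpret pair_sigma_finite N "lborel :: (real^2) measure" by unfold_locales
  note [measurable_cong] = sN
  note [measurable] = F
  have iQ: "(indicator unit_square :: real^2 \<Rightarrow> ennreal) \<in> borel_measurable borel" by simp
  have pm: "borel_measurable (N \<Otimes>\<^sub>M lborel) = (borel_measurable borel :: (((real^2) \<times> 'b) \<times> (real^2) \<Rightarrow> ennreal) set)"
    by (intro measurable_cong_sets refl)
      (simp only: sets_pair_measure_cong[OF sN sets_lborel] borel_prod)
  have m1: "(\<lambda>x. F (fst x) * indicator unit_square (snd x - fst (fst x))) \<in> borel_measurable (N \<Otimes>\<^sub>M lborel)"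
    unfolding pm by (intro borel_measurable_times_ennreal borel_compose_continuous[OF F] borel_compose_continuous[OF iQ] continuous_intros)
  have m2: "(\<lambda>x. F (snd x + fst (fst x), snd (fst x)) * indicator unit_square (- fst (fst x))) \<in> borel_measurable (N \<Otimes>\<^sub>M lborel)"
    unfolding pm by (intro borel_measurable_times_ennreal borel_compose_continuous[OF F] borel_compose_continuous[OF iQ] continuous_intros)
  have sF: "(\<integral>\<^sup>+ p. G p \<partial>N) = (\<integral>\<^sup>+ p. G (c + fst p, snd p) \<partial>N)" if [measurable]: "G \<in> borel_measurable borel" for G c
  proof -
    have "(\<integral>\<^sup>+ p. G p \<partial>distr N borel (\<lambda>p. (c + fst p, snd p))) = (\<integral>\<^sup>+ p. G (c + fst p, snd p) \<partial>N)"
    proof (intro nn_integral_distr)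
      have "(\<lambda>p :: (real^2) \<times> 'b. (c + fst p, snd p)) \<in> borel_measurable borel"
        by (intro borel_measurable_continuous_onI continuous_intros)
      then show "(\<lambda>p. (c + fst p, snd p)) \<in> measurable N borel" by (simp add: measurable_cong_sets[OF sN refl])
    qed (simp add: that)
    then show ?thesis by (simp add: inv)
  qed
  \<comment> \<open>Insert the integral 1 of a translated test set, exchange the integrals, move
    \<open>p\<close> by \<open>y\<close> using invariance, and exchange back: the average over
    \<open>y\<close> has become Lebesgue measure in the first coordinate.\<close>
  have "(\<integral>\<^sup>+ p. F p \<partial>N) = (\<integral>\<^sup>+ p. (\<integral>\<^sup>+ y. F p * indicator unit_square (y - fst p) \<partial>lborel) \<partial>N)"
  proof (rule nn_integral_cong)
    fix p :: "(real^2) \<times> 'b"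
    have "(\<integral>\<^sup>+ y. F p * indicator unit_square (y - fst p) \<partial>lborel) = F p * (\<integral>\<^sup>+ y. indicator unit_square (- fst p + y) \<partial>lborel)"
      by (subst nn_integral_cmult) (simp_all add: algebra_simps)
    also have "(\<integral>\<^sup>+ y. indicator unit_square (- fst p + y) \<partial>lborel) = (\<integral>\<^sup>+ y. indicator unit_square y \<partial>lborel)"
      by (rule nn_integral_lborel_shift) simp
    also have "\<dots> = 1" by (simp add: emeasure_unit_square)
    finally show "F p = (\<integral>\<^sup>+ y. F p * indicator unit_square (y - fst p) \<partial>lborel)" by simp
  qed
  also have "\<dots> = (\<integral>\<^sup>+ y. (\<integral>\<^sup>+ p. F p * indicator unit_square (y - fst p) \<partial>N) \<partial>lborel)"
    by (rule Fubini'[symmetric]) (use m1 in \<open>simp add: case_prod_beta'\<close>)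
  also have "\<dots> = (\<integral>\<^sup>+ y. (\<integral>\<^sup>+ p. F (y + fst p, snd p) * indicator unit_square (- fst p) \<partial>N) \<partial>lborel)"
  proof (rule nn_integral_cong)
    fix y :: "real^2"
    have "(\<integral>\<^sup>+ p. F p * indicator unit_square (y - fst p) \<partial>N)
        = (\<integral>\<^sup>+ p. F (y + fst p, snd p) * indicator unit_square (y - fst (y + fst p, snd p)) \<partial>N)"
      by (rule sF, intro borel_measurable_times_ennreal F borel_compose_continuous[OF iQ] continuous_intros)
    then show "(\<integral>\<^sup>+ p. F p * indicator unit_square (y - fst p) \<partial>N)
        = (\<integral>\<^sup>+ p. F (y + fst p, snd p) * indicator unit_square (- fst p) \<partial>N)" by simp
  qed
  also have "\<dots> = (\<integral>\<^sup>+ p. (\<integral>\<^sup>+ y. F (y + fst p, snd p) * indicator unit_square (- fst p) \<partial>lborel) \<partial>N)"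
    by (rule Fubini') (use m2 in \<open>simp add: case_prod_beta'\<close>)
  also have "\<dots> = (\<integral>\<^sup>+ p. indicator unit_square (- fst p) * (\<integral>\<^sup>+ y. F (y, snd p) \<partial>lborel) \<partial>N)"
  proof (rule nn_integral_cong)
    fix p :: "(real^2) \<times> 'b"
    have "(\<integral>\<^sup>+ y. F (y + fst p, snd p) * indicator unit_square (- fst p) \<partial>lborel)
        = (\<integral>\<^sup>+ y. F (fst p + y, snd p) \<partial>lborel) * indicator unit_square (- fst p)"
      by (subst nn_integral_multc) (simp_all add: add.commute)
    also have "(\<integral>\<^sup>+ y. F (fst p + y, snd p) \<partial>lborel) = (\<integral>\<^sup>+ y. F (y, snd p) \<partial>lborel)"
      by (rule nn_integral_lborel_shift[of "\<lambda>y. F (y, snd p)"]) measurable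
    finally show "(\<integral>\<^sup>+ y. F (y + fst p, snd p) * indicator unit_square (- fst p) \<partial>lborel)
        = indicator unit_square (- fst p) * (\<integral>\<^sup>+ y. F (y, snd p) \<partial>lborel)" by (simp add: mult.commute)
  qed
  finally show ?thesis .
qed

text \<open>Translation and rotation part read off from two evaluations, hence a continuous function
  for pointwise convergence even off the rigid motions.\<close>

definition coord :: "(real^2 \<Rightarrow> real^2) \<Rightarrow> (real^2) \<times> (real^2)" where
  "coord g = (g 0, g (vector [1, 0]) - g 0)"

text \<open>For unit z it turns the coordinates (a, z) of \<open>motion a z\<close> into the pair
  (b, z) with b the point that this motion sends to the origin.\<close>

definition chart :: "(real^2) \<times> (real^2) \<Rightarrow> (real^2) \<times> (real^2)" where
  "chart p = (- cmul (conj2 (snd p)) (fst p), snd p)"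

text \<open>\<open>place (b, z)\<close> translates \<open>b\<close> to the origin and then rotates by \<open>z\<close>.\<close>

definition place :: "(real^2) \<times> (real^2) \<Rightarrow> real^2 \<Rightarrow> real^2" where
  "place p x = cmul (snd p) (x - fst p)"

lemma coord_motion: "coord (motion a z) = (a, z)"
  by (simp add: coord_def motion_def real2_eq_iff)

lemma place_eq_motion: "place p = motion (- cmul (snd p) (fst p)) (snd p)"
  by (rule ext) (simp add: place_def motion_def cmul_diff)

lemma place_rigid: "norm (snd p) = 1 \<Longrightarrow> place p \<in> rigid_motions"
  unfolding place_eq_motion by (rule motion_rigid)

lemma chart_coord: "g \<in> rigid_motions \<Longrightarrow> place (chart (coord g)) = g"
  by (elim rigid_motionE) (simp add: coord_motion place_eq_motion chart_def cmul_minus cmul_conj2)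

lemma norm_snd_chart_coord: "g \<in> rigid_motions \<Longrightarrow> norm (snd (chart (coord g))) = 1"
  by (elim rigid_motionE) (simp add: coord_motion chart_def)

lemma coord_borel: "coord \<in> borel_measurable borel"
  unfolding coord_def by (intro borel_measurable_continuous_onI continuous_intros continuous_on_product_coordinates)

lemma continuous_on_chart: "continuous_on UNIV chart"
  unfolding chart_def by (intro continuous_intros)

lemma chart_borel: "chart \<in> borel_measurable borel"
  by (rule borel_measurable_continuous_onI[OF continuous_on_chart])

section \<open>Invariance of Haar measure in two systems of coordinates\<close>

locale haar =
  fixes \<nu> :: "(real^2 \<Rightarrow> real^2) measure"
  assumes haar: "haar_measure \<nu>"
begin

lemma sets_nu: "sets \<nu> = sets (restrict_space borel rigid_motions)"
  using haar by (simp add: haar_measure_def)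

lemma space_nu: "space \<nu> = rigid_motions"
  using sets_eq_imp_space_eq[OF sets_nu] by (simp add: space_restrict_space)

lemma left_invariant: "g \<in> rigid_motions \<Longrightarrow> S \<in> sets \<nu> \<Longrightarrow> emeasure \<nu> ((\<lambda>h. g \<circ> h) ` S) = emeasure \<nu> S"
  using haar by (simp add: haar_measure_def)

lemma coord_measurable: "coord \<in> measurable \<nu> borel"
  using measurable_restrict_space1[OF coord_borel] by (simp add: measurable_cong_sets[OF sets_nu refl])

lemma chart_coord_measurable: "(\<lambda>g. chart (coord g)) \<in> measurable \<nu> borel"
  by (rule measurable_compose[OF coord_measurable chart_borel])

definition N :: "((real^2) \<times> (real^2)) measure" where
  "N = distr \<nu> borel coord"

text \<open>In the coordinates of \<open>N\<close> a translation applied after the motion shifts the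
  first component; in those of \<open>M\<close> this is done by a translation applied before it, and
  a lattice packing becomes periodic in that component.\<close>

definition M :: "((real^2) \<times> (real^2)) measure" where
  "M = distr \<nu> borel (\<lambda>g. chart (coord g))"

lemma sets_N [simp]: "sets N = sets borel" and sets_M [simp]: "sets M = sets borel"
  and space_N [simp]: "space N = UNIV" and space_M [simp]: "space M = UNIV"
  by (simp_all add: N_def M_def)

lemma emeasure_N: "S \<in> sets borel \<Longrightarrow> emeasure N S = emeasure \<nu> {g \<in> rigid_motions. coord g \<in> S}"
  unfolding N_def by (subst emeasure_distr[OF coord_measurable]) (auto simp: space_nu intro!: arg_cong2[where f = emeasure])

lemma emeasure_M: "S \<in> sets borel \<Longrightarrow> emeasure M S = emeasure \<nu> {g \<in> rigid_motions. chart (coord g) \<in> S}"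
  unfolding M_def by (subst emeasure_distr[OF chart_coord_measurable]) (auto simp: space_nu intro!: arg_cong2[where f = emeasure])

lemma nn_integral_M: "F \<in> borel_measurable borel \<Longrightarrow> (\<integral>\<^sup>+ p. F p \<partial>M) = (\<integral>\<^sup>+ p. F (chart p) \<partial>N)"
  unfolding M_def N_def
  by (simp add: nn_integral_distr[OF chart_coord_measurable] nn_integral_distr[OF coord_measurable] measurable_compose[OF chart_borel])

lemma AE_N_norm: "AE p in N. norm (snd p) = 1"
proof -
  have m: "{p \<in> space borel. norm (snd p) = 1} \<in> sets (borel :: ((real^2) \<times> (real^2)) measure)"
    by (simp add: borel_closed closed_Collect_eq continuous_intros)
  show ?thesis unfolding N_def AE_distr_iff[OF coord_measurable m]
    by (rule AE_I2) (auto simp: space_nu coord_motion elim!: rigid_motionE)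
qed

lemma AE_M_norm: "AE p in M. norm (snd p) = 1"
proof -
  have m: "{p \<in> space borel. norm (snd p) = 1} \<in> sets (borel :: ((real^2) \<times> (real^2)) measure)"
    by (simp add: borel_closed closed_Collect_eq continuous_intros)
  show ?thesis unfolding M_def AE_distr_iff[OF chart_coord_measurable m]
    by (rule AE_I2) (simp add: space_nu norm_snd_chart_coord)
qed

lemma N_translation: "distr N borel (\<lambda>p. (c + fst p, snd p)) = N"
proof (rule measure_eqI)
  have sh: "(\<lambda>p :: (real^2) \<times> (real^2). (c + fst p, snd p)) \<in> borel_measurable borel"
    by (intro borel_measurable_continuous_onI continuous_intros)
  then have shN: "(\<lambda>p. (c + fst p, snd p)) \<in> measurable N borel" by (simp add: measurable_cong_sets[OF sets_N refl])
  fix S assume "S \<in> sets (distr N borel (\<lambda>p. (c + fst p, snd p)))"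
  then have S: "S \<in> sets borel" by simp
  define A where "A = {g \<in> rigid_motions. coord g \<in> S}"
  define A' where "A' = {g \<in> rigid_motions. coord ((+) c \<circ> g) \<in> S}"
  have c: "coord ((+) c \<circ> g) = (c + fst (coord g), snd (coord g))" for g by (simp add: coord_def)
  have "A' = {g \<in> rigid_motions. coord g \<in> (\<lambda>p. (c + fst p, snd p)) -` S}" by (simp add: A'_def c)
  moreover have "(\<lambda>p. (c + fst p, snd p)) -` S \<in> sets (borel :: ((real^2) \<times> (real^2)) measure)"
    using measurable_sets[OF sh S] by simp
  ultimately have "emeasure (distr N borel (\<lambda>p. (c + fst p, snd p))) S = emeasure \<nu> A'" and A's: "A' \<in> sets \<nu>"
    using measurable_sets[OF coord_measurable, of "(\<lambda>p. (c + fst p, snd p)) -` S"]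
    by (simp_all add: emeasure_distr[OF shN] S emeasure_N space_nu vimage_def Int_def conj_commute)
  moreover have img: "(\<lambda>h. (+) c \<circ> h) ` A' = A"
  proof (intro equalityI subsetI)
    fix g assume g: "g \<in> A"
    have "(+) c \<circ> ((+) (- c) \<circ> g) = g" by auto
    moreover from this have "(+) (- c) \<circ> g \<in> A'"
      using g rigid_comp[OF translation_rigid, of g "- c"] by (simp add: A_def A'_def)
    ultimately show "g \<in> (\<lambda>h. (+) c \<circ> h) ` A'" by (metis imageI)
  qed (auto simp: A_def A'_def intro: rigid_comp translation_rigid)
  moreover have "emeasure N S = emeasure \<nu> A" using S by (simp add: emeasure_N A_def)
  ultimately show "emeasure (distr N borel (\<lambda>p. (c + fst p, snd p))) S = emeasure N S"
    using left_invariant[OF translation_rigid A's, of c, unfolded img] by simp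
qed simp

lemma continuous_motion: "continuous_on UNIV (\<lambda>p. motion (fst p) (snd p))"
  by (rule continuous_on_coordinatewise_then_product) (auto simp: motion_def intro!: continuous_intros)

lemma N_bounded_finite: "emeasure N {p. norm (fst p) \<le> k} < \<infinity>"
proof -
  let ?K = "(\<lambda>p. motion (fst p) (snd p)) ` (cball 0 k \<times> sphere 0 1)"
  have "compact ?K"
    by (intro compact_continuous_image continuous_on_subset[OF continuous_motion] compact_Times) auto
  moreover have "?K \<subseteq> rigid_motions" by (auto intro: motion_rigid)
  ultimately have "emeasure \<nu> ?K < \<infinity>" using haar by (simp add: haar_measure_def)
  moreover have "{g \<in> rigid_motions. coord g \<in> {p. norm (fst p) \<le> k}} = ?K"
    by (force simp: rigid_motions_eq coord_motion image_iff)
  moreover have "{p :: (real^2) \<times> (real^2). norm (fst p) \<le> k} \<in> sets borel"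
    by (intro borel_closed closed_Collect_le continuous_intros)
  ultimately show ?thesis by (simp add: emeasure_N)
qed

lemma sigma_finite_N: "sigma_finite_measure N"
proof
  let ?A = "range (\<lambda>k :: nat. {p :: (real^2) \<times> (real^2). norm (fst p) \<le> real k})"
  have "{p :: (real^2) \<times> (real^2). norm (fst p) \<le> real k} \<in> sets borel" for k
    by (intro borel_closed closed_Collect_le continuous_intros)
  moreover have "\<Union>?A = UNIV" using real_arch_simple by auto
  ultimately show "\<exists>A. countable A \<and> A \<subseteq> sets N \<and> \<Union>A = space N \<and> (\<forall>a\<in>A. emeasure N a \<noteq> \<infinity>)"
    using N_bounded_finite by (intro exI[of _ ?A]) (auto simp: less_top[symmetric])
qed

text \<open>For a fixed rotation z the chart acts on the translation part as multiplication by the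
  unit \<open>- conj2 z\<close>, which preserves Lebesgue measure. So the disintegration of
  \<open>N\<close> over the rotations serves for \<open>M\<close> too.\<close>

lemma nn_integral_M_eq:
  assumes F: "F \<in> borel_measurable borel"
  shows "(\<integral>\<^sup>+ p. F p \<partial>M) = (\<integral>\<^sup>+ p. indicator unit_square (- fst p) * (\<integral>\<^sup>+ y. F (y, snd p) \<partial>lborel) \<partial>N)"
proof -
  have Fc: "(\<lambda>p. F (chart p)) \<in> borel_measurable borel" by (rule measurable_compose[OF chart_borel F])
  have "(\<integral>\<^sup>+ p. F p \<partial>M) = (\<integral>\<^sup>+ p. indicator unit_square (- fst p) * (\<integral>\<^sup>+ y. F (chart (y, snd p)) \<partial>lborel) \<partial>N)"
    unfolding nn_integral_M[OF F]
    by (rule disintegrate_translation_invariant[OF sets_N sigma_finite_N N_translation Fc])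
  also have "\<dots> = (\<integral>\<^sup>+ p. indicator unit_square (- fst p) * (\<integral>\<^sup>+ y. F (y, snd p) \<partial>lborel) \<partial>N)"
  proof (rule nn_integral_cong_AE, use AE_N_norm in eventually_elim)
    fix p :: "(real^2) \<times> (real^2)" assume "norm (snd p) = 1"
    then have n: "norm (- conj2 (snd p)) = 1" by simp
    have e: "chart (y, snd p) = (cmul (- conj2 (snd p)) y, snd p)" for y
      by (simp add: chart_def real2_eq_iff)
    have "(\<lambda>y. F (y, snd p)) \<in> borel_measurable borel"
      by (rule measurable_compose[OF borel_measurable_continuous_onI F]) (intro continuous_intros)
    then show "indicator unit_square (- fst p) * (\<integral>\<^sup>+ y. F (chart (y, snd p)) \<partial>lborel)
        = indicator unit_square (- fst p) * (\<integral>\<^sup>+ y. F (y, snd p) \<partial>lborel)"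
      unfolding e using nn_integral_lborel_cmul[OF n, of "\<lambda>y. F (y, snd p)"] by simp
  qed
  finally show ?thesis .
qed

text \<open>This is invariance under right multiplication by translations, whereas the hypothesis
  concerns left multiplication. It follows because the fibres over the rotations carry Lebesgue
  measure.\<close>

lemma M_translation: "distr M borel (\<lambda>p. (c + fst p, snd p)) = M"
proof (rule measure_eqI)
  have sh: "(\<lambda>p :: (real^2) \<times> (real^2). (c + fst p, snd p)) \<in> borel_measurable borel"
    by (intro borel_measurable_continuous_onI continuous_intros)
  then have shM: "(\<lambda>p. (c + fst p, snd p)) \<in> measurable M borel" by (simp add: measurable_cong_sets[OF sets_M refl])
  fix S assume "S \<in> sets (distr M borel (\<lambda>p. (c + fst p, snd p)))"
  then have S: "S \<in> sets borel" by simp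
  have i: "indicator S \<in> borel_measurable (borel :: ((real^2) \<times> (real^2)) measure)" using S by simp
  have i2: "(\<lambda>p. indicator S (c + fst p, snd p)) \<in> borel_measurable (borel :: ((real^2) \<times> (real^2)) measure)"
    by (rule measurable_compose[OF sh i])
  have "emeasure (distr M borel (\<lambda>p. (c + fst p, snd p))) S = (\<integral>\<^sup>+ p. indicator S p \<partial>distr M borel (\<lambda>p. (c + fst p, snd p)))"
    using S by simp
  also have "\<dots> = (\<integral>\<^sup>+ p. indicator S (c + fst p, snd p) \<partial>M)"
    by (rule nn_integral_distr[OF shM]) (use S in simp)
  also have "\<dots> = (\<integral>\<^sup>+ p. indicator unit_square (- fst p) * (\<integral>\<^sup>+ y. indicator S (c + y, snd p) \<partial>lborel) \<partial>N)"
    unfolding nn_integral_M_eq[OF i2] by simp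
  also have "\<dots> = (\<integral>\<^sup>+ p. indicator unit_square (- fst p) * (\<integral>\<^sup>+ y. indicator S (y, snd p) \<partial>lborel) \<partial>N)"
  proof (rule nn_integral_cong, rule arg_cong2[where f = times, OF refl])
    fix p :: "(real^2) \<times> (real^2)"
    have "(\<lambda>y. indicator S (y, snd p) :: ennreal) \<in> borel_measurable borel"
      by (rule measurable_compose[OF borel_measurable_continuous_onI i]) (intro continuous_intros)
    then show "(\<integral>\<^sup>+ y. indicator S (c + y, snd p) \<partial>lborel) = (\<integral>\<^sup>+ y. indicator S (y, snd p) \<partial>lborel)"
      by (rule nn_integral_lborel_shift)
  qed
  also have "\<dots> = (\<integral>\<^sup>+ p. indicator S p \<partial>M)" by (rule nn_integral_M_eq[OF i, symmetric])
  also have "\<dots> = emeasure M S" using S by simp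
  finally show "emeasure (distr M borel (\<lambda>p. (c + fst p, snd p))) S = emeasure M S" .
qed simp

text \<open>The mass of the rotation factor: the marginal of \<open>M\<close> in the first
  coordinate is \<open>C\<close> times Lebesgue measure.\<close>

definition C :: real where
  "C = measure N {p. - fst p \<in> unit_square}"

lemma emeasure_M_Times:
  assumes "S \<in> sets borel" shows "emeasure M (S \<times> UNIV) = ennreal C * emeasure lborel S"
proof -
  have mQ: "{p. - fst p \<in> unit_square} \<in> sets (borel :: ((real^2) \<times> (real^2)) measure)"
  proof -
    have "{p. - fst p \<in> unit_square} = (\<lambda>p :: (real^2) \<times> (real^2). - fst p) -` unit_square" by auto
    also have "open \<dots>" unfolding unit_square_def by (intro open_vimage open_box continuous_intros)
    finally show ?thesis by (rule borel_open)
  qed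
  have mS: "S \<times> UNIV \<in> sets (borel :: ((real^2) \<times> (real^2)) measure)"
    using assms by (simp add: borel_prod[symmetric] pair_measureI)
  have "{p. - fst p \<in> unit_square} \<subseteq> {p :: (real^2) \<times> (real^2). norm (fst p) \<le> 2}"
  proof
    fix p :: "(real^2) \<times> (real^2)" assume "p \<in> {p. - fst p \<in> unit_square}"
    then have "\<bar>fst p $ 1\<bar> \<le> 1" "\<bar>fst p $ 2\<bar> \<le> 1" by (auto simp: unit_square_def mem_box_cart forall_2)
    then show "p \<in> {p. norm (fst p) \<le> 2}" using norm_le_l1_cart[of "fst p"] by (simp add: sum_2)
  qed
  then have fin: "emeasure N {p. - fst p \<in> unit_square} < \<infinity>"
  proof -
    have "{p :: (real^2) \<times> (real^2). norm (fst p) \<le> 2} \<in> sets borel"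
      by (intro borel_closed closed_Collect_le continuous_intros)
    then show ?thesis
      using emeasure_mono[OF \<open>{p. - fst p \<in> unit_square} \<subseteq> _\<close>, of N] N_bounded_finite[of 2] by (auto intro: le_less_trans)
  qed
  have "emeasure M (S \<times> UNIV) = (\<integral>\<^sup>+ p. indicator (S \<times> UNIV) p \<partial>M)" using mS by simp
  also have "\<dots> = (\<integral>\<^sup>+ p. indicator unit_square (- fst p) * (\<integral>\<^sup>+ y. indicator (S \<times> UNIV) (y, snd p) \<partial>lborel) \<partial>N)"
    using mS by (intro nn_integral_M_eq) simp
  also have "\<dots> = (\<integral>\<^sup>+ p. emeasure lborel S * indicator {p. - fst p \<in> unit_square} p \<partial>N)"
  proof (rule nn_integral_cong)
    fix p :: "(real^2) \<times> (real^2)"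
    have "(\<lambda>y. indicator (S \<times> UNIV) (y, snd p) :: ennreal) = indicator S" by (simp add: fun_eq_iff indicator_def)
    then have "(\<integral>\<^sup>+ y. indicator (S \<times> UNIV) (y, snd p) \<partial>lborel) = emeasure lborel S" using assms by simp
    then show "indicator unit_square (- fst p) * (\<integral>\<^sup>+ y. indicator (S \<times> UNIV) (y, snd p) \<partial>lborel)
        = emeasure lborel S * indicator {p. - fst p \<in> unit_square} p"
      by (simp add: indicator_def)
  qed
  also have "\<dots> = emeasure lborel S * emeasure N {p. - fst p \<in> unit_square}"
    using mQ by (subst nn_integral_cmult_indicator) auto
  also have "emeasure N {p. - fst p \<in> unit_square} = ennreal C"
    unfolding C_def using fin by (intro emeasure_eq_ennreal_measure) (simp add: less_top)
  finally show ?thesis by (simp add: mult.commute)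
qed

lemma C_pos: "0 < C"
proof (rule ccontr)
  assume "\<not> 0 < C"
  then have "C = 0" using measure_nonneg[of N "{p. - fst p \<in> unit_square}"] unfolding C_def by linarith
  then have "emeasure M UNIV = 0" using emeasure_M_Times[of UNIV] by simp
  then have "emeasure \<nu> rigid_motions = 0" by (simp add: emeasure_M)
  then show False using haar by (simp add: haar_measure_def space_nu)
qed

end

section \<open>The orbit of the hexagonal packing\<close>

lemma motion_hex:
  assumes z: "norm z = 1"
  shows "motion a z ` hex x v = hex (motion a z x) (cmul z v)"
proof -
  have rot: "cmul z (rot60 v) = rot60 (cmul z v)"
    by (simp add: rot60_def real2_eq_iff algebra_simps)
  have "motion a z (x + s *\<^sub>R v + t *\<^sub>R rot60 v) = motion a z x + s *\<^sub>R cmul z v + t *\<^sub>R rot60 (cmul z v)" for s t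
    by (simp add: motion_def cmul_add cmul_scaleR rot)
  then show ?thesis unfolding hex_def by (auto simp: image_iff) metis+
qed

definition shift :: "'a::plus \<Rightarrow> 'a \<times> 'b \<Rightarrow> 'a \<times> 'b" where
  "shift v p = (v + fst p, snd p)"

lemma shift_simps [simp]: "fst (shift v p) = v + fst p" "snd (shift v p) = snd p"
  by (simp_all add: shift_def)

lemma shift_borel: "shift (v :: real^2) \<in> borel_measurable (borel :: ((real^2) \<times> (real^2)) measure)"
  unfolding shift_def by (intro borel_measurable_continuous_onI continuous_intros)

lemma continuous_on_place: "continuous_on UNIV (\<lambda>p. place p x)"
  unfolding place_def by (intro continuous_intros)

lemma place_inverse:
  assumes "norm (snd p) = 1"
  shows "fst p + cmul (conj2 (snd p)) (place p x) = x" "place p (fst p + cmul (conj2 (snd p)) y) = y"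
  using assms by (simp_all add: place_def cmul_conj2)

text \<open>The inverse of \<open>place p\<close> depends continuously on \<open>p\<close>. So
  points of the moved sets that converge can be pulled back to a convergent sequence in
  \<open>X\<close>, whose limit stays in the closed set \<open>X\<close>.\<close>

lemma centres_converge_place:
  assumes X: "closed X" and lim: "p \<longlonglongrightarrow> q" and n: "\<And>j. norm (snd (p j)) = 1" "norm (snd q) = 1"
  shows "centres_converge (\<lambda>j. place (p j) ` X) (place q ` X)"
  unfolding centres_converge_def
proof (intro conjI ballI allI impI)
  fix y assume "y \<in> place q ` X"
  then obtain x where x: "x \<in> X" "y = place q x" by blast
  have "(\<lambda>j. place (p j) x) \<longlonglongrightarrow> place q x"
    by (rule continuous_on_tendsto_compose[OF continuous_on_place lim]) auto
  then show "\<exists>\<xi>. (\<forall>\<^sub>F j in sequentially. \<xi> j \<in> place (p j) ` X) \<and> \<xi> \<longlonglongrightarrow> y"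
    using x by (intro exI[of _ "\<lambda>j. place (p j) x"]) simp
next
  fix k \<xi> y assume *: "strict_mono k \<and> (\<forall>i. \<xi> i \<in> place (p (k i)) ` X) \<and> \<xi> \<longlonglongrightarrow> y"
  define x where "x i = fst (p (k i)) + cmul (conj2 (snd (p (k i)))) (\<xi> i)" for i
  have xX: "x i \<in> X" for i
  proof -
    obtain t where "t \<in> X" "\<xi> i = place (p (k i)) t" using * by blast
    then show ?thesis using n(1)[of "k i"] by (simp add: x_def place_inverse)
  qed
  have pk: "(\<lambda>i. p (k i)) \<longlonglongrightarrow> q" using LIMSEQ_subseq_LIMSEQ[OF lim, of k] * by (simp add: comp_def)
  have "(\<lambda>i. (p (k i), \<xi> i)) \<longlonglongrightarrow> (q, y)" using pk * by (intro tendsto_Pair) auto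
  then have "(\<lambda>i. fst (fst (p (k i), \<xi> i)) + cmul (conj2 (snd (fst (p (k i), \<xi> i)))) (snd (p (k i), \<xi> i)))
      \<longlonglongrightarrow> fst (fst (q, y)) + cmul (conj2 (snd (fst (q, y)))) (snd (q, y))"
    by (intro continuous_on_tendsto_compose[where f = "\<lambda>u. fst (fst u) + cmul (conj2 (snd (fst u))) (snd u)" and s = UNIV] continuous_intros) auto
  then have "x \<longlonglongrightarrow> fst q + cmul (conj2 (snd q)) y" unfolding x_def by simp
  then have "fst q + cmul (conj2 (snd q)) y \<in> X" using X xX closed_sequentially by blast
  then show "y \<in> place q ` X" using place_inverse(2)[OF n(2), of y] by (metis imageI)
qed

locale hex_orbit = disk_packings r c + haar \<nu> for r c \<nu>
begin

definition w0 :: "real^2" where "w0 = vector [2 * r, 0]"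

abbreviation "lam \<equiv> lat w0"

definition lattice :: "(real^2) set" where "lattice = range lam"

definition basis_map :: "real^2 \<Rightarrow> real^2" where
  "basis_map a = (a $ 1) *\<^sub>R w0 + (a $ 2) *\<^sub>R rot60 w0"

text \<open>Half open, so that its lattice translates tile the plane exactly and not merely up to
  null sets.\<close>

definition cell :: "(real^2) set" where
  "cell = basis_map ` {a. 0 \<le> a $ 1 \<and> a $ 1 < 1 \<and> 0 \<le> a $ 2 \<and> a $ 2 < 1}"

definition P0 :: "(real^2) set set" where "P0 = ball_packing r lattice"

lemma norm_w0: "norm w0 = 2 * r"
proof -
  have "(norm w0)\<^sup>2 = (2 * r)\<^sup>2" unfolding norm_sq_real2 by (simp add: w0_def)
  then show ?thesis using r_pos power2_eq_iff_nonneg[of "norm w0" "2 * r"] by simp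
qed

lemma lam_minus: "- lam k = lam (- fst k, - snd k)"
  by (simp add: lat_def)

lemma dist_lam: "k \<noteq> l \<Longrightarrow> 2 * r \<le> dist (lam k) (lam l)"
  using dist_lat_ge[of k l w0] unfolding norm_w0 .

lemma lam_inj: "lam k = lam l \<Longrightarrow> k = l"
  using dist_lam[of k l] r_pos by force

lemma separated_lattice: "separated (2 * r) lattice"
  unfolding separated_def
proof (intro ballI impI)
  fix x y assume "x \<in> lattice" "y \<in> lattice" "x \<noteq> y"
  then obtain k l where "x = lam k" "y = lam l" "k \<noteq> l" unfolding lattice_def by blast
  then show "2 * r \<le> dist x y" using dist_lam by simp
qed

lemma lattice_closed: "closed lattice"
  using separated_closed[of "2 * r"] separated_lattice r_pos by simp

lemma lattice_translate: "(\<lambda>x. x - lam k) ` lattice = lattice"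
proof (intro equalityI subsetI)
  fix y assume "y \<in> lattice"
  then obtain l where "y = lam l" by (auto simp: lattice_def)
  then have "y = lam (fst l + fst k, snd l + snd k) - lam k" by (simp add: lat_diff)
  then show "y \<in> (\<lambda>x. x - lam k) ` lattice" by (auto simp: lattice_def)
qed (auto simp: lattice_def lat_diff)

lemma P0_packing: "P0 \<in> packings B"
  unfolding P0_def by (rule packingI[OF separated_lattice])

lemma linear_basis_map: "linear basis_map"
  by (rule linearI) (simp_all add: basis_map_def scaleR_left_distrib scaleR_right_distrib)

text \<open>The fundamental parallelogram of the lattice has the area of the minimal cell, which is
  why the hexagonal packing attains the density bound.\<close>

lemma det_basis_map: "det (matrix basis_map) = cell_area"
  by (simp add: det_2 matrix_def basis_map_def axis_def w0_def rot60_def real_div_sqrt field_simps)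

definition basis_coord :: "real^2 \<Rightarrow> real^2" where
  "basis_coord b = vector [(b $ 1 - b $ 2 / sqrt 3) / (2 * r), b $ 2 / (sqrt 3 * r)]"

lemma basis_coord_map: "basis_coord (basis_map a) = a"
  using r_pos by (simp add: basis_coord_def basis_map_def w0_def rot60_def real2_eq_iff field_simps)

lemma basis_map_coord: "basis_map (basis_coord b) = b"
  using r_pos by (simp add: basis_coord_def basis_map_def w0_def rot60_def real2_eq_iff field_simps)

lemma basis_map_inj: "inj basis_map"
  by (rule injI) (metis basis_coord_map)

lemma lam_eq_basis_map: "lam k = basis_map (vector [of_int (fst k), of_int (snd k)])"
  by (simp add: lat_def basis_map_def)

lemma cell_tiling: "\<exists>!k. b - lam k \<in> cell"
proof -
  obtain a where a: "b = basis_map a" using basis_map_coord by metis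
  have *: "b - lam k \<in> cell \<longleftrightarrow> k = (\<lfloor>a $ 1\<rfloor>, \<lfloor>a $ 2\<rfloor>)" for k
  proof -
    have "b - lam k = basis_map (a - vector [of_int (fst k), of_int (snd k)])"
      unfolding a lam_eq_basis_map by (rule linear_diff[OF linear_basis_map, symmetric])
    then have "b - lam k \<in> cell \<longleftrightarrow> 0 \<le> a $ 1 - of_int (fst k) \<and> a $ 1 - of_int (fst k) < 1 \<and> 0 \<le> a $ 2 - of_int (snd k) \<and> a $ 2 - of_int (snd k) < 1"
      unfolding cell_def by (simp add: inj_image_mem_iff[OF basis_map_inj])
    also have "\<dots> \<longleftrightarrow> fst k = \<lfloor>a $ 1\<rfloor> \<and> snd k = \<lfloor>a $ 2\<rfloor>" by linarith
    finally show ?thesis by (auto simp: prod_eq_iff)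
  qed
  then show ?thesis by auto
qed

lemma cell_measure: "cell \<in> sets borel" "emeasure lborel cell = ennreal cell_area" "bounded cell"
proof -
  define Q where "Q = {a :: real^2. 0 \<le> a $ 1 \<and> a $ 1 < 1 \<and> 0 \<le> a $ 2 \<and> a $ 2 < 1}"
  have Qsq: "Q \<subseteq> square 0 1" by (auto simp: Q_def mem_square)
  then have Qb: "bounded Q" by (rule bounded_subset[rotated]) (simp add: square_def)
  have "Q = ({a. 0 \<le> a $ 1} \<inter> {a. 0 \<le> a $ 2}) \<inter> ({a. a $ 1 < 1} \<inter> {a. a $ 2 < 1})" by (auto simp: Q_def)
  also have "\<dots> \<in> sets borel"
    by (intro sets.Int borel_closed[OF closed_Collect_le] borel_open[OF open_Collect_less] continuous_intros)
  finally have Qs: "Q \<in> sets borel" .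
  have "cell = basis_coord -` Q"
  proof (intro equalityI subsetI)
    fix b assume "b \<in> basis_coord -` Q"
    then have "basis_map (basis_coord b) \<in> basis_map ` Q" by simp
    then show "b \<in> cell" by (simp add: basis_map_coord cell_def Q_def)
  qed (auto simp: cell_def Q_def basis_coord_map)
  moreover have "basis_coord \<in> borel_measurable borel"
    using r_pos unfolding basis_coord_def
    by (intro borel_measurable_continuous_onI) (auto simp: continuous_on_real2_iff intro!: continuous_intros)
  ultimately show cs: "cell \<in> sets borel" using measurable_sets[of basis_coord borel borel Q] Qs by simp
  show cb: "bounded cell" unfolding cell_def Q_def[symmetric]
    by (rule bounded_linear_image[OF Qb]) (use linear_basis_map in \<open>simp add: linear_conv_bounded_linear\<close>)
  have Qm: "Q \<in> lmeasurable"
    using Qs bounded_set_imp_lmeasurable[OF Qb] by simp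
  \<comment> \<open>The half-open square is squeezed between the open and the closed unit
    square.\<close>
  have "measure lebesgue (box 0 (vector [1, 1] :: real^2)) \<le> measure lebesgue Q"
    by (rule measure_mono_fmeasurable) (use Qm in \<open>auto simp: Q_def mem_box_cart forall_2\<close>)
  moreover have "measure lebesgue (box 0 (vector [1, 1] :: real^2)) = 1"
    using emeasure_unit_square by (simp add: unit_square_def measure_def)
  moreover have "measure lebesgue Q \<le> measure lebesgue (square 0 1)"
    by (rule measure_mono_fmeasurable[OF Qsq _ square_lmeasurable]) (use Qm in auto)
  ultimately have "measure lebesgue Q = 1" by (simp add: measure_square)
  then have "measure lebesgue cell = cell_area"
    unfolding cell_def Q_def[symmetric] measure_linear_image[OF linear_basis_map Qm] det_basis_map
    using cell_area_pos by simp
  then show "emeasure lborel cell = ennreal cell_area"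
    using cs emeasure_eq_ennreal_measure[of lborel cell] emeasure_bounded_finite[OF cb] by (simp add: less_top)
qed

end

section \<open>The invariant measure on the orbit\<close>

context hex_orbit
begin

abbreviation "S1 \<equiv> {p :: (real^2) \<times> (real^2). norm (snd p) = 1}"

text \<open>The default \<open>P0\<close> keeps the map within the packings and measurable on the
  whole space; it occurs only on an \<open>M\<close>-null set.\<close>

definition orb :: "(real^2) \<times> (real^2) \<Rightarrow> (real^2) set set" where
  "orb p = (if p \<in> S1 then ball_packing r (place p ` lattice) else P0)"

lemma closed_S1: "closed S1"
  by (intro closed_Collect_eq continuous_intros)

lemma S1_borel: "S1 \<in> sets borel"
  using closed_S1 by (rule borel_closed)

lemma orb_eq_move: "p \<in> S1 \<Longrightarrow> orb p = move_packing (place p) P0"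
  by (simp add: orb_def P0_def move_ball_packing place_rigid)

lemma orb_packing: "orb p \<in> packings B"
  unfolding orb_def using P0_packing packingI[OF separated_rigid[OF place_rigid separated_lattice]] by simp

lemma orb_chart: "g \<in> rigid_motions \<Longrightarrow> orb (chart (coord g)) = move_packing g P0"
  by (simp add: orb_eq_move norm_snd_chart_coord chart_coord)

lemma orb_shift: "orb (shift (lam k) p) = orb p"
proof -
  have "place (shift (lam k) p) ` lattice = place p ` (\<lambda>x. x - lam k) ` lattice"
    unfolding image_image by (intro image_cong) (simp_all add: place_def algebra_simps)
  then show ?thesis by (simp add: orb_def lattice_translate)
qed

text \<open>Continuity of \<open>orb\<close> on \<open>S1\<close>, in the form of closed sets:
  \<open>S1\<close> is closed in the plane times the plane, and the packing topology is given by its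
  convergent sequences.\<close>

lemma orb_open: "openin (packing_topology B) U \<Longrightarrow> closed {p \<in> S1. orb p \<notin> U}"
proof -
  assume U: "openin (packing_topology B) U"
  show ?thesis
    unfolding closed_sequential_limits
  proof (intro allI impI, elim conjE)
    fix p q assume p: "\<forall>n. p n \<in> {p \<in> S1. orb p \<notin> U}" and lim: "p \<longlonglongrightarrow> q"
    have q: "q \<in> S1" using closed_sequentially[OF closed_S1 _ lim] p by blast
    moreover have "orb q \<notin> U"
    proof
      assume "orb q \<in> U"
      then have "ball_packing r (place q ` lattice) \<in> U" using q by (simp add: orb_def)
      moreover have "centres_converge (\<lambda>j. place (p j) ` lattice) (place q ` lattice)"
        using p q by (intro centres_converge_place lattice_closed lim) auto
      moreover have "separated (2 * r) (place q ` lattice)" "\<forall>j. separated (2 * r) (place (p j) ` lattice)"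
        using p q by (auto intro!: separated_rigid place_rigid separated_lattice)
      ultimately have "\<forall>\<^sub>F j in sequentially. ball_packing r (place (p j) ` lattice) \<in> U"
        using conjunct2[OF U[unfolded openin_iff], rule_format, of "place q ` lattice" "\<lambda>j. place (p j) ` lattice"] by blast
      then obtain j where "ball_packing r (place (p j) ` lattice) \<in> U"
        using eventually_happens'[OF sequentially_bot] by blast
      moreover have "p j \<in> S1" "orb (p j) \<notin> U" using p by blast+
      ultimately show False by (simp add: orb_def)
    qed
    ultimately show "q \<in> {p \<in> S1. orb p \<notin> U}" by blast
  qed
qed

lemma orb_measurable: "orb \<in> measurable borel (packing_borel B)"
proof (rule measurable_packing_borelI)
  fix U assume U: "openin (packing_topology B) U"
  have "orb -` U \<inter> space borel = (S1 - {p \<in> S1. orb p \<notin> U}) \<union> (if P0 \<in> U then - S1 else {})"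
  proof (rule set_eqI)
    fix p
    have "p \<notin> S1 \<Longrightarrow> orb p = P0" by (simp add: orb_def)
    then show "p \<in> orb -` U \<inter> space borel \<longleftrightarrow> p \<in> (S1 - {p \<in> S1. orb p \<notin> U}) \<union> (if P0 \<in> U then - S1 else {})"
      by (cases "p \<in> S1") auto
  qed
  then show "orb -` U \<inter> space borel \<in> sets borel"
    using S1_borel borel_closed[OF orb_open[OF U]] by (auto intro: sets.Diff sets.Un)
qed (rule orb_packing)

lemma orb_measurable_M: "orb \<in> measurable M (packing_borel B)"
  using orb_measurable by (simp add: measurable_cong_sets[OF sets_M refl])

lemma emeasure_M_shift:
  assumes "S \<in> sets borel" shows "emeasure M (shift v -` S) = emeasure M S"
proof -
  have "shift v \<in> measurable M borel" using shift_borel by (simp add: measurable_cong_sets[OF sets_M refl])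
  then have "emeasure (distr M borel (shift v)) S = emeasure M (shift v -` S)"
    using assms by (simp add: emeasure_distr)
  then show ?thesis using M_translation[of v] by (simp add: shift_def[abs_def])
qed

text \<open>The translate of \<open>H\<close> by \<open>lam k\<close>, written as a preimage so that
  its measurability follows from that of the shift.\<close>

definition tile :: "((real^2) \<times> (real^2)) set \<Rightarrow> int \<times> int \<Rightarrow> ((real^2) \<times> (real^2)) set" where
  "tile H k = shift (- lam k) -` H"

definition fundamental :: "((real^2) \<times> (real^2)) set \<Rightarrow> bool" where
  "fundamental H \<longleftrightarrow> H \<in> sets borel \<and> (\<forall>p. \<exists>!k. p \<in> tile H k)"

lemma tile_borel: "H \<in> sets borel \<Longrightarrow> tile H k \<in> sets borel"
  unfolding tile_def using measurable_sets[OF shift_borel, of H "- lam k"] by simp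

lemma fundamental_disjoint: "fundamental H \<Longrightarrow> disjoint_family (tile H)"
  unfolding fundamental_def disjoint_family_on_def by blast

lemma fundamental_cover: "fundamental H \<Longrightarrow> (\<Union>k. tile H k) = UNIV"
  unfolding fundamental_def by blast

lemma emeasure_M_tiles:
  assumes "fundamental H" "G \<in> sets borel"
  shows "emeasure M G = (\<integral>\<^sup>+ k. emeasure M (G \<inter> tile H k) \<partial>count_space UNIV)"
proof -
  have "G = (\<Union>k. G \<inter> tile H k)" using fundamental_cover[OF assms(1)] by blast
  then have "emeasure M G = emeasure M (\<Union>k\<in>UNIV. G \<inter> tile H k)" by simp
  also have "\<dots> = (\<integral>\<^sup>+ k. emeasure M (G \<inter> tile H k) \<partial>count_space UNIV)"
  proof (rule emeasure_UN_countable)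
    show "G \<inter> tile H k \<in> sets M" for k using assms tile_borel[of H k] by (simp add: fundamental_def sets.Int)
    show "disjoint_family_on (\<lambda>k. G \<inter> tile H k) UNIV"
      using fundamental_disjoint[OF assms(1)] unfolding disjoint_family_on_def by blast
  qed auto
  finally show ?thesis .
qed

text \<open>Two fundamental domains of the lattice are equivalent by pieces, so a periodic set meets them in
  equal mass.\<close>

lemma fundamental_exchange:
  assumes H: "fundamental H" "fundamental H'" and G: "G \<in> sets borel" "\<And>k. shift (lam k) -` G = G"
  shows "emeasure M (G \<inter> H) = emeasure M (G \<inter> H')"
proof -
  have sH: "H \<in> sets borel" "H' \<in> sets borel" using H by (auto simp: fundamental_def)
  let ?neg = "\<lambda>k :: int \<times> int. (- fst k, - snd k)"
  have bij: "bij_betw ?neg UNIV UNIV" by (rule bij_betwI[where g = ?neg]) auto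
  \<comment> \<open>A lattice translation carries the piece of \<open>H\<close> in the tile of
    \<open>H'\<close> with index k onto the piece of \<open>H'\<close> in the tile of
    \<open>H\<close> with index -k.\<close>
  have eq: "emeasure M (G \<inter> H \<inter> tile H' k) = emeasure M (G \<inter> H' \<inter> tile H (?neg k))" for k
  proof -
    have "shift (lam k) -` (G \<inter> H \<inter> tile H' k) = G \<inter> H' \<inter> tile H (?neg k)"
      using G(2)[of k] unfolding tile_def by (auto simp: shift_def lam_minus[symmetric])
    then show ?thesis
      using emeasure_M_shift[of "G \<inter> H \<inter> tile H' k" "lam k"] sH G(1) tile_borel by auto
  qed
  have "emeasure M (G \<inter> H) = (\<integral>\<^sup>+ k. emeasure M (G \<inter> H \<inter> tile H' k) \<partial>count_space UNIV)"
    using sH G(1) by (intro emeasure_M_tiles H) auto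
  also have "\<dots> = (\<integral>\<^sup>+ k. emeasure M (G \<inter> H' \<inter> tile H (?neg k)) \<partial>count_space UNIV)"
    unfolding eq ..
  also have "\<dots> = (\<integral>\<^sup>+ k. emeasure M (G \<inter> H' \<inter> tile H k) \<partial>count_space UNIV)"
    by (rule nn_integral_bij_count_space[OF bij])
  also have "\<dots> = emeasure M (G \<inter> H')"
    using sH G(1) by (intro emeasure_M_tiles[symmetric] H) auto
  finally show ?thesis .
qed

definition F0 :: "((real^2) \<times> (real^2)) set" where "F0 = cell \<times> UNIV"

lemma mem_tile_F0: "p \<in> tile F0 k \<longleftrightarrow> fst p - lam k \<in> cell"
  by (auto simp: tile_def F0_def shift_def add.commute)

lemma fst_vimage_borel: "S \<in> sets borel \<Longrightarrow> S \<times> UNIV \<in> sets (borel :: ((real^2) \<times> (real^2)) measure)"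
  by (simp add: borel_prod[symmetric] pair_measureI)

lemma fundamental_F0: "fundamental F0"
  unfolding fundamental_def mem_tile_F0 using cell_tiling cell_measure(1) by (auto simp: F0_def fst_vimage_borel)

lemma emeasure_F0: "emeasure M F0 = ennreal (C * cell_area)"
  unfolding F0_def emeasure_M_Times[OF cell_measure(1)] cell_measure(2)
  using C_pos cell_area_pos by (intro ennreal_mult[symmetric]) auto

lemma F0_pos: "0 < C * cell_area"
  using C_pos cell_area_pos by (rule mult_pos_pos)

lemma F0_nonzero: "ennreal (C * cell_area) \<noteq> 0" "ennreal (C * cell_area) / ennreal (C * cell_area) = 1"
proof -
  have "ennreal x \<noteq> 0" "ennreal x / ennreal x = 1" if "0 < x" for x using that by (simp_all add: divide_ennreal)
  from this[OF F0_pos] show "ennreal (C * cell_area) \<noteq> 0" "ennreal (C * cell_area) / ennreal (C * cell_area) = 1" .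
qed

definition mu0 :: "(real^2) set set measure" where
  "mu0 = distr (uniform_measure M F0) (packing_borel B) orb"

lemma F0_borel: "F0 \<in> sets borel" using fundamental_F0 by (simp add: fundamental_def)

lemma orb_measurable_uniform: "orb \<in> measurable (uniform_measure M F0) (packing_borel B)"
  using orb_measurable_M by (simp cong: measurable_cong_sets)

lemma sets_mu0: "sets mu0 = sets (packing_borel B)"
  by (simp add: mu0_def)

lemma vimage_orb_borel: "A \<in> sets (packing_borel B) \<Longrightarrow> orb -` A \<in> sets borel"
  using measurable_sets[OF orb_measurable, of A] by simp

lemma emeasure_mu0:
  assumes "A \<in> sets (packing_borel B)"
  shows "emeasure mu0 A = emeasure M (orb -` A \<inter> F0) / ennreal (C * cell_area)"
  unfolding mu0_def using assms F0_borel vimage_orb_borel[OF assms]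
  by (simp add: emeasure_distr[OF orb_measurable_uniform] emeasure_uniform_measure emeasure_F0 Int_commute)

lemma prob_mu0: "prob_space mu0"
  unfolding mu0_def
proof (rule prob_space.prob_space_distr[OF _ orb_measurable_uniform])
  show "prob_space (uniform_measure M F0)"
    by (rule prob_space_uniform_measure) (unfold emeasure_F0, use F0_nonzero in auto)
qed

lemma chart_comp:
  assumes "p \<in> S1" "norm w = 1"
  shows "chart (coord (motion a w \<circ> place p)) = (fst p - cmul (conj2 (cmul w (snd p))) a, cmul w (snd p))"
proof -
  have n: "norm (cmul w (snd p)) = 1" using assms by (simp add: norm_cmul)
  have "motion a w \<circ> place p = motion (a - cmul (cmul w (snd p)) (fst p)) (cmul w (snd p))"
    unfolding place_eq_motion motion_comp by (simp add: cmul_minus cmul_assoc)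
  then show ?thesis by (simp add: coord_motion chart_def cmul_diff cmul_conj2[OF n])
qed

text \<open>Left multiplication by \<open>h\<close> does not preserve the domain \<open>F0\<close>.
  It pulls it back to another fundamental domain \<open>H\<close>; left invariance of
  \<open>\<nu>\<close> moves the mass to \<open>H\<close>, and periodicity of \<open>orb\<close>
  allows the exchange of \<open>H\<close> for \<open>F0\<close>.\<close>

lemma emeasure_mu0_move:
  assumes h: "h \<in> rigid_motions" and A: "A \<in> sets (packing_borel B)"
  shows "emeasure mu0 (move_packing h ` A) = emeasure mu0 A"
proof -
  obtain a w where w: "norm w = 1" "h = motion a w" using h by (rule rigid_motionE)
  obtain h' where h': "h' \<in> rigid_motions" "h \<circ> h' = id" "h' \<circ> h = id" using h by (rule rigid_inverse)
  have hA: "move_packing h ` A \<in> sets (packing_borel B)" using move_sets[OF h A] .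
  \<comment> \<open>The parameters that left multiplication by \<open>h\<close> sends into
    \<open>F0\<close>, by \<open>chart_comp\<close>. Over each rotation separately this is a
    translate of \<open>cell\<close>, by an amount depending on the rotation.\<close>
  define H where "H = (\<lambda>p. (fst p - cmul (conj2 (cmul w (snd p))) a, snd p)) -` F0"
  have Hb: "H \<in> sets borel"
  proof -
    have "(\<lambda>p :: (real^2) \<times> (real^2). (fst p - cmul (conj2 (cmul w (snd p))) a, snd p)) \<in> borel_measurable borel"
      by (intro borel_measurable_continuous_onI continuous_intros)
    then show ?thesis using measurable_sets[of _ borel borel F0] F0_borel unfolding H_def by simp
  qed
  have H: "fundamental H"
    unfolding fundamental_def
  proof (intro conjI Hb allI)
    fix p :: "(real^2) \<times> (real^2)"
    have "p \<in> tile H k \<longleftrightarrow> (fst p - cmul (conj2 (cmul w (snd p))) a) - lam k \<in> cell" for k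
      by (simp add: tile_def H_def F0_def algebra_simps)
    then show "\<exists>!k. p \<in> tile H k" using cell_tiling by simp
  qed
  define E where "E = {g \<in> rigid_motions. chart (coord g) \<in> orb -` A \<inter> H}"
  have oA: "orb -` A \<in> sets borel" "orb -` (move_packing h ` A) \<in> sets borel"
    using vimage_orb_borel A hA by auto
  have Es: "E \<in> sets \<nu>"
  proof -
    have "orb -` A \<inter> H \<in> sets borel" using oA(1) Hb by (rule sets.Int)
    from measurable_sets[OF chart_coord_measurable this]
    have "(\<lambda>g. chart (coord g)) -` (orb -` A \<inter> H) \<inter> rigid_motions \<in> sets \<nu>" unfolding space_nu .
    also have "(\<lambda>g. chart (coord g)) -` (orb -` A \<inter> H) \<inter> rigid_motions = E" by (auto simp: E_def)
    finally show ?thesis .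
  qed
  have inj: "Q \<in> A \<longleftrightarrow> move_packing h Q \<in> move_packing h ` A" for Q
    using move_cancel[OF h'(3)] by (metis imageE imageI)
  have "{g \<in> rigid_motions. chart (coord g) \<in> orb -` (move_packing h ` A) \<inter> F0} = (\<lambda>g. h \<circ> g) ` E"
  proof -
    have key: "h \<circ> g \<in> {g \<in> rigid_motions. chart (coord g) \<in> orb -` (move_packing h ` A) \<inter> F0} \<longleftrightarrow> g \<in> E"
      if g: "g \<in> rigid_motions" for g
    proof -
      let ?p = "chart (coord g)"
      have hg: "h \<circ> g \<in> rigid_motions" using rigid_comp[OF h g] .
      have 1: "orb (chart (coord (h \<circ> g))) \<in> move_packing h ` A \<longleftrightarrow> orb ?p \<in> A"
        unfolding orb_chart[OF hg] orb_chart[OF g] inj[of "move_packing g P0"] move_packing_comp ..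
      have "h \<circ> g = motion a w \<circ> place ?p" using w g by (simp add: chart_coord)
      then have "chart (coord (h \<circ> g)) = (fst ?p - cmul (conj2 (cmul w (snd ?p))) a, cmul w (snd ?p))"
        using chart_comp[OF _ w(1), of ?p a] norm_snd_chart_coord[OF g] by simp
      then have 2: "chart (coord (h \<circ> g)) \<in> F0 \<longleftrightarrow> ?p \<in> H" by (simp add: H_def F0_def)
      show ?thesis using 1 2 g hg by (simp add: E_def)
    qed
    show ?thesis
    proof (intro equalityI subsetI)
      fix g assume g: "g \<in> {g \<in> rigid_motions. chart (coord g) \<in> orb -` (move_packing h ` A) \<inter> F0}"
      then have g': "h' \<circ> g \<in> rigid_motions" using rigid_comp[OF h'(1)] by blast
      have e: "h \<circ> (h' \<circ> g) = g" using h'(2) by (simp flip: comp_assoc)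
      then have "h' \<circ> g \<in> E" using key[OF g'] g by simp
      then show "g \<in> (\<lambda>g. h \<circ> g) ` E" using e by (metis imageI)
    next
      fix g assume "g \<in> (\<lambda>g. h \<circ> g) ` E"
      then obtain g' where g': "g' \<in> E" "g = h \<circ> g'" by blast
      then have "g' \<in> rigid_motions" by (simp add: E_def)
      then show "g \<in> {g \<in> rigid_motions. chart (coord g) \<in> orb -` (move_packing h ` A) \<inter> F0}"
        using key g' by simp
    qed
  qed
  then have "emeasure M (orb -` (move_packing h ` A) \<inter> F0) = emeasure \<nu> ((\<lambda>g. h \<circ> g) ` E)"
    using emeasure_M[of "orb -` (move_packing h ` A) \<inter> F0"] oA(2) F0_borel by simp
  also have "\<dots> = emeasure \<nu> E" by (rule left_invariant[OF h Es])
  also have "\<dots> = emeasure M (orb -` A \<inter> H)" using oA(1) Hb by (simp add: emeasure_M E_def)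
  also have "\<dots> = emeasure M (orb -` A \<inter> F0)"
  proof (rule fundamental_exchange[OF H fundamental_F0 oA(1)])
    show "shift (lam k) -` orb -` A = orb -` A" for k by (simp add: vimage_def orb_shift)
  qed
  finally show ?thesis by (simp add: emeasure_mu0 A hA)
qed

lemma mu0_invariant: "mu0 \<in> invariant_measures B"
  unfolding invariant_measures_def using prob_mu0 sets_mu0 emeasure_mu0_move by (simp add: measure_def)

text \<open>The measure lives on a single orbit, and an invariant set contains all of an orbit or
  none of it.\<close>

lemma mu0_ergodic: "mu0 \<in> ergodic_measures B"
  unfolding ergodic_measures_def
proof (intro CollectI conjI mu0_invariant ballI impI)
  fix A assume A: "A \<in> sets mu0" and inv: "\<forall>g\<in>rigid_motions. move_packing g ` A = A"
  have sA: "A \<in> sets (packing_borel B)" using A by (simp add: sets_mu0)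
  have orb: "orb p \<in> A \<longleftrightarrow> P0 \<in> A" for p
  proof (cases "p \<in> S1")
    case True
    then have g: "place p \<in> rigid_motions" by (simp add: place_rigid)
    obtain h where h: "h \<in> rigid_motions" "place p \<circ> h = id" "h \<circ> place p = id" using g by (rule rigid_inverse)
    have "move_packing (place p) P0 \<in> A" if "P0 \<in> A" using inv g that by blast
    moreover have "P0 \<in> A" if "move_packing (place p) P0 \<in> A"
      using inv h(1) that move_cancel[OF h(3), of P0] by (metis imageI)
    ultimately show ?thesis using orb_eq_move[OF True] by auto
  qed (simp add: orb_def)
  show "measure mu0 A = 0 \<or> measure mu0 A = 1"
  proof (cases "P0 \<in> A")
    case True
    then have "orb -` A = UNIV" by (simp add: vimage_def orb)
    then have "emeasure mu0 A = 1" unfolding emeasure_mu0[OF sA] by (simp only: Int_UNIV_left emeasure_F0 F0_nonzero)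
    then show ?thesis by (simp add: measure_def)
  next
    case False
    then have "emeasure mu0 A = 0" by (simp add: emeasure_mu0[OF sA] vimage_def orb)
    then show ?thesis by (simp add: measure_def)
  qed
qed

end

section \<open>Density and support of the orbit measure\<close>

lemma emeasure_lborel_shift:
  fixes S :: "'a::euclidean_space set"
  assumes "S \<in> sets borel" shows "emeasure lborel {x. c + x \<in> S} = emeasure lborel S"
proof -
  have m: "(+) c \<in> borel_measurable borel" by simp
  have "{x. c + x \<in> S} = (+) c -` S" by auto
  moreover have "emeasure (distr lborel borel ((+) c)) S = emeasure lborel ((+) c -` S)"
    using assms by (simp add: emeasure_distr)
  ultimately show ?thesis by (simp add: lborel_distr_plus)
qed

context hex_orbit
begin

lemma emeasure_lborel_ball: "0 \<le> t \<Longrightarrow> emeasure lborel (ball (0 :: real^2) t) = ennreal (unit_area * t\<^sup>2)"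
  using ball_area[of t] emeasure_eq_ennreal_measure[of lborel "ball (0 :: real^2) t"] emeasure_lborel_ball_finite[of "0 :: real^2" t]
  by (simp add: less_top)

text \<open>The pieces of the lattice disks inside one cell, each translated back to the origin, are
  the pieces into which the translates of the cell cut a single disk.\<close>

lemma emeasure_cell_disks: "emeasure lborel (\<Union>k. cell \<inter> ball (lam k) r) = emeasure lborel (ball (0 :: real^2) r)"
proof -
  let ?T = "\<lambda>k. {b. lam k + b \<in> cell}"
  have Ts: "?T k \<in> sets borel" for k
  proof -
    have "?T k = (+) (lam k) -` cell" by auto
    then show ?thesis using measurable_sets[of "(+) (lam k)" borel borel cell] cell_measure(1) by simp
  qed
  have uniq: "\<exists>!k. lam k + b \<in> cell" for b
  proof -
    obtain k where k: "b - lam k \<in> cell" "\<And>l. b - lam l \<in> cell \<Longrightarrow> l = k" using cell_tiling[of b] by blast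
    have e: "lam l + b = b - lam (- fst l, - snd l)" for l
      by (simp flip: lam_minus)
    show ?thesis
    proof (rule ex1I[of _ "(- fst k, - snd k)"])
      show "lam (- fst k, - snd k) + b \<in> cell" unfolding e using k(1) by simp
      show "l = (- fst k, - snd k)" if "lam l + b \<in> cell" for l
        using k(2)[of "(- fst l, - snd l)"] that unfolding e by (auto simp: prod_eq_iff)
    qed
  qed
  have "emeasure lborel (\<Union>k. cell \<inter> ball (lam k) r) = (\<integral>\<^sup>+ k. emeasure lborel (cell \<inter> ball (lam k) r) \<partial>count_space UNIV)"
  proof (rule emeasure_UN_countable)
    show "cell \<inter> ball (lam k) r \<in> sets lborel" for k using cell_measure(1) by simp
    have "ball (lam k) r \<inter> ball (lam l) r = {}" if "k \<noteq> l" for k l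
      using dist_lam[OF that] by (intro disjoint_ballI) simp
    then show "disjoint_family_on (\<lambda>k. cell \<inter> ball (lam k) r) UNIV" unfolding disjoint_family_on_def by blast
  qed auto
  also have "\<dots> = (\<integral>\<^sup>+ k. emeasure lborel (ball 0 r \<inter> ?T k) \<partial>count_space UNIV)"
  proof (rule nn_integral_cong)
    fix k
    have "{x. lam k + x \<in> cell \<inter> ball (lam k) r} = ball 0 r \<inter> ?T k" by (auto simp: dist_norm)
    then show "emeasure lborel (cell \<inter> ball (lam k) r) = emeasure lborel (ball 0 r \<inter> ?T k)"
      using emeasure_lborel_shift[of "cell \<inter> ball (lam k) r" "lam k"] cell_measure(1) by simp
  qed
  also have "\<dots> = emeasure lborel (\<Union>k. ball 0 r \<inter> ?T k)"
  proof (rule emeasure_UN_countable[symmetric])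
    show "ball 0 r \<inter> ?T k \<in> sets lborel" for k using Ts[of k] by simp
    show "disjoint_family_on (\<lambda>k. ball 0 r \<inter> ?T k) UNIV" unfolding disjoint_family_on_def using uniq by blast
  qed auto
  also have "(\<Union>k. ball 0 r \<inter> ?T k) = ball 0 r" using uniq by blast
  finally show ?thesis .
qed

text \<open>The origin is covered as soon as the point moved to it lies within \<open>r\<close> of a
  lattice point, and such points fill the area of one disk in each cell. The reverse inequality is
  \<open>measure_density_le\<close>.\<close>

lemma mu0_density: "max_density \<le> measure_density B mu0"
proof -
  let ?S = "\<Union>k. cell \<inter> ball (lam k) r"
  have Sb: "?S \<in> sets borel" using cell_measure(1) by (intro sets.countable_UN) auto
  have "ennreal (C * (unit_area * r\<^sup>2)) = ennreal C * ennreal (unit_area * r\<^sup>2)"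
    using C_pos by (intro ennreal_mult) auto
  also have "\<dots> = emeasure M (?S \<times> UNIV)"
    unfolding emeasure_M_Times[OF Sb] emeasure_cell_disks using r_pos by (simp add: emeasure_lborel_ball)
  also have "\<dots> \<le> emeasure M (orb -` covered 0 \<inter> F0)"
  proof (rule emeasure_mono_AE)
    show "orb -` covered 0 \<inter> F0 \<in> sets M" using vimage_orb_borel[OF covered_sets] F0_borel by simp
    show "AE p in M. p \<in> ?S \<times> UNIV \<longrightarrow> p \<in> orb -` covered 0 \<inter> F0"
    proof (use AE_M_norm in eventually_elim, rule impI)
      fix p :: "(real^2) \<times> (real^2)" assume n: "norm (snd p) = 1" and p: "p \<in> ?S \<times> UNIV"
      then obtain k where k: "fst p \<in> cell" "dist (lam k) (fst p) < r" by (auto simp: mem_Times_iff)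
      have "dist (place p (lam k)) 0 \<le> r"
        using k(2) n by (simp add: place_def norm_cmul dist_norm)
      then have "orb p \<in> covered 0"
      proof -
        have "place p (lam k) \<in> place p ` lattice" by (simp add: lattice_def)
        then have "ball_packing r (place p ` lattice) \<in> covered 0"
          using \<open>dist (place p (lam k)) 0 \<le> r\<close>
            ball_packing_covered[OF separated_rigid[OF place_rigid[OF n] separated_lattice]] by blast
        then show ?thesis using n by (simp add: orb_def)
      qed
      then show "p \<in> orb -` covered 0 \<inter> F0" using k(1) by (simp add: F0_def mem_Times_iff)
    qed
  qed
  finally have "ennreal (C * (unit_area * r\<^sup>2)) / ennreal (C * cell_area) \<le> emeasure mu0 (covered 0)"
    unfolding emeasure_mu0[OF covered_sets] by (rule divide_right_mono_ennreal)
  also have "ennreal (C * (unit_area * r\<^sup>2)) / ennreal (C * cell_area) = ennreal (C * (unit_area * r\<^sup>2) / (C * cell_area))"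
    using F0_pos C_pos by (intro divide_ennreal) auto
  also have "C * (unit_area * r\<^sup>2) / (C * cell_area) = max_density"
  proof -
    have "C * a / (C * b) = a / b" for a b using C_pos by simp
    then show ?thesis by blast
  qed
  also have "emeasure mu0 (covered 0) = ennreal (measure mu0 (covered 0))"
    using prob_space.finite_measure[OF prob_mu0] by (rule finite_measure.emeasure_eq_measure)
  finally show ?thesis by (simp add: measure_density_covered)
qed

lemma mu0_optimal: "optimally_dense_measure B mu0" "(SUP m\<in>invariant_measures B. measure_density B m) = max_density"
proof -
  have eq: "measure_density B mu0 = max_density"
    using mu0_density measure_density_le[OF mu0_invariant] by (rule antisym[rotated])
  show sup: "(SUP m\<in>invariant_measures B. measure_density B m) = max_density"
  proof (rule antisym)
    show "(SUP m\<in>invariant_measures B. measure_density B m) \<le> max_density"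
      using mu0_invariant measure_density_le by (intro cSUP_least) auto
    show "max_density \<le> (SUP m\<in>invariant_measures B. measure_density B m)"
      unfolding eq[symmetric] using measure_density_le by (intro cSUP_upper mu0_invariant bdd_aboveI2)
  qed
  show "optimally_dense_measure B mu0"
    unfolding optimally_dense_measure_def using mu0_ergodic eq sup by simp
qed

lemma compact_core: "compact (closure cell \<times> sphere 0 1 :: ((real^2) \<times> (real^2)) set)"
  using cell_measure(3) by (intro compact_Times) auto

text \<open>If a neighbourhood of \<open>P0\<close> were null, so would be all its images under
  motions, by invariance. Their preimages are relatively open, and finitely many cover the compact
  set \<open>closure cell\<close> times the circle, hence almost all of \<open>F0\<close>, which has
  positive mass.\<close>

lemma P0_support: "P0 \<in> measure_support B mu0"
  unfolding measure_support_def
proof (intro CollectI conjI P0_packing allI impI, elim conjE, rule ccontr)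
  fix U assume U: "openin (packing_topology B) U" "P0 \<in> U" and "\<not> 0 < measure mu0 U"
  then have "measure mu0 U = 0" using measure_nonneg[of mu0 U] by linarith
  then have z: "emeasure mu0 U = 0"
    using finite_measure.emeasure_eq_measure[OF prob_space.finite_measure[OF prob_mu0]] by simp
  have Us: "U \<in> sets (packing_borel B)" using open_sets[OF U(1)] .
  let ?V = "\<lambda>p. move_packing (place p) ` U"
  let ?K = "closure cell \<times> sphere 0 1 :: ((real^2) \<times> (real^2)) set"
  have KS: "?K \<subseteq> S1" by auto
  have Vo: "openin (packing_topology B) (?V p)" if "p \<in> S1" for p
    using openin_move[OF _ U(1)] that by (simp add: place_rigid)
  have null: "emeasure M (orb -` ?V p \<inter> F0) = 0" if "p \<in> S1" for p
  proof -
    have "emeasure mu0 (?V p) = 0"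
      using emeasure_mu0_move[OF _ Us, of "place p"] that z by (simp add: place_rigid)
    then show ?thesis using emeasure_mu0[OF open_sets[OF Vo[OF that]]] by (auto simp: ennreal_divide_eq_0_iff)
  qed
  have cov: "?K \<subseteq> (\<Union>p\<in>?K. - {q \<in> S1. orb q \<notin> ?V p})"
  proof
    fix p assume p: "p \<in> ?K"
    then have "orb p \<in> ?V p" using KS U(2) orb_eq_move[of p] by blast
    then show "p \<in> (\<Union>p\<in>?K. - {q \<in> S1. orb q \<notin> ?V p})" using p by blast
  qed
  have op: "open (- {q \<in> S1. orb q \<notin> ?V p})" if "p \<in> ?K" for p
    using orb_open[OF Vo[of p]] that KS by (intro open_Compl) blast
  obtain D where D: "D \<subseteq> ?K" "finite D" "?K \<subseteq> (\<Union>p\<in>D. - {q \<in> S1. orb q \<notin> ?V p})"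
    by (rule compactE_image[OF compact_core op cov])
  have Ds: "orb -` ?V p \<inter> F0 \<in> sets M" if "p \<in> D" for p
    using vimage_orb_borel[OF open_sets[OF Vo]] F0_borel D(1) KS that by auto
  have "emeasure M F0 \<le> emeasure M (\<Union>p\<in>D. orb -` ?V p \<inter> F0)"
  proof (rule emeasure_mono_AE)
    show "(\<Union>p\<in>D. orb -` ?V p \<inter> F0) \<in> sets M" using D(2) Ds by (rule sets.finite_UN)
    show "AE q in M. q \<in> F0 \<longrightarrow> q \<in> (\<Union>p\<in>D. orb -` ?V p \<inter> F0)"
    proof (use AE_M_norm in eventually_elim, rule impI)
      fix q assume q: "norm (snd q) = 1" "q \<in> F0"
      then have "q \<in> ?K" using closure_subset[of cell] by (auto simp: F0_def mem_Times_iff)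
      then obtain p where "p \<in> D" "orb q \<in> ?V p" using D(3) q(1) by blast
      then show "q \<in> (\<Union>p\<in>D. orb -` ?V p \<inter> F0)" using q(2) by blast
    qed
  qed
  also have "\<dots> \<le> (\<Sum>p\<in>D. emeasure M (orb -` ?V p \<inter> F0))"
    using Ds by (intro emeasure_subadditive_finite D(2)) auto
  also have "\<dots> = 0" using null D(1) KS by (intro sum.neutral) blast
  finally show False using F0_nonzero(1) by (simp only: emeasure_F0) simp
qed

end

section \<open>Genericity of the hexagonal packing\<close>

context hex_orbit
begin

definition window :: "real^2 \<Rightarrow> real \<Rightarrow> ((real^2) \<times> (real^2)) set" where
  "window q R = {p. dist (place p q) q < R}"

lemma window_borel: "window q R \<in> sets borel"
proof -
  have "open (window q R)" unfolding window_def
    by (intro open_Collect_less continuous_intros continuous_on_place)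
  then show ?thesis by (rule borel_open)
qed

lemma motions_within_eq: "motions_within R q = {g \<in> rigid_motions. chart (coord g) \<in> window q R}"
  by (auto simp: motions_within_def window_def chart_coord)

lemma measure_motions_within: "measure \<nu> (motions_within R q) = measure M (window q R)"
  unfolding measure_def motions_within_eq emeasure_M[OF window_borel] ..

text \<open>The image of \<open>q\<close> has norm |q - b|, where b is the first component of
  \<open>p\<close>. So the condition on the motion differs from a bound on |b| by at most 2 |q|,
  whatever the rotation.\<close>

lemma window_bounds:
  assumes "p \<in> S1"
  shows "norm (fst p) < R - 2 * norm q \<Longrightarrow> p \<in> window q R" "p \<in> window q R \<Longrightarrow> norm (fst p) < R + 2 * norm q"
proof -
  have n: "norm (place p q) = norm (q - fst p)" using assms by (simp add: place_def norm_cmul)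
  show "p \<in> window q R" if "norm (fst p) < R - 2 * norm q"
  proof -
    have "dist (place p q) q \<le> norm (q - fst p) + norm q" unfolding dist_norm n[symmetric] by (rule norm_triangle_ineq4)
    also have "\<dots> \<le> norm q + norm (fst p) + norm q" using norm_triangle_ineq4[of q "fst p"] by simp
    finally show ?thesis using that by (simp add: window_def)
  qed
  show "norm (fst p) < R + 2 * norm q" if "p \<in> window q R"
  proof -
    have "norm (fst p) \<le> norm q + norm (q - fst p)" using norm_triangle_ineq4[of q "q - fst p"] by simp
    also have "norm (q - fst p) \<le> dist (place p q) q + norm q"
      unfolding n[symmetric] dist_norm using norm_triangle_sub by (metis add.commute)
    finally show ?thesis using that by (simp add: window_def)
  qed
qed

lemma measure_M_Times:
  assumes "S \<in> lmeasurable" "S \<in> sets borel"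
  shows "measure M (S \<times> UNIV) = C * measure lebesgue S" "S \<times> UNIV \<in> fmeasurable M"
proof -
  have "emeasure lborel S = ennreal (measure lebesgue S)"
    using emeasure_eq_measure2[OF assms(1)] assms(2) by (simp add: emeasure_completion)
  then have "emeasure M (S \<times> UNIV) = ennreal (C * measure lebesgue S)"
    using emeasure_M_Times[OF assms(2)] C_pos by (simp add: ennreal_mult)
  moreover have "0 \<le> C * measure lebesgue S" using C_pos by simp
  ultimately show "measure M (S \<times> UNIV) = C * measure lebesgue S" "S \<times> UNIV \<in> fmeasurable M"
    using measure_eq_emeasure_eq_ennreal fst_vimage_borel[OF assms(2)] by (blast, simp add: fmeasurable_def)
qed

lemma measure_M_mono_AE:
  assumes "AE p in M. p \<in> A \<longrightarrow> p \<in> A'" "A' \<in> fmeasurable M"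
  shows "measure M A \<le> measure M A'"
proof -
  have "emeasure M A \<le> emeasure M A'" using assms by (intro emeasure_mono_AE) auto
  moreover have "emeasure M A' < top" using assms(2) by (simp add: fmeasurable_def)
  ultimately show ?thesis unfolding measure_def by (rule enn2real_mono)
qed

lemma window_fmeasurable: "window q R \<in> fmeasurable M"
proof -
  have "emeasure M (window q R) \<le> emeasure M (ball 0 (R + 2 * norm q) \<times> UNIV)"
  proof (rule emeasure_mono_AE)
    show "AE p in M. p \<in> window q R \<longrightarrow> p \<in> ball 0 (R + 2 * norm q) \<times> UNIV"
      using AE_M_norm by eventually_elim (auto simp: mem_Times_iff dest: window_bounds(2)[rotated])
  qed (simp add: fst_vimage_borel)
  also have "\<dots> < \<infinity>"
  proof -
    have "ball 0 (R + 2 * norm q) \<times> UNIV \<in> fmeasurable M" by (rule measure_M_Times(2)) auto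
    then show ?thesis by (simp add: fmeasurable_def)
  qed
  finally show ?thesis using window_borel by (simp add: fmeasurable_def)
qed

lemma tile_F0_fmeasurable: "tile F0 k \<in> fmeasurable M"
proof -
  have "emeasure M (tile F0 k) = ennreal (C * cell_area)"
    unfolding tile_def emeasure_M_shift[OF F0_borel] emeasure_F0 ..
  then show ?thesis using tile_borel[OF F0_borel] by (simp add: fmeasurable_def)
qed

lemma integral_M_shift:
  fixes G :: "_ \<Rightarrow> real"
  assumes "G \<in> borel_measurable borel"
  shows "(\<integral>p. G (shift v p) \<partial>M) = (\<integral>p. G p \<partial>M)"
proof -
  have "shift v \<in> measurable M borel" using shift_borel by (simp add: measurable_cong_sets[OF sets_M refl])
  then have "(\<integral>p. G p \<partial>distr M borel (shift v)) = (\<integral>p. G (shift v p) \<partial>M)"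
    using assms by (rule integral_distr)
  then show ?thesis using M_translation[of v] by (simp add: shift_def[abs_def])
qed

text \<open>Tiles contained in the window contribute nothing. The remaining part lies in an annulus
  of bounded width about radius \<open>R\<close>, whose mass is of order \<open>R\<close>, against a
  window of mass of order R^2.\<close>

lemma periodic_mean_zero:
  fixes \<psi> :: "(real^2) \<times> (real^2) \<Rightarrow> real"
  assumes m: "\<psi> \<in> borel_measurable borel" and per: "\<And>k p. \<psi> (shift (lam k) p) = \<psi> p"
    and bd: "\<And>p. \<bar>\<psi> p\<bar> \<le> b" and zero: "set_lebesgue_integral M F0 \<psi> = 0"
  shows "((\<lambda>R. set_lebesgue_integral M (window q R) \<psi> / measure M (window q R)) \<longlongrightarrow> 0) at_top"
proof -
  have int: "set_integrable M A \<psi>" if "A \<in> fmeasurable M" for A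
    unfolding set_integrable_def
  proof (rule integrableI_bounded_set_indicator[where B = b])
    show "A \<in> sets M" "emeasure M A < \<infinity>" using that by (auto simp: fmeasurable_def)
    show "\<psi> \<in> borel_measurable M" using m by (simp cong: measurable_cong_sets)
    show "AE x in M. x \<in> A \<longrightarrow> norm (\<psi> x) \<le> b" using bd by simp
  qed
  have b0: "0 \<le> b" using bd[of undefined] by linarith
  have le: "\<bar>set_lebesgue_integral M A \<psi>\<bar> \<le> b * measure M A" if A: "A \<in> fmeasurable M" for A
  proof -
    have iA: "integrable M (indicator A :: _ \<Rightarrow> real)" using A by (simp add: fmeasurable_def)
    have "\<bar>set_lebesgue_integral M A \<psi>\<bar> \<le> (\<integral>p. \<bar>indicator A p * \<psi> p\<bar> \<partial>M)"
      unfolding set_lebesgue_integral_def using integral_abs_bound[of M "\<lambda>p. indicator A p * \<psi> p"] by simp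
    also have "\<dots> \<le> (\<integral>p. b * indicator A p \<partial>M)"
    proof (rule integral_mono)
      show "integrable M (\<lambda>p. \<bar>indicator A p * \<psi> p\<bar>)"
        using int[OF A] by (intro integrable_abs) (simp add: set_integrable_def)
      show "integrable M (\<lambda>p. b * indicator A p)" using iA by (rule integrable_mult_right)
      show "\<bar>indicator A p * \<psi> p\<bar> \<le> b * indicator A p" for p
        using bd[of p] by (cases "p \<in> A") auto
    qed
    also have "\<dots> = b * measure M A" using A by (simp add: fmeasurable_def)
    finally show ?thesis .
  qed
  have tile0: "set_lebesgue_integral M (tile F0 k) \<psi> = 0" for k
  proof -
    have "(\<lambda>p. indicator F0 p * \<psi> p) \<in> borel_measurable borel" using m F0_borel by simp
    from integral_M_shift[OF this, of "- lam k"]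
    have "(\<integral>p. indicator F0 (shift (- lam k) p) * \<psi> (shift (- lam k) p) \<partial>M) = 0"
      using zero by (simp add: set_lebesgue_integral_def)
    moreover have "indicator F0 (shift (- lam k) p) * \<psi> (shift (- lam k) p) = indicator (tile F0 k) p *\<^sub>R \<psi> p" for p
      unfolding lam_minus per by (simp add: tile_def indicator_def lam_minus[symmetric])
    ultimately show ?thesis by (simp add: set_lebesgue_integral_def)
  qed
  have tiles0: "set_lebesgue_integral M (\<Union>k\<in>J. tile F0 k) \<psi> = 0 \<and> (\<Union>k\<in>J. tile F0 k) \<in> fmeasurable M" if "finite J" for J
    using that
  proof induction
    case (insert k J)
    have "tile F0 k \<inter> tile F0 l = {}" if "l \<in> J" for l
      using fundamental_disjoint[OF fundamental_F0] insert.hyps(2) that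
      unfolding disjoint_family_on_def by (metis UNIV_I)
    then have disj: "tile F0 k \<inter> (\<Union>k\<in>J. tile F0 k) = {}" by (simp add: Int_UN_distrib)
    have "set_lebesgue_integral M (tile F0 k \<union> (\<Union>k\<in>J. tile F0 k)) \<psi> = 0"
      using set_integral_Un[OF disj int[OF tile_F0_fmeasurable] int[OF conjunct2[OF insert.IH]]] insert.IH tile0[of k] by simp
    moreover have "tile F0 k \<union> (\<Union>k\<in>J. tile F0 k) \<in> fmeasurable M"
      using tile_F0_fmeasurable conjunct2[OF insert.IH] by (rule fmeasurable.Un)
    ultimately show ?case by simp
  qed (simp add: set_lebesgue_integral_def)
  obtain t where t: "\<And>x. x \<in> cell \<Longrightarrow> norm x \<le> t" using cell_measure(3) by (auto simp: bounded_iff)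
  define t' where "t' = max t 0"
  have t': "0 \<le> t'" "\<And>x. x \<in> cell \<Longrightarrow> norm x \<le> t'" using t by (force simp: t'_def)+
  \<comment> \<open>The first summand bounds the deviation of the window from a disk, the second the
    diameter of a tile.\<close>
  define k0 where "k0 = 2 * norm q + 2 * t'"
  have k0: "0 \<le> k0" using t' by (simp add: k0_def)
  have bound: "\<bar>set_lebesgue_integral M (window q R) \<psi> / measure M (window q R)\<bar> \<le> 16 * b * k0 / R"
    if R: "2 * k0 + 1 \<le> R" for R
  proof -
    \<comment> \<open>The tiles lying entirely in the disk that the window is known to
      contain.\<close>
    define J where "J = {k. \<forall>x. x - lam k \<in> cell \<longrightarrow> norm x < R - 2 * norm q}"
    have "lam k \<in> lattice \<inter> cball 0 (R + t')" if "k \<in> J" for k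
    proof -
      have z: "0 \<in> cell"
      proof -
        have "basis_map 0 = 0" by (simp add: basis_map_def)
        then show ?thesis unfolding cell_def by (intro image_eqI[of _ _ 0]) auto
      qed
      then have "norm (lam k) < R - 2 * norm q" using that by (auto simp: J_def dest: spec[of _ "lam k"])
      then show ?thesis using t' by (auto simp: lattice_def) (smt (verit) norm_ge_zero)
    qed
    then have "lam ` J \<subseteq> lattice \<inter> cball 0 (R + t')" by blast
    moreover have "finite (lattice \<inter> cball 0 (R + t'))"
      using r_pos by (intro separated_finite[of "2 * r"] separated_subset[OF separated_lattice]) (auto intro: bounded_subset[OF bounded_cball])
    ultimately have J: "finite J" using finite_subset finite_imageD lam_inj by (metis inj_onI)
    define H where "H = (\<Union>k\<in>J. tile F0 k)"
    have H: "set_lebesgue_integral M H \<psi> = 0" "H \<in> fmeasurable M" using tiles0[OF J] by (auto simp: H_def)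
    have W: "window q R \<in> fmeasurable M" by (rule window_fmeasurable)
    have HW: "AE p in M. p \<in> H \<longrightarrow> p \<in> window q R"
    proof (use AE_M_norm in eventually_elim, rule impI)
      fix p :: "(real^2) \<times> (real^2)" assume n: "norm (snd p) = 1" and "p \<in> H"
      then obtain k where "k \<in> J" "fst p - lam k \<in> cell" by (auto simp: H_def mem_tile_F0)
      then have "norm (fst p) < R - 2 * norm q" by (simp add: J_def)
      then show "p \<in> window q R" using window_bounds(1)[of p] n by simp
    qed
    let ?A = "(ball 0 (R + k0) - ball 0 (R - k0)) :: (real^2) set"
    have Am: "?A \<in> lmeasurable" "?A \<in> sets borel" by auto
    have WH: "AE p in M. p \<in> window q R - H \<longrightarrow> p \<in> ?A \<times> UNIV"
    proof (use AE_M_norm in eventually_elim, rule impI)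
      fix p :: "(real^2) \<times> (real^2)" assume n: "norm (snd p) = 1" and p: "p \<in> window q R - H"
      have 1: "norm (fst p) < R + k0" using window_bounds(2)[of p q R] n p t' by (simp add: k0_def)
      obtain k where k: "fst p - lam k \<in> cell" using cell_tiling by blast
      then have "k \<notin> J" using p by (auto simp: H_def mem_tile_F0)
      then obtain x where x: "x - lam k \<in> cell" "R - 2 * norm q \<le> norm x" by (auto simp: J_def not_less)
      have "norm (x - fst p) \<le> norm (x - lam k) + norm (fst p - lam k)"
        using norm_triangle_ineq4[of "x - lam k" "fst p - lam k"] by simp
      then have "norm (x - fst p) \<le> 2 * t'" using t'(2)[OF x(1)] t'(2)[OF k] by linarith
      then have "R - k0 \<le> norm (fst p)" using x(2) norm_triangle_ineq2[of x "fst p"] unfolding k0_def by linarith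
      then show "p \<in> ?A \<times> UNIV" using 1 by (simp add: mem_Times_iff)
    qed
    have eq: "set_lebesgue_integral M (window q R) \<psi> = set_lebesgue_integral M (window q R - H) \<psi>"
    proof -
      have "set_lebesgue_integral M (window q R) \<psi> = set_lebesgue_integral M ((window q R - H) \<union> H) \<psi>"
        unfolding set_lebesgue_integral_def
      proof (rule integral_cong_AE)
        have "\<psi> \<in> borel_measurable M" using m by (simp cong: measurable_cong_sets)
        then have "(\<lambda>p. indicator A p *\<^sub>R \<psi> p) \<in> borel_measurable M" if "A \<in> sets M" for A
          using that by (intro borel_measurable_scaleR borel_measurable_indicator)
        then show "(\<lambda>p. indicator (window q R) p *\<^sub>R \<psi> p) \<in> borel_measurable M"
          "(\<lambda>p. indicator ((window q R - H) \<union> H) p *\<^sub>R \<psi> p) \<in> borel_measurable M"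
          using fmeasurableD[OF W] fmeasurableD[OF H(2)] by (simp_all only: sets.Diff sets.Un)
        show "AE p in M. indicator (window q R) p *\<^sub>R \<psi> p = indicator ((window q R - H) \<union> H) p *\<^sub>R \<psi> p"
        proof (use HW in eventually_elim)
          fix p assume "p \<in> H \<longrightarrow> p \<in> window q R"
          then show "indicator (window q R) p *\<^sub>R \<psi> p = indicator ((window q R - H) \<union> H) p *\<^sub>R \<psi> p"
            by (cases "p \<in> H"; cases "p \<in> window q R") simp_all
        qed
      qed
      also have "\<dots> = set_lebesgue_integral M (window q R - H) \<psi> + set_lebesgue_integral M H \<psi>"
        using W H(2) by (intro set_integral_Un int) auto
      finally show ?thesis using H(1) by simp
    qed
    have Rk: "k0 < R" using R k0 by linarith
    have mA: "measure lebesgue ?A = 4 * unit_area * k0 * R"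
    proof -
      have "measure lebesgue ?A = unit_area * (R + k0)\<^sup>2 - unit_area * (R - k0)\<^sup>2"
        using ball_area[of "R + k0"] ball_area[of "R - k0"] Rk k0
        by (subst measurable_measure_Diff) auto
      then show ?thesis by (simp add: power2_eq_square algebra_simps)
    qed
    have "measure M (window q R - H) \<le> measure M (?A \<times> UNIV)"
      by (rule measure_M_mono_AE[OF WH measure_M_Times(2)[OF Am]])
    then have up: "measure M (window q R - H) \<le> C * (4 * unit_area * k0 * R)"
      unfolding measure_M_Times(1)[OF Am] mA .
    have low: "C * (unit_area * (R / 2)\<^sup>2) \<le> measure M (window q R)"
    proof -
      have "measure M (ball 0 (R / 2) \<times> UNIV) \<le> measure M (window q R)"
      proof (rule measure_M_mono_AE[OF _ W], use AE_M_norm in eventually_elim, rule impI)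
        fix p :: "(real^2) \<times> (real^2)" assume n: "norm (snd p) = 1" and p: "p \<in> ball 0 (R / 2) \<times> UNIV"
        have "R / 2 \<le> R - 2 * norm q" using R t' by (simp add: k0_def)
        then show "p \<in> window q R" using window_bounds(1)[of p R q] n p by (simp add: mem_Times_iff)
      qed
      moreover have "measure M (ball 0 (R / 2) \<times> UNIV) = C * measure lebesgue (ball (0 :: real^2) (R / 2))"
        by (rule measure_M_Times(1)) auto
      moreover have "measure lebesgue (ball (0 :: real^2) (R / 2)) = unit_area * (R / 2)\<^sup>2"
        using R k0 by (intro ball_area) linarith
      ultimately show ?thesis by simp
    qed
    \<comment> \<open>The annulus contributes the factor \<open>4 * k0 * R\<close>, and the window
      contains a disk of radius \<open>R / 2\<close>; hence the constant 16.\<close>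
    have arith: "b' / w \<le> 16 * b * k0 / R" if "b' \<le> b * m" "m \<le> C * (4 * u * k0 * R)" "C * (u * (R / 2)\<^sup>2) \<le> w" "0 < u" "0 \<le> b'"
      for b' m w u :: real
    proof -
      have R0: "0 < R" using Rk k0 by linarith
      have l: "0 < C * (u * (R / 2)\<^sup>2)" using C_pos that(4) R0 by simp
      have le': "b' \<le> b * (C * (4 * u * k0 * R))" using that(1) mult_left_mono[OF that(2) b0] by linarith
      have "b' / w \<le> b * (C * (4 * u * k0 * R)) / (C * (u * (R / 2)\<^sup>2))"
        by (rule frac_le[OF order_trans[OF that(5) le'] le' l that(3)])
      also have "b * (C * (4 * u * k0 * R)) = (C * u * R) * (4 * b * k0)" by simp
      also have "C * (u * (R / 2)\<^sup>2) = (C * u * R) * (R / 4)" by (simp add: power2_eq_square)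
      also have "(C * u * R) * (4 * b * k0) / ((C * u * R) * (R / 4)) = (4 * b * k0) / (R / 4)"
        using C_pos that(4) R0 by (intro mult_divide_mult_cancel_left) simp
      also have "\<dots> = 16 * b * k0 / R" by simp
      finally show ?thesis .
    qed
    have "\<bar>set_lebesgue_integral M (window q R) \<psi>\<bar> / measure M (window q R) \<le> 16 * b * k0 / R"
    proof (rule arith[OF _ up low])
      show "\<bar>set_lebesgue_integral M (window q R) \<psi>\<bar> \<le> b * measure M (window q R - H)"
        unfolding eq using W H(2) by (intro le) auto
    qed (auto simp: content_ball_pos)
    then show ?thesis by simp
  qed
  show ?thesis
  proof (rule Lim_null_comparison)
    show "\<forall>\<^sub>F R in at_top. norm (set_lebesgue_integral M (window q R) \<psi> / measure M (window q R)) \<le> 16 * b * k0 / R"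
      using eventually_ge_at_top[of "2 * k0 + 1"] by eventually_elim (use bound in simp)
    show "((\<lambda>R. 16 * b * k0 / R) \<longlongrightarrow> 0) at_top"
      by (rule tendsto_divide_0[OF tendsto_const filterlim_at_top_imp_at_infinity[OF filterlim_ident]])
  qed
qed

end

section \<open>Averages of continuous functions along the orbit\<close>

context hex_orbit
begin

lemma continuous_map_measurable:
  assumes "continuous_map (packing_topology B) euclideanreal f"
  shows "f \<in> borel_measurable (packing_borel B)"
proof (rule borel_measurableI)
  fix V :: "real set" assume "open V"
  then have "openin (packing_topology B) {P \<in> topspace (packing_topology B). f P \<in> V}"
    by (intro openin_continuous_map_preimage[OF assms]) (simp only: open_openin[symmetric])
  then have "{P \<in> packings B. f P \<in> V} \<in> sets (packing_borel B)"
    using open_sets by (simp add: topspace_packing_topology)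
  also have "{P \<in> packings B. f P \<in> V} = f -` V \<inter> space (packing_borel B)"
    by (auto simp: space_packing_borel)
  finally show "f -` V \<inter> space (packing_borel B) \<in> sets (packing_borel B)" .
qed

text \<open>Along the orbit \<open>f\<close> is periodic and continuous, so its values are already
  taken on the compact set \<open>closure cell\<close> times the circle, apart from the default
  value of \<open>orb\<close>.\<close>

lemma continuous_map_orb_bounded:
  assumes f: "continuous_map (packing_topology B) euclideanreal f"
  shows "\<exists>b. \<forall>p. \<bar>f (orb p)\<bar> \<le> b"
proof -
  have "continuous_on S1 (\<lambda>p. f (orb p))"
    unfolding continuous_on_closed_vimage[OF closed_S1]
  proof (intro allI impI)
    fix D :: "real set" assume "closed D"
    then have "openin (packing_topology B) {P \<in> topspace (packing_topology B). f P \<in> - D}"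
      by (intro openin_continuous_map_preimage[OF f]) (simp only: open_openin[symmetric] open_Compl)
    from orb_open[OF this] show "closed ((\<lambda>p. f (orb p)) -` D \<inter> S1)"
      using orb_packing by (simp add: topspace_packing_topology vimage_def Int_def conj_commute)
  qed
  then have "continuous_on (closure cell \<times> sphere 0 1) (\<lambda>p. f (orb p))"
    by (rule continuous_on_subset) auto
  then have "bounded ((\<lambda>p. f (orb p)) ` (closure cell \<times> sphere 0 1))"
    using compact_core by (intro compact_imp_bounded compact_continuous_image)
  then obtain b where b: "\<And>p. p \<in> closure cell \<times> sphere 0 1 \<Longrightarrow> \<bar>f (orb p)\<bar> \<le> b"
    unfolding bounded_iff by auto
  have "\<bar>f (orb p)\<bar> \<le> max b \<bar>f P0\<bar>" for p
  proof (cases "p \<in> S1")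
    case True
    obtain k where k: "fst p - lam k \<in> cell" using cell_tiling by blast
    define p' where "p' = shift (- lam k) p"
    have "p' \<in> closure cell \<times> sphere 0 1"
      using k True closure_subset[of cell] by (auto simp: p'_def mem_Times_iff)
    moreover have "orb p' = orb p" unfolding p'_def lam_minus by (rule orb_shift)
    ultimately show ?thesis using b[of p'] by simp
  qed (simp add: orb_def)
  then show ?thesis by blast
qed

lemma integral_mu0:
  assumes f: "f \<in> borel_measurable (packing_borel B)"
  shows "(\<integral>P. f P \<partial>mu0) = (set_lebesgue_integral M F0 (\<lambda>p. f (orb p)) / (C * cell_area) :: real)"
proof -
  have fo: "(\<lambda>p. f (orb p)) \<in> borel_measurable M" by (rule measurable_compose[OF orb_measurable_M f])
  have "(\<integral>P. f P \<partial>mu0) = (\<integral>p. f (orb p) \<partial>uniform_measure M F0)"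
    unfolding mu0_def by (rule integral_distr[OF orb_measurable_uniform f])
  also have "\<dots> = (\<integral>p. (indicator F0 p / (C * cell_area)) *\<^sub>R f (orb p) \<partial>M)"
  proof -
    have "uniform_measure M F0 = density M (\<lambda>p. ennreal (indicator F0 p / (C * cell_area)))"
      unfolding uniform_measure_def emeasure_F0
    proof (rule arg_cong[of _ _ "density M"], rule ext)
      fix p
      show "indicator F0 p / ennreal (C * cell_area) = ennreal (indicator F0 p / (C * cell_area))"
        using divide_ennreal[OF _ F0_pos, of "indicator F0 p"] by (simp add: ennreal_indicator)
    qed
    moreover have "(\<lambda>p. indicator F0 p / (C * cell_area)) \<in> borel_measurable M"
      using F0_borel by (intro borel_measurable_divide borel_measurable_indicator borel_measurable_const) simp
    moreover have "0 \<le> indicator F0 p / (C * cell_area)" for p using F0_pos by (intro divide_nonneg_pos) auto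
    ultimately show ?thesis using integral_density[OF fo, of "\<lambda>p. indicator F0 p / (C * cell_area)"] by simp
  qed
  also have "\<dots> = (\<integral>p. (indicator F0 p *\<^sub>R f (orb p)) / (C * cell_area) \<partial>M)"
    by (intro Bochner_Integration.integral_cong refl) simp
  also have "\<dots> = (\<integral>p. indicator F0 p *\<^sub>R f (orb p) \<partial>M) / (C * cell_area)"
    by (rule integral_divide_zero)
  finally show ?thesis by (simp only: set_lebesgue_integral_def)
qed

text \<open>In coordinates the average over motions near the identity at \<open>q\<close> is the
  average of the periodic function \<open>\<phi>\<close> over a window. Subtracting its mean
  \<open>I\<close> over \<open>F0\<close> reduces the limit to
  \<open>periodic_mean_zero\<close>.\<close>

lemma P0_generic: "generic_packing \<nu> B mu0 P0"
  unfolding generic_packing_def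
proof (intro conjI P0_support allI impI)
  fix q f assume f: "continuous_map (packing_topology B) euclideanreal f"
  have fm: "f \<in> borel_measurable (packing_borel B)" by (rule continuous_map_measurable[OF f])
  define \<phi> where "\<phi> p = f (orb p)" for p
  have phm: "\<phi> \<in> borel_measurable borel" unfolding \<phi>_def by (rule measurable_compose[OF orb_measurable fm])
  obtain b where b: "\<And>p. \<bar>\<phi> p\<bar> \<le> b" using continuous_map_orb_bounded[OF f] by (auto simp: \<phi>_def)
  define I where "I = (\<integral>P. f P \<partial>mu0)"
  have I: "I = set_lebesgue_integral M F0 \<phi> / (C * cell_area)" unfolding I_def \<phi>_def by (rule integral_mu0[OF fm])
  have int: "set_integrable M A \<phi>" if "A \<in> fmeasurable M" for A
    unfolding set_integrable_def
  proof (rule integrableI_bounded_set_indicator[where B = b])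
    show "A \<in> sets M" "emeasure M A < \<infinity>" using that by (auto simp: fmeasurable_def)
    show "\<phi> \<in> borel_measurable M" using phm by (simp cong: measurable_cong_sets)
    show "AE x in M. x \<in> A \<longrightarrow> norm (\<phi> x) \<le> b" using b by simp
  qed
  have const: "set_integrable M A (\<lambda>p. I)" "set_lebesgue_integral M A (\<lambda>p. I) = I * measure M A" if "A \<in> fmeasurable M" for A
    using that by (auto simp: set_integrable_def set_lebesgue_integral_def fmeasurable_def)
  have diff: "set_lebesgue_integral M A (\<lambda>p. \<phi> p - I) = set_lebesgue_integral M A \<phi> - I * measure M A" if "A \<in> fmeasurable M" for A
    using set_integral_diff(2)[OF int[OF that] const(1)[OF that]] const(2)[OF that] by simp
  have F0f: "F0 \<in> fmeasurable M" using F0_borel emeasure_F0 by (simp add: fmeasurable_def)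
  have F0m: "measure M F0 = C * cell_area" using emeasure_F0 F0_pos by (intro measure_eq_emeasure_eq_ennreal) auto
  have lim: "((\<lambda>R. set_lebesgue_integral M (window q R) (\<lambda>p. \<phi> p - I) / measure M (window q R)) \<longlongrightarrow> 0) at_top"
  proof (rule periodic_mean_zero)
    show "(\<lambda>p. \<phi> p - I) \<in> borel_measurable borel" using phm by simp
    show "\<phi> (shift (lam k) p) - I = \<phi> p - I" for k p by (simp add: \<phi>_def orb_shift)
    show "\<bar>\<phi> p - I\<bar> \<le> b + \<bar>I\<bar>" for p using b[of p] by linarith
    have cancel: "a / m * m = a" if "0 < m" for a m :: real using that by simp
    show "set_lebesgue_integral M F0 (\<lambda>p. \<phi> p - I) = 0"
      unfolding diff[OF F0f] F0m by (subst I) (simp only: cancel[OF F0_pos] diff_self)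
  qed
  have avg: "(LINT g:motions_within R q|\<nu>. f (move_packing g P0)) = set_lebesgue_integral M (window q R) \<phi>" for R
  proof -
    have "set_lebesgue_integral M (window q R) \<phi> = (\<integral>g. indicator (window q R) (chart (coord g)) *\<^sub>R \<phi> (chart (coord g)) \<partial>\<nu>)"
      unfolding set_lebesgue_integral_def M_def
      using phm window_borel by (intro integral_distr chart_coord_measurable) auto
    also have "\<dots> = (LINT g:motions_within R q|\<nu>. f (move_packing g P0))"
      unfolding set_lebesgue_integral_def
    proof (rule Bochner_Integration.integral_cong[OF refl])
      fix g assume "g \<in> space \<nu>"
      then have g: "g \<in> rigid_motions" by (simp add: space_nu)
      then have "\<phi> (chart (coord g)) = f (move_packing g P0)" by (simp add: \<phi>_def orb_chart)
      moreover have "indicator (window q R) (chart (coord g)) = (indicator (motions_within R q) g :: real)"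
        using g by (simp add: motions_within_eq indicator_def)
      ultimately show "indicator (window q R) (chart (coord g)) *\<^sub>R \<phi> (chart (coord g)) = indicator (motions_within R q) g *\<^sub>R f (move_packing g P0)"
        by simp
    qed
    finally show ?thesis by simp
  qed
  \<comment> \<open>Splitting off the constant \<open>I\<close> from the quotient requires a nonzero
    denominator, which holds once the window contains a disk.\<close>
  have pos: "\<forall>\<^sub>F R in at_top. 0 < measure M (window q R)"
    using eventually_gt_at_top[of "2 * norm q"]
  proof eventually_elim
    case (elim R)
    have "measure M (ball 0 (R - 2 * norm q) \<times> UNIV) \<le> measure M (window q R)"
    proof (rule measure_M_mono_AE[OF _ window_fmeasurable], use AE_M_norm in eventually_elim, rule impI)
      fix p :: "(real^2) \<times> (real^2)" assume "norm (snd p) = 1" "p \<in> ball 0 (R - 2 * norm q) \<times> UNIV"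
      then show "p \<in> window q R" using window_bounds(1)[of p R q] by (simp add: mem_Times_iff)
    qed
    moreover have "measure M (ball 0 (R - 2 * norm q) \<times> UNIV) = C * measure lebesgue (ball (0 :: real^2) (R - 2 * norm q))"
      by (rule measure_M_Times(1)) auto
    moreover have "0 < measure lebesgue (ball (0 :: real^2) (R - 2 * norm q))" using elim by (simp add: content_ball_pos)
    ultimately show ?case using C_pos by (smt (verit) mult_pos_pos)
  qed
  have "((\<lambda>R. set_lebesgue_integral M (window q R) (\<lambda>p. \<phi> p - I) / measure M (window q R) + I) \<longlongrightarrow> 0 + I) at_top"
    by (rule tendsto_add[OF lim tendsto_const])
  moreover have "\<forall>\<^sub>F R in at_top. set_lebesgue_integral M (window q R) (\<lambda>p. \<phi> p - I) / measure M (window q R) + I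
      = (LINT g:motions_within R q|\<nu>. f (move_packing g P0)) / measure \<nu> (motions_within R q)"
    using pos
  proof eventually_elim
    case (elim R)
    have "(a - I * m) / m + I = a / m" if "0 < m" for a m :: real using that by (simp add: diff_divide_distrib)
    from this[OF elim] show ?case unfolding avg measure_motions_within diff[OF window_fmeasurable] .
  qed
  ultimately show "((\<lambda>R. (LINT g:motions_within R q|\<nu>. f (move_packing g P0)) / measure \<nu> (motions_within R q))
      \<longlongrightarrow> (LINT Q|mu0. f Q)) at_top"
    unfolding I_def[symmetric] using Lim_transform_eventually by fastforce
qed

section \<open>Congruence of all optimally dense packings\<close>

lemma optimally_dense_is_hex:
  assumes "optimally_dense_packing \<nu> B P"
  shows "\<exists>x v. norm v = 2 * r \<and> P = ball_packing r (hex x v)"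
proof -
  obtain \<mu> where mu: "optimally_dense_measure B \<mu>" "P \<in> measure_support B \<mu>"
    using assms unfolding optimally_dense_packing_def generic_packing_def by blast
  then have "\<mu> \<in> invariant_measures B" "measure_density B \<mu> = max_density"
    using mu0_optimal(2) by (auto simp: optimally_dense_measure_def ergodic_measures_def)
  then show ?thesis using optimal_support_hex mu(2) by blast
qed

lemma hex_congruent:
  assumes "norm v = 2 * r" "norm w = 2 * r"
  shows "\<exists>g\<in>rigid_motions. ball_packing r (hex y w) = move_packing g (ball_packing r (hex x v))"
proof -
  \<comment> \<open>The complex quotient w / v, a unit because both vectors have length
    \<open>2 * r\<close>.\<close>
  define z where "z = (1 / (2 * r)\<^sup>2) *\<^sub>R cmul w (conj2 v)"
  have "norm z = 1" using r_pos assms by (simp add: z_def norm_cmul power2_eq_square)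
  have v2: "v $ 1 * v $ 1 + v $ 2 * v $ 2 = (2 * r)\<^sup>2" using norm_sq_real2[of v] assms(1) by (simp add: power2_eq_square)
  have "cmul (cmul w (conj2 v)) v = (v $ 1 * v $ 1 + v $ 2 * v $ 2) *\<^sub>R w"
    by (simp add: real2_eq_iff algebra_simps)
  moreover have "cmul (a *\<^sub>R u) v = a *\<^sub>R cmul u v" for a u by (simp add: real2_eq_iff algebra_simps)
  ultimately have zv: "cmul z v = w" using r_pos unfolding z_def v2 by simp
  let ?g = "motion (y - cmul z x) z"
  have g: "?g \<in> rigid_motions" using \<open>norm z = 1\<close> by (rule motion_rigid)
  have "?g ` hex x v = hex y w" using motion_hex[OF \<open>norm z = 1\<close>, of "y - cmul z x" x v] zv by (simp add: motion_def)
  then show ?thesis using move_ball_packing[OF g, of r "hex x v"] g by metis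
qed

end

theorem theorem1:
  fixes r :: real and c :: "real^2" and \<nu> :: "(real^2 \<Rightarrow> real^2) measure"
  assumes "r > 0" and "haar_measure \<nu>"
  shows "(\<exists>P. optimally_dense_packing \<nu> {cball c r} P) \<and>
         (\<forall>P Q. optimally_dense_packing \<nu> {cball c r} P \<and> optimally_dense_packing \<nu> {cball c r} Q \<longrightarrow>
            (\<exists>g\<in>rigid_motions. Q = move_packing g P))"
proof -
  interpret hex_orbit r c \<nu> using assms by unfold_locales
  have "optimally_dense_packing \<nu> {cball c r} P0"
    unfolding optimally_dense_packing_def using mu0_optimal(1) P0_generic by blast
  moreover have "\<exists>g\<in>rigid_motions. Q = move_packing g P"
    if "optimally_dense_packing \<nu> {cball c r} P" "optimally_dense_packing \<nu> {cball c r} Q" for P Q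
    using optimally_dense_is_hex[OF that(1)] optimally_dense_is_hex[OF that(2)] hex_congruent by blast
  ultimately show ?thesis by blast
qed

end
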